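(* Let $\beta>0$ and let $\Omega\subset\mathbf{R}^2\simeq\mathbf{C}$ be the interior of a convex polygon with vertices $z_1,\dots,z_n$ and sides $\Gamma_i=(z_i,z_{i+1})$. Suppose the distributions $q_i,\partial_{\mathbf n}q_i\in\mathcal{E}'[0,1]$ ($i=1,\dots,n$; here $\partial_{\mathbf n}q_i$ is merely the name of a distribution) are such that the global relation \[ \sum_{i=1}^n\rho_i(\lambda)=0\qquad\text{for all }\lambda\in\mathbf{C}\setminus\{0\} \] is satisfied, where \[ \frac{\rho_i(\lambda)}{|\Gamma_i|}=\left\langle \partial_{\mathbf n}q_i,\ \psi_i^*\!\left(e^{-\mathrm{i}\lambda z'+\mathrm{i}\beta^2\bar z'/\lambda}\right)\right\rangle+\left(\lambda e^{\mathrm{i}\alpha_i}+\frac{\beta^2}{\lambda e^{\mathrm{i}\alpha_i}}\right)\left\langle q_i,\ \psi_i^*\!\left(e^{-\mathrm{i}\lambda z'+\mathrm{i}\beta^2\bar z'/\lambda}\right)\right\rangle. \] Suppose that for some $1\le i\le n$ and some $s\in\mathbf{R}$ the natural extension of $q_i$ to a compactly supported distribution on $\mathbf{R}$ belongs to $H^s(\mathbf{R})$. Then $\partial_{\mathbf n}q_i\in H^{s-1}_{\mathrm{loc}}(0,1)$.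
   Context: The polygon is bounded and convex, its vertices $z_1,\dots,z_n$ are listed counterclockwise (indices modulo $n$), $\Gamma_i=(z_i,z_{i+1})$ is the open side, $\alpha_i=\arg(z_{i+1}-z_i)$, and $|\Gamma_i|$ is the length of $\Gamma_i$. The parametrisation is $\psi_i(\tau)=\tau z_{i+1}+(1-\tau)z_i$, $\tau\in[0,1]$, and $\psi_i^*(f)(\tau)=f(\psi_i(\tau))$. $\mathcal{E}[0,1]$ is the Fréchet space of smooth functions $[0,1]\to\mathbf{C}$ with semi-norms $\delta_n(\varphi)=\max_{[0,1]}|\varphi^{(n)}|$, $n\ge0$; $\mathcal{E}'[0,1]$ is its topological dual, with pairing $\langle\cdot,\cdot\rangle$. The natural extension of $u\in\mathcal{E}'[0,1]$ to a distribution on $\mathbf{R}$ supported in $[0,1]$ is $\varphi\mapsto\langle u,\varphi|_{[0,1]}\rangle$. $H^s(\mathbf{R})$ is the usual $L^2$-based Sobolev space, and $u\in H^{s-1}_{\mathrm{loc}}(0,1)$ means that $\varphi u\in H^{s-1}(\mathbf{R})$ for every $\varphi\in C_c^\infty(0,1)$. *)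

theory Defs
  imports "HOL-Analysis.Analysis"
begin

section \<open>Smooth functions\<close>

text \<open>
  Derivatives are taken within \<open>S\<close>: for \<open>S = UNIV\<close> they are the usual ones, and for
  \<open>S = {0..1}\<close> they are one-sided at the end points. For \<open>S = {0..1}\<close> only the values of
  \<open>f\<close> on \<open>S\<close> matter, so total functions serve as representatives of functions on \<open>[0,1]\<close>.
\<close>

definition nderiv_within :: "real set \<Rightarrow> nat \<Rightarrow> (real \<Rightarrow> complex) \<Rightarrow> real \<Rightarrow> complex" where
  "nderiv_within S k f = ((\<lambda>g t. vector_derivative g (at t within S)) ^^ k) f"

definition smooth_on :: "real set \<Rightarrow> (real \<Rightarrow> complex) set" where
  "smooth_on S = {f. \<forall>k. \<forall>t\<in>S. nderiv_within S k f differentiable (at t within S)}"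

section \<open>Topological duals\<close>

text \<open>
  The space \<open>X\<close> carries the locally convex topology generated by the semi-norms \<open>p i\<close>; the
  condition on \<open>u\<close> is linearity on \<open>X\<close> and continuity at every point of \<open>X\<close>. The values of \<open>u\<close>
  outside \<open>X\<close> carry no information.
\<close>

definition topological_dual ::
  "(real \<Rightarrow> complex) set \<Rightarrow> ('i \<Rightarrow> (real \<Rightarrow> complex) \<Rightarrow> real) \<Rightarrow> ((real \<Rightarrow> complex) \<Rightarrow> complex) set"
where
  "topological_dual X p = {u.
     (\<forall>f\<in>X. \<forall>g\<in>X. u (\<lambda>x. f x + g x) = u f + u g) \<and>
     (\<forall>c. \<forall>f\<in>X. u (\<lambda>x. c * f x) = c * u f) \<and>
     (\<forall>f\<in>X. \<forall>e>0. \<exists>I d. finite I \<and> d > 0 \<and>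
        (\<forall>g\<in>X. (\<forall>i\<in>I. p i (\<lambda>x. g x - f x) < d) \<longrightarrow> cmod (u g - u f) < e))}"

definition seminorm01 :: "nat \<Rightarrow> (real \<Rightarrow> complex) \<Rightarrow> real" where
  "seminorm01 k f = (SUP t\<in>{0..1}. cmod (nderiv_within {0..1} k f t))"

definition dual01 :: "((real \<Rightarrow> complex) \<Rightarrow> complex) set" where
  "dual01 = topological_dual (smooth_on {0..1}) seminorm01"

section \<open>Tempered distributions and Sobolev spaces on the line\<close>

definition schwartz_space :: "(real \<Rightarrow> complex) set" where
  "schwartz_space = {f \<in> smooth_on UNIV.
     \<forall>j k. bdd_above (range (\<lambda>x. \<bar>x\<bar> ^ j * cmod (nderiv_within UNIV k f x)))}"

definition schwartz_seminorm :: "nat \<times> nat \<Rightarrow> (real \<Rightarrow> complex) \<Rightarrow> real" where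
  "schwartz_seminorm = (\<lambda>(j, k) f. SUP x. \<bar>x\<bar> ^ j * cmod (nderiv_within UNIV k f x))"

definition tempered_distributions :: "((real \<Rightarrow> complex) \<Rightarrow> complex) set" where
  "tempered_distributions = topological_dual schwartz_space schwartz_seminorm"

definition fourier :: "(real \<Rightarrow> complex) \<Rightarrow> real \<Rightarrow> complex" where
  "fourier f \<xi> = (\<integral>x. exp (- \<i> * of_real (x * \<xi>)) * f x \<partial>lborel)"

text \<open>
  \<open>u\<close> belongs to \<open>H\<^sup>s\<close> if its Fourier transform, the distribution \<open>\<phi> \<mapsto> u (fourier \<phi>)\<close>, is given by
  a function \<open>g\<close> that is square integrable with weight \<open>(1 + \<xi>\<^sup>2)\<^sup>s\<close>.
\<close>

definition sobolev :: "real \<Rightarrow> ((real \<Rightarrow> complex) \<Rightarrow> complex) set" where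
  "sobolev s = {u \<in> tempered_distributions. \<exists>g \<in> borel_measurable lborel.
     integrable lborel (\<lambda>\<xi>. (1 + \<xi>\<^sup>2) powr s * (cmod (g \<xi>))\<^sup>2) \<and>
     (\<forall>\<phi>\<in>schwartz_space. u (fourier \<phi>) = (\<integral>\<xi>. g \<xi> * \<phi> \<xi> \<partial>lborel))}"

definition natural_extension ::
  "((real \<Rightarrow> complex) \<Rightarrow> complex) \<Rightarrow> (real \<Rightarrow> complex) \<Rightarrow> complex" where
  "natural_extension u = (\<lambda>\<phi>. u (restrict \<phi> {0..1}))"

definition mult_distribution ::
  "(real \<Rightarrow> complex) \<Rightarrow> ((real \<Rightarrow> complex) \<Rightarrow> complex) \<Rightarrow> (real \<Rightarrow> complex) \<Rightarrow> complex" where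
  "mult_distribution \<phi> u = (\<lambda>f. u (\<lambda>x. \<phi> x * f x))"

definition test_functions01 :: "(real \<Rightarrow> complex) set" where
  "test_functions01 = {\<phi> \<in> smooth_on UNIV. closure {x. \<phi> x \<noteq> 0} \<subseteq> {0<..<1}}"

definition sobolev_loc01 :: "real \<Rightarrow> ((real \<Rightarrow> complex) \<Rightarrow> complex) set" where
  "sobolev_loc01 s = {u. \<forall>\<phi>\<in>test_functions01. mult_distribution \<phi> (natural_extension u) \<in> sobolev s}"

section \<open>Convex polygons\<close>

text \<open>
  The vertices are \<open>z 0, \<dots>, z (n - 1)\<close>, with indices taken modulo \<open>n\<close>. The last condition
  expresses the counterclockwise order: the interior lies to the left of each directed side.
\<close>

definition convex_polygon :: "nat \<Rightarrow> (nat \<Rightarrow> complex) \<Rightarrow> complex set \<Rightarrow> bool" where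
  "convex_polygon n z \<Omega> \<longleftrightarrow>
     n \<ge> 3 \<and> inj_on z {..<n} \<and>
     \<Omega> = interior (convex hull (z ` {..<n})) \<and>
     {w. w extreme_point_of (convex hull (z ` {..<n}))} = z ` {..<n} \<and>
     frontier \<Omega> = (\<Union>i<n. closed_segment (z i) (z (Suc i mod n))) \<and>
     (\<forall>i<n. \<forall>w\<in>\<Omega>. Im (cnj (z (Suc i mod n) - z i) * (w - z i)) > 0)"

section \<open>The global relation\<close>

definition side_angle :: "nat \<Rightarrow> (nat \<Rightarrow> complex) \<Rightarrow> nat \<Rightarrow> real" where
  "side_angle n z i = Arg (z (Suc i mod n) - z i)"

definition side_length :: "nat \<Rightarrow> (nat \<Rightarrow> complex) \<Rightarrow> nat \<Rightarrow> real" where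
  "side_length n z i = dist (z i) (z (Suc i mod n))"

definition side_param :: "nat \<Rightarrow> (nat \<Rightarrow> complex) \<Rightarrow> nat \<Rightarrow> real \<Rightarrow> complex" where
  "side_param n z i \<tau> = of_real \<tau> * z (Suc i mod n) + of_real (1 - \<tau>) * z i"

definition exp_kernel :: "real \<Rightarrow> complex \<Rightarrow> complex \<Rightarrow> complex" where
  "exp_kernel \<beta> \<mu> w = exp (- \<i> * \<mu> * w + \<i> * of_real (\<beta>\<^sup>2) * cnj w / \<mu>)"

definition rho ::
  "real \<Rightarrow> nat \<Rightarrow> (nat \<Rightarrow> complex) \<Rightarrow> (nat \<Rightarrow> (real \<Rightarrow> complex) \<Rightarrow> complex) \<Rightarrow>
   (nat \<Rightarrow> (real \<Rightarrow> complex) \<Rightarrow> complex) \<Rightarrow> nat \<Rightarrow> complex \<Rightarrow> complex" where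
  "rho \<beta> n z q dq i \<mu> = of_real (side_length n z i) *
     (dq i (exp_kernel \<beta> \<mu> \<circ> side_param n z i)
      + (\<mu> * exp (\<i> * of_real (side_angle n z i))
         + of_real (\<beta>\<^sup>2) / (\<mu> * exp (\<i> * of_real (side_angle n z i))))
        * q i (exp_kernel \<beta> \<mu> \<circ> side_param n z i))"

end

theory Submission
  imports Defs "HOL-Probability.Characteristic_Functions" "HOL-Probability.Sinc_Integral"
begin

text \<open>
  Let \<open>l\<close> be the length of the side \<open>\<Gamma>\<^sub>i\<close>, and let \<open>(l X, y)\<close> be the Cartesian coordinates in
  which \<open>\<Gamma>\<^sub>i\<close> is the segment \<open>0 < X < 1\<close>, \<open>y = 0\<close> and the polygon lies in \<open>y \<ge> 0\<close>. For real
  \<open>\<eta>\<close> put \<open>S \<eta> = sqrt (\<eta>\<^sup>2 / l\<^sup>2 + 4 \<beta>\<^sup>2)\<close> and evaluate the global relation at the spectral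
  parameter \<open>exp (- \<i> \<alpha>\<^sub>i) k\<close> with \<open>k = (\<eta> / l - S \<eta>) / 2 < 0\<close>. Then \<open>l (k - \<beta>\<^sup>2 / k) = \<eta>\<close> and
  \<open>k + \<beta>\<^sup>2 / k = - S \<eta>\<close>, so that, up to a factor independent of the point, the kernel becomes the
  wave \<open>exp (- \<i> X \<eta> - y S \<eta>)\<close>, which is bounded on the polygon and purely oscillating on the
  side \<open>\<Gamma>\<^sub>i\<close>. The global relation now says that the Fourier transforms \<open>u\<close> of the Neumann datum
  and \<open>v\<close> of the Dirichlet datum on \<open>\<Gamma>\<^sub>i\<close> satisfy \<open>u = S v + G\<close>, where \<open>G\<close> collects the pairings
  of the data on the other sides with waves.

  Multiplying the Neumann datum by a test function \<open>\<phi>\<close> means convolving \<open>u\<close> with the rapidly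
  decreasing Fourier transform \<open>h\<close> of \<open>\<phi>\<close>. Since \<open>S\<close> grows linearly, the term \<open>S v\<close> loses one
  Sobolev order (\<open>multiplier_convolution\<close>: Peetre's inequality and Young's inequality). It remains
  to see that the convolution of \<open>h\<close> with \<open>G\<close> is rapidly decreasing, which expresses that the data
  on the other sides produce a smooth contribution away from the corners. There are two
  mechanisms. At points with \<open>y \<ge> \<delta> > 0\<close> the wave itself decreases exponentially
  (\<open>decay_off_axis\<close>). At points whose abscissa \<open>X\<close> is outside the support of \<open>\<phi>\<close>, all moments of
  \<open>h \<zeta> exp (\<i> X \<zeta>)\<close> vanish, because by Fourier inversion they are derivatives of \<open>\<phi>\<close> at \<open>X\<close>;
  expanding \<open>exp (- y S)\<close> by Taylor's formula then leaves only the remainder, and this is small to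
  any order because \<open>exp (- y S)\<close> is a symbol uniformly in \<open>y \<ge> 0\<close>: each \<open>\<eta>\<close>-derivative gains a
  factor \<open>1 / (1 + \<bar>\<eta>\<bar>)\<close> (\<open>exp_symbol_bound\<close>, \<open>decay_off_support\<close>). Convexity of the polygon
  enters through \<open>other_side_off_open_side\<close>: the other sides lie in \<open>y \<ge> 0\<close> and do not meet the
  open side \<open>\<Gamma>\<^sub>i\<close>, so that by compactness every point on them is of one of the two kinds.

  The data are only functionals on smooth functions. They enter the estimates through their
  finite order (\<open>order_bound\<close>), and they may be interchanged with integrals of exponentials
  (\<open>functional_exchange\<close>); this turns each estimate for waves, together with its derivatives along a side, into
  one for the pairings.
\<close>

section \<open>Smooth functions and their derivatives\<close>

text \<open>
  A smooth function together with all its derivatives. All estimates are carried out on explicit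
  sequences of derivatives; the iterated operator \<open>nderiv_within\<close> only appears where
  jets are translated into membership in \<open>smooth_on\<close> and back.
\<close>

definition jet :: "real set \<Rightarrow> (nat \<Rightarrow> real \<Rightarrow> complex) \<Rightarrow> bool" where
  "jet S F \<longleftrightarrow> (\<forall>k. \<forall>t\<in>S. (F k has_vector_derivative F (Suc k) t) (at t within S))"

lemma jetD: "jet S F \<Longrightarrow> t \<in> S \<Longrightarrow> (F k has_vector_derivative F (Suc k) t) (at t within S)"
  by (simp add: jet_def)

lemma jet_subset: "jet S F \<Longrightarrow> T \<subseteq> S \<Longrightarrow> jet T F"
  unfolding jet_def by (meson has_vector_derivative_within_subset subsetD)

lemma jet_shift: "jet S F \<Longrightarrow> jet S (\<lambda>k. F (k + m))"
  by (simp add: jet_def)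

lemma jet_continuous: "jet S F \<Longrightarrow> continuous_on S (F k)"
  unfolding jet_def by (auto simp: continuous_on_eq_continuous_within intro: has_vector_derivative_continuous)

lemma nderiv_within_0 [simp]: "nderiv_within S 0 f = f"
  by (simp add: nderiv_within_def)

lemma nderiv_within_Suc:
  "nderiv_within S (Suc k) f t = vector_derivative (nderiv_within S k f) (at t within S)"
  by (simp add: nderiv_within_def)

lemma jet_nderiv_within: "f \<in> smooth_on S \<Longrightarrow> jet S (\<lambda>k. nderiv_within S k f)"
  by (simp add: jet_def smooth_on_def nderiv_within_Suc vector_derivative_works)

lemma at_within_unit_interval_neq_bot: "t \<in> {0..1::real} \<Longrightarrow> at t within {0..1} \<noteq> bot"
  by (simp add: trivial_limit_within islimpt_Icc)

text \<open>
  Derivatives within \<open>S\<close> are unique as soon as no point of \<open>S\<close> is isolated, hence any jet of \<open>f\<close>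
  computes the iterated derivatives of \<open>f\<close>.
\<close>

lemma nderiv_within_jet:
  assumes S: "\<And>t. t \<in> S \<Longrightarrow> at t within S \<noteq> bot"
    and F: "jet S F" and t: "t \<in> S" and f: "\<And>t. t \<in> S \<Longrightarrow> f t = F 0 t"
  shows "nderiv_within S k f t = F k t"
  using t
proof (induction k arbitrary: t)
  case 0
  then show ?case by (simp add: f)
next
  case (Suc k)
  have "(nderiv_within S k f has_vector_derivative F (Suc k) t) (at t within S)"
    by (rule has_vector_derivative_transform[OF Suc.prems Suc.IH jetD[OF F Suc.prems]])
  then show ?case
    using vector_derivative_within[OF S[OF Suc.prems]] by (simp add: nderiv_within_Suc)
qed

lemma jet_imp_smooth_on:
  assumes S: "\<And>t. t \<in> S \<Longrightarrow> at t within S \<noteq> bot"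
    and F: "jet S F" and f: "\<And>t. t \<in> S \<Longrightarrow> f t = F 0 t"
  shows "f \<in> smooth_on S"
proof -
  have "(nderiv_within S k f has_vector_derivative F (Suc k) t) (at t within S)" if "t \<in> S" for k t
    by (rule has_vector_derivative_transform[OF that _ jetD[OF F that]])
       (rule nderiv_within_jet[OF S F _ f])
  then show ?thesis
    unfolding smooth_on_def using differentiableI_vector by blast
qed

lemma smooth_on_unit_intervalI:
  "jet {0..1} F \<Longrightarrow> (\<And>t. t \<in> {0..1} \<Longrightarrow> f t = F 0 t) \<Longrightarrow> f \<in> smooth_on {0..1}"
  by (rule jet_imp_smooth_on[OF at_within_unit_interval_neq_bot])

lemma nderiv_unit_interval:
  "jet {0..1} F \<Longrightarrow> t \<in> {0..1} \<Longrightarrow> nderiv_within {0..1} k (F 0) t = F k t"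
  by (rule nderiv_within_jet[OF at_within_unit_interval_neq_bot]) (assumption | rule refl)+

lemma smooth_on_UNIV_I: "jet UNIV F \<Longrightarrow> F 0 \<in> smooth_on UNIV"
  by (rule jet_imp_smooth_on) auto

lemma nderiv_UNIV: "jet UNIV F \<Longrightarrow> nderiv_within UNIV k (F 0) = F k"
  by (rule ext, rule nderiv_within_jet) auto

lemma jet_add: "jet S F \<Longrightarrow> jet S G \<Longrightarrow> jet S (\<lambda>k t. F k t + G k t)"
  unfolding jet_def by (auto intro!: derivative_eq_intros)

lemma jet_diff: "jet S F \<Longrightarrow> jet S G \<Longrightarrow> jet S (\<lambda>k t. F k t - G k t)"
  unfolding jet_def by (auto intro!: derivative_eq_intros)

lemma jet_cmult: "jet S F \<Longrightarrow> jet S (\<lambda>k t. c * F k t)"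
  unfolding jet_def by (auto intro!: derivative_eq_intros)

text \<open>
  Leibniz' rule; the induction step is Pascal's identity.
\<close>

lemma jet_mult:
  assumes F: "jet S F" and G: "jet S G"
  shows "jet S (\<lambda>k t. \<Sum>j\<le>k. of_nat (k choose j) * (F j t * G (k - j) t))"
  unfolding jet_def
proof (intro allI ballI)
  fix k t assume t: "t \<in> S"
  let ?f = "\<lambda>j. F j t" and ?g = "\<lambda>j. G j t"
  have "((\<lambda>t. \<Sum>j\<le>k. of_nat (k choose j) * (F j t * G (k - j) t)) has_vector_derivative
      (\<Sum>j\<le>k. of_nat (k choose j) * (?f j * ?g (Suc (k - j)) + ?f (Suc j) * ?g (k - j))))
      (at t within S)"
    by (intro derivative_intros jetD[OF F t] jetD[OF G t])
  moreover have "(\<Sum>j\<le>k. of_nat (k choose j) * (?f j * ?g (Suc (k - j)) + ?f (Suc j) * ?g (k - j)))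
      = (\<Sum>j\<le>Suc k. of_nat (Suc k choose j) * (?f j * ?g (Suc k - j)))"
  proof -
    have "(\<Sum>j\<le>Suc k. of_nat (Suc k choose j) * (?f j * ?g (Suc k - j)))
        = ?f 0 * ?g (Suc k) + (\<Sum>j\<le>k. of_nat (Suc k choose Suc j) * (?f (Suc j) * ?g (k - j)))"
      by (subst sum.atMost_Suc_shift) simp
    also have "\<dots> = ?f 0 * ?g (Suc k)
        + (\<Sum>j\<le>k. of_nat (k choose Suc j) * (?f (Suc j) * ?g (k - j)))
        + (\<Sum>j\<le>k. of_nat (k choose j) * (?f (Suc j) * ?g (k - j)))"
      by (simp add: sum.distrib algebra_simps)
    also have "?f 0 * ?g (Suc k) + (\<Sum>j\<le>k. of_nat (k choose Suc j) * (?f (Suc j) * ?g (k - j)))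
        = (\<Sum>j\<le>Suc k. of_nat (k choose j) * (?f j * ?g (Suc k - j)))"
      by (subst sum.atMost_Suc_shift) simp
    also have "\<dots> = (\<Sum>j\<le>k. of_nat (k choose j) * (?f j * ?g (Suc (k - j))))"
      by (simp add: binomial_eq_0 Suc_diff_le)
    finally show ?thesis
      by (simp add: sum.distrib algebra_simps)
  qed
  ultimately show "((\<lambda>t. \<Sum>j\<le>k. of_nat (k choose j) * (F j t * G (k - j) t)) has_vector_derivative
      (\<Sum>j\<le>Suc k. of_nat (Suc k choose j) * (F j t * G (Suc k - j) t))) (at t within S)"
    by simp
qed

lemma jet_unit_interval_bounded:
  assumes "jet {0..1} F"
  shows "\<exists>B>0. \<forall>k\<le>N. \<forall>t\<in>{0..1}. cmod (F k t) \<le> B"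
proof (induction N)
  have *: "\<exists>B>0. \<forall>t\<in>{0..1}. cmod (F k t) \<le> B" for k
  proof -
    have "compact (F k ` {0..1})"
      using jet_continuous[OF assms] by (intro compact_continuous_image) auto
    then show ?thesis
      using compact_imp_bounded bounded_pos by (metis imageI)
  qed
  { case 0 show ?case using *[of 0] by simp }
  { case (Suc N)
    then obtain B B' where "B > 0" "\<forall>k\<le>N. \<forall>t\<in>{0..1}. cmod (F k t) \<le> B"
      "B' > 0" "\<forall>t\<in>{0..1}. cmod (F (Suc N) t) \<le> B'" using *[of "Suc N"] by blast
    then show ?case
      by (intro exI[of _ "B + B'"]) (auto simp: le_Suc_eq add_increasing add_increasing2) }
qed

lemma seminorm01_le:
  assumes "jet {0..1} F" "\<And>t. t \<in> {0..1} \<Longrightarrow> cmod (F k t) \<le> B"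
  shows "seminorm01 k (F 0) \<le> B"
  unfolding seminorm01_def
  by (rule cSUP_least) (use nderiv_unit_interval[OF assms(1)] assms(2) in auto)

lemma le_seminorm01:
  assumes F: "jet {0..1} F" and t: "t \<in> {0..1}"
  shows "cmod (F k t) \<le> seminorm01 k (F 0)"
proof -
  obtain B where "\<forall>t\<in>{0..1}. cmod (F k t) \<le> B"
    using jet_unit_interval_bounded[OF F, of k] by blast
  then have "bdd_above ((\<lambda>t. cmod (nderiv_within {0..1} k (F 0) t)) ` {0..1})"
    by (intro bdd_aboveI2[of _ _ B]) (use nderiv_unit_interval[OF F] in auto)
  then show ?thesis
    unfolding seminorm01_def using nderiv_unit_interval[OF F t] cSUP_upper[OF t] by metis
qed

lemma dual01_add: "u \<in> dual01 \<Longrightarrow> f \<in> smooth_on {0..1} \<Longrightarrow> g \<in> smooth_on {0..1} \<Longrightarrow>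
    u (\<lambda>x. f x + g x) = u f + u g"
  and dual01_cmult: "u \<in> dual01 \<Longrightarrow> f \<in> smooth_on {0..1} \<Longrightarrow> u (\<lambda>x. c * f x) = c * u f"
  by (auto simp: dual01_def topological_dual_def)

lemma jet_smooth01: "jet {0..1} F \<Longrightarrow> F 0 \<in> smooth_on {0..1}"
  by (rule smooth_on_unit_intervalI) auto

lemma dual01_diff:
  assumes u: "u \<in> dual01" and F: "jet {0..1} F" and G: "jet {0..1} G"
  shows "u (\<lambda>x. F 0 x - G 0 x) = u (F 0) - u (G 0)"
  using dual01_add[OF u jet_smooth01[OF F] jet_smooth01[OF jet_cmult[OF G]], of "-1"]
    dual01_cmult[OF u jet_smooth01[OF G], of "-1"] by simp

lemma dual01_continuous:
  assumes "u \<in> dual01" and f: "f \<in> smooth_on {0..1}" and e: "e > 0"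
  shows "\<exists>I d. finite I \<and> d > 0 \<and>
        (\<forall>g\<in>smooth_on {0..1}. (\<forall>i\<in>I. seminorm01 i (\<lambda>x. g x - f x) < d) \<longrightarrow> cmod (u g - u f) < e)"
proof -
  have "\<forall>f\<in>smooth_on {0..1}. \<forall>e>0. \<exists>I d. finite I \<and> d > 0 \<and>
        (\<forall>g\<in>smooth_on {0..1}. (\<forall>i\<in>I. seminorm01 i (\<lambda>x. g x - f x) < d) \<longrightarrow> cmod (u g - u f) < e)"
    using assms(1) unfolding dual01_def topological_dual_def mem_Collect_eq by (elim conjE)
  from bspec[OF this f] show ?thesis using e by (elim allE impE)
qed

text \<open>
  A functional of order at most \<open>N\<close>. For linear functionals on smooth functions on \<open>[0,1]\<close> this is
  the quantitative form of continuity.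
\<close>

definition order_bound :: "((real \<Rightarrow> complex) \<Rightarrow> complex) \<Rightarrow> real \<Rightarrow> nat \<Rightarrow> bool" where
  "order_bound u C N \<longleftrightarrow> C > 0 \<and> (\<forall>F B. jet {0..1} F \<longrightarrow>
     (\<forall>k\<le>N. \<forall>t\<in>{0..1}. cmod (F k t) \<le> B) \<longrightarrow> cmod (u (F 0)) \<le> C * B)"

lemma order_boundD:
  assumes "order_bound u C N" "jet {0..1} F"
    "\<And>k t. k \<le> N \<Longrightarrow> t \<in> {0..1} \<Longrightarrow> cmod (F k t) \<le> B"
  shows "cmod (u (F 0)) \<le> C * B"
  using assms unfolding order_bound_def by blast

lemma order_bound_pos: "order_bound u C N \<Longrightarrow> C > 0"
  by (simp add: order_bound_def)

text \<open>
  Continuity at \<open>0\<close> yields a neighbourhood on which \<open>u\<close> is bounded by \<open>1\<close>; scaling a function into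
  this neighbourhood gives the bound.
\<close>

lemma dual01_bounded:
  assumes u: "u \<in> dual01"
  shows "\<exists>C N. order_bound u C N"
proof -
  have zero: "(\<lambda>x. 0) \<in> smooth_on {0..1}"
    by (rule smooth_on_unit_intervalI[of "\<lambda>k x. 0"]) (auto simp: jet_def)
  have u0: "u (\<lambda>x. 0) = 0"
    using dual01_cmult[OF u zero, of 0] by simp
  from dual01_continuous[OF u zero, of 1] obtain I d where I: "finite I" and d: "d > 0"
    and *: "\<And>g. g \<in> smooth_on {0..1} \<Longrightarrow> (\<And>i. i \<in> I \<Longrightarrow> seminorm01 i g < d) \<Longrightarrow> cmod (u g) < 1"
    by (auto simp: u0)
  obtain N where N: "\<And>i. i \<in> I \<Longrightarrow> i \<le> N"
    using I by (meson finite_nat_set_iff_bounded_le)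
  have pos: "cmod (u (F 0)) \<le> 2 / d * B"
    if F: "jet {0..1} F" and B: "\<And>k t. k \<le> N \<Longrightarrow> t \<in> {0..1} \<Longrightarrow> cmod (F k t) \<le> B" and "B > 0" for F B
  proof -
    define c where "c = d / (2 * B)"
    have c: "c > 0" using d \<open>B > 0\<close> by (simp add: c_def)
    have "cmod (u (\<lambda>x. of_real c * F 0 x)) < 1"
    proof (rule *)
      show "(\<lambda>x. of_real c * F 0 x) \<in> smooth_on {0..1}"
        by (rule jet_smooth01[OF jet_cmult[OF F]])
      fix i assume "i \<in> I"
      have "seminorm01 i (\<lambda>x. of_real c * F 0 x) \<le> c * B"
        using c B[OF N[OF \<open>i \<in> I\<close>]] by (intro seminorm01_le[OF jet_cmult[OF F]]) (auto simp: norm_mult)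
      also have "c * B < d" using d \<open>B > 0\<close> by (simp add: c_def)
      finally show "seminorm01 i (\<lambda>x. of_real c * F 0 x) < d" .
    qed
    then have "c * cmod (u (F 0)) < 1"
      using dual01_cmult[OF u jet_smooth01[OF F]] c by (simp add: norm_mult)
    then show ?thesis
      using d \<open>B > 0\<close> by (simp add: c_def field_simps)
  qed
  have "order_bound u (2 / d) N"
    unfolding order_bound_def
  proof (intro conjI allI impI)
    show "2 / d > 0" using d by simp
    fix F B assume F: "jet {0..1} F" and B': "\<forall>k\<le>N. \<forall>t\<in>{0..1}. cmod (F k t) \<le> B"
    then have B: "cmod (F k t) \<le> B" if "k \<le> N" "t \<in> {0..1}" for k t using that by blast
    have "B \<ge> 0" using order_trans[OF norm_ge_zero B[of 0 0]] by simp
    show "cmod (u (F 0)) \<le> 2 / d * B"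
    proof (rule field_le_epsilon)
      fix e :: real assume "e > 0"
      have "cmod (u (F 0)) \<le> 2 / d * (B + e * d / 2)"
        by (rule pos[OF F]) (use order_trans[OF B] \<open>B \<ge> 0\<close> d \<open>e > 0\<close> in \<open>auto intro!: add_nonneg_pos\<close>)
      then show "cmod (u (F 0)) \<le> 2 / d * B + e"
        using d by (simp add: field_simps)
    qed
  qed
  then show ?thesis by blast
qed

text \<open>
  The space \<open>smooth_on {0..1}\<close> consists of total functions. If two of them agree on \<open>[0,1]\<close>, all
  derivatives of the difference vanish there, so a functional of finite order cannot separate them.
\<close>

lemma dual01_cong:
  assumes u: "u \<in> dual01" and f: "f \<in> smooth_on {0..1}" and eq: "\<And>t. t \<in> {0..1} \<Longrightarrow> g t = f t"
  shows "u g = u f"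
proof -
  let ?F = "\<lambda>k. nderiv_within {0..1} k f"
  have F: "jet {0..1} ?F" by (rule jet_nderiv_within[OF f])
  define G where "G = (\<lambda>k::nat. if k = 0 then g else ?F k)"
  have G: "jet {0..1} G"
    unfolding jet_def
  proof (intro allI ballI)
    fix k t assume t: "t \<in> {0..1::real}"
    show "(G k has_vector_derivative G (Suc k) t) (at t within {0..1})"
      by (rule has_vector_derivative_transform[OF t, of "G k" "?F k"])
         (use jetD[OF F t, of k] in \<open>auto simp: G_def eq\<close>)
  qed
  obtain C N where ob: "order_bound u C N"
    using dual01_bounded[OF u] by blast
  note C = order_boundD[OF ob]
  have "C > 0" by (rule order_bound_pos[OF ob])
  have "cmod (u (\<lambda>x. G 0 x - ?F 0 x)) \<le> C * 0"
  proof (rule C[OF jet_diff[OF G F]])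
    fix k t assume "t \<in> {0..1::real}"
    then show "cmod (G k t - ?F k t) \<le> 0" by (simp add: G_def eq)
  qed
  then show ?thesis
    using dual01_diff[OF u G F] by (simp add: G_def)
qed

lemma smooth01_mult:
  "f \<in> smooth_on {0..1} \<Longrightarrow> g \<in> smooth_on {0..1} \<Longrightarrow> (\<lambda>x. f x * g x) \<in> smooth_on {0..1}"
  using jet_smooth01[OF jet_mult[OF jet_nderiv_within jet_nderiv_within], of f g] by simp

lemma dual01_mult:
  assumes u: "u \<in> dual01" and \<phi>: "\<phi> \<in> smooth_on {0..1}"
  shows "(\<lambda>f. u (\<lambda>x. \<phi> x * f x)) \<in> dual01"
proof -
  let ?P = "\<lambda>k. nderiv_within {0..1} k \<phi>"
  have P: "jet {0..1} ?P" by (rule jet_nderiv_within[OF \<phi>])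
  obtain C N where ob: "order_bound u C N"
    using dual01_bounded[OF u] by blast
  note C = order_boundD[OF ob]
  have "C > 0" by (rule order_bound_pos[OF ob])
  obtain A where "A > 0" and A: "\<And>k t. k \<le> N \<Longrightarrow> t \<in> {0..1} \<Longrightarrow> cmod (?P k t) \<le> A"
    using jet_unit_interval_bounded[OF P, of N] by blast
  have cont: "\<exists>I d. finite I \<and> d > 0 \<and>
        (\<forall>g\<in>smooth_on {0..1}. (\<forall>i\<in>I. seminorm01 i (\<lambda>x. g x - f x) < d) \<longrightarrow>
          cmod (u (\<lambda>x. \<phi> x * g x) - u (\<lambda>x. \<phi> x * f x)) < e)"
    if f: "f \<in> smooth_on {0..1}" and e: "e > 0" for f and e :: real
  proof -
    define D where "D = C * (2 ^ N * A)"
    have D: "D > 0" using \<open>C > 0\<close> \<open>A > 0\<close> by (simp add: D_def)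
    show ?thesis
    proof (intro exI conjI ballI impI)
      show "finite {..N}" by simp
      show "e / (2 * D) > 0" using e D by simp
      fix g assume g: "g \<in> smooth_on {0..1}" and "\<forall>i\<in>{..N}. seminorm01 i (\<lambda>x. g x - f x) < e / (2 * D)"
      then have lt: "\<And>i. i \<le> N \<Longrightarrow> seminorm01 i (\<lambda>x. g x - f x) < e / (2 * D)" by simp
      let ?f = "\<lambda>k. nderiv_within {0..1} k f" and ?g = "\<lambda>k. nderiv_within {0..1} k g"
      let ?h = "\<lambda>k t. ?g k t - ?f k t"
      have h: "jet {0..1} ?h"
        by (intro jet_diff jet_nderiv_within f g)
      have hb: "cmod (?h k t) \<le> e / (2 * D)" if "k \<le> N" "t \<in> {0..1}" for k t
        using le_seminorm01[OF h that(2), of k] lt[OF that(1)] by simp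
      let ?m = "\<lambda>k t. \<Sum>j\<le>k. of_nat (k choose j) * (?P j t * ?h (k - j) t)"
      have "cmod (u (?m 0)) \<le> C * (2 ^ N * (A * (e / (2 * D))))"
      proof (rule C[OF jet_mult[OF P h]])
        fix k t assume k: "k \<le> N" and t: "t \<in> {0..1::real}"
        have "cmod (?m k t) \<le> (\<Sum>j\<le>k. of_nat (k choose j) * (A * (e / (2 * D))))"
        proof (rule order_trans[OF norm_sum sum_mono])
          fix j assume "j \<in> {..k}"
          have "cmod (?P j t * ?h (k - j) t) \<le> A * (e / (2 * D))"
            unfolding norm_mult using \<open>j \<in> {..k}\<close> k t A[of j t] hb[of "k - j" t] \<open>A > 0\<close>
            by (intro mult_mono) auto
          then show "cmod (of_nat (k choose j) * (?P j t * ?h (k - j) t)) \<le> of_nat (k choose j) * (A * (e / (2 * D)))"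
            unfolding norm_mult[of "of_nat _"] by (intro mult_mono) auto
        qed
        also have "\<dots> = 2 ^ k * (A * (e / (2 * D)))"
          unfolding sum_distrib_right[symmetric] of_nat_sum[symmetric] choose_row_sum by simp
        also have "\<dots> \<le> 2 ^ N * (A * (e / (2 * D)))"
          using \<open>A > 0\<close> e D k by (intro mult_right_mono) auto
        finally show "cmod (?m k t) \<le> 2 ^ N * (A * (e / (2 * D)))" .
      qed
      also have "\<dots> = e / 2"
        using \<open>C > 0\<close> \<open>A > 0\<close> by (simp add: D_def field_simps)
      finally have "cmod (u (\<lambda>x. \<phi> x * (g x - f x))) < e" using e by simp
      moreover have "u (\<lambda>x. \<phi> x * (g x - f x)) = u (\<lambda>x. \<phi> x * g x) - u (\<lambda>x. \<phi> x * f x)"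
        using dual01_diff[OF u jet_mult[OF P jet_nderiv_within[OF g]] jet_mult[OF P jet_nderiv_within[OF f]]]
        by (simp add: algebra_simps)
      ultimately show "cmod (u (\<lambda>x. \<phi> x * g x) - u (\<lambda>x. \<phi> x * f x)) < e" by simp
    qed
  qed
  have add: "u (\<lambda>x. \<phi> x * (f x + g x)) = u (\<lambda>x. \<phi> x * f x) + u (\<lambda>x. \<phi> x * g x)"
    if "f \<in> smooth_on {0..1}" "g \<in> smooth_on {0..1}" for f g
    using dual01_add[OF u smooth01_mult[OF \<phi> that(1)] smooth01_mult[OF \<phi> that(2)]]
    by (simp add: algebra_simps)
  have cm: "u (\<lambda>x. \<phi> x * (c * f x)) = c * u (\<lambda>x. \<phi> x * f x)"
    if "f \<in> smooth_on {0..1}" for f c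
    using dual01_cmult[OF u smooth01_mult[OF \<phi> that], of c]
    by (simp add: algebra_simps)
  show ?thesis
    unfolding dual01_def topological_dual_def using add cm cont by simp
qed

section \<open>Schwartz functions and tempered distributions\<close>

lemma smooth_on_UNIV_imp_01: "f \<in> smooth_on UNIV \<Longrightarrow> f \<in> smooth_on {0..1}"
  using jet_smooth01[OF jet_subset[OF jet_nderiv_within[of f UNIV]]] by simp

lemma schwartz_smooth: "f \<in> schwartz_space \<Longrightarrow> f \<in> smooth_on UNIV"
  by (simp add: schwartz_space_def)

lemma schwartz_jet: "f \<in> schwartz_space \<Longrightarrow> jet UNIV (\<lambda>k. nderiv_within UNIV k f)"
  by (rule jet_nderiv_within[OF schwartz_smooth])

lemma jet_imp_schwartz:
  assumes "jet UNIV F" "\<And>j k. \<exists>C. \<forall>x. \<bar>x\<bar> ^ j * cmod (F k x) \<le> C"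
  shows "F 0 \<in> schwartz_space"
  unfolding schwartz_space_def
  using smooth_on_UNIV_I[OF assms(1)] nderiv_UNIV[OF assms(1)] assms(2)
  by (auto simp: bdd_above_def)

lemma schwartz_diff:
  assumes f: "f \<in> schwartz_space" and g: "g \<in> schwartz_space"
  shows "(\<lambda>x. f x - g x) \<in> schwartz_space"
proof -
  let ?F = "\<lambda>k. nderiv_within UNIV k f" and ?G = "\<lambda>k. nderiv_within UNIV k g"
  have *: "\<exists>C. \<forall>x. \<bar>x\<bar> ^ j * cmod (?F k x - ?G k x) \<le> C" for j k
  proof -
    obtain A B where A: "\<And>x. \<bar>x\<bar> ^ j * cmod (?F k x) \<le> A" and B: "\<And>x. \<bar>x\<bar> ^ j * cmod (?G k x) \<le> B"
      using f g unfolding schwartz_space_def bdd_above_def by fastforce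
    have "\<bar>x\<bar> ^ j * cmod (?F k x - ?G k x) \<le> A + B" for x
    proof -
      have "\<bar>x\<bar> ^ j * cmod (?F k x - ?G k x) \<le> \<bar>x\<bar> ^ j * (cmod (?F k x) + cmod (?G k x))"
        by (intro mult_left_mono norm_triangle_ineq4) auto
      then show ?thesis using A[of x] B[of x] by (simp add: algebra_simps)
    qed
    then show ?thesis by blast
  qed
  have "jet UNIV (\<lambda>k x. ?F k x - ?G k x)"
    by (intro jet_diff schwartz_jet f g)
  from jet_imp_schwartz[OF this *] show ?thesis by simp
qed

text \<open>
  The functional \<open>w\<close> stands for an extension of \<open>v\<close> to functions on the line. Such extensions restrict
  their argument to \<open>[0,1]\<close> first, or multiply it by a test function; on smooth functions the order of
  these operations is immaterial, and only there is \<open>w\<close> determined.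
\<close>

lemma dual01_tempered:
  assumes v: "v \<in> dual01" and w: "\<And>f. f \<in> smooth_on UNIV \<Longrightarrow> w f = v f"
  shows "w \<in> tempered_distributions"
proof -
  note sU = schwartz_smooth
  have s01: "f \<in> smooth_on {0..1}" if "f \<in> schwartz_space" for f
    by (rule smooth_on_UNIV_imp_01[OF schwartz_smooth[OF that]])
  have le: "seminorm01 k f \<le> schwartz_seminorm (0, k) f" if f: "f \<in> schwartz_space" for k f
  proof -
    have j: "jet UNIV (\<lambda>k. nderiv_within UNIV k f)" by (rule schwartz_jet[OF f])
    have all: "\<forall>j k. bdd_above (range (\<lambda>x. \<bar>x\<bar> ^ j * cmod (nderiv_within UNIV k f x)))"
      using f unfolding schwartz_space_def by simp
    have b: "bdd_above (range (\<lambda>x. \<bar>x\<bar> ^ 0 * cmod (nderiv_within UNIV k f x)))"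
      by (rule all[rule_format])
    have "seminorm01 k ((\<lambda>k. nderiv_within UNIV k f) 0) \<le> schwartz_seminorm (0, k) f"
      unfolding schwartz_seminorm_def
      using cSUP_upper[OF _ b] by (intro seminorm01_le[OF jet_subset[OF j]]) auto
    then show ?thesis by simp
  qed
  have cont: "\<exists>I d. finite I \<and> d > 0 \<and>
        (\<forall>g\<in>schwartz_space. (\<forall>i\<in>I. schwartz_seminorm i (\<lambda>x. g x - f x) < d) \<longrightarrow> cmod (w g - w f) < e)"
    if f: "f \<in> schwartz_space" and e: "e > 0" for f and e :: real
  proof -
    obtain I d where I: "finite I" "d > 0"
      "\<And>g. g \<in> smooth_on {0..1} \<Longrightarrow> (\<forall>i\<in>I. seminorm01 i (\<lambda>x. g x - f x) < d) \<Longrightarrow> cmod (v g - v f) < e"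
      using dual01_continuous[OF v s01[OF f] e] by metis
    show ?thesis
    proof (intro exI conjI ballI impI)
      show "finite ((\<lambda>i. (0, i)) ` I)" "d > 0" using I by auto
      fix g assume g: "g \<in> schwartz_space"
        and lt: "\<forall>i\<in>(\<lambda>i. (0, i)) ` I. schwartz_seminorm i (\<lambda>x. g x - f x) < d"
      have "cmod (v g - v f) < e"
        using le[OF schwartz_diff[OF g f]] lt by (intro I(3) s01 g) (auto intro: le_less_trans)
      then show "cmod (w g - w f) < e" by (simp add: w sU f g)
    qed
  qed
  have add: "w (\<lambda>x. f x + g x) = w f + w g" if "f \<in> schwartz_space" "g \<in> schwartz_space" for f g
    using w[OF smooth_on_UNIV_I[OF jet_add[OF schwartz_jet[OF that(1)] schwartz_jet[OF that(2)]]]]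
      dual01_add[OF v s01[OF that(1)] s01[OF that(2)]] by (simp add: w sU that)
  have cm: "w (\<lambda>x. c * f x) = c * w f" if "f \<in> schwartz_space" for f c
    using w[OF smooth_on_UNIV_I[OF jet_cmult[OF schwartz_jet[OF that]]]]
      dual01_cmult[OF v s01[OF that]] by (simp add: w sU that)
  show ?thesis
    unfolding tempered_distributions_def topological_dual_def using add cm cont by simp
qed

lemma natural_extension_eq:
  assumes u: "u \<in> dual01" and f: "f \<in> smooth_on UNIV"
  shows "natural_extension u f = u f"
  unfolding natural_extension_def by (rule dual01_cong[OF u smooth_on_UNIV_imp_01[OF f]]) auto

section \<open>Integrals of exponentials and continuous functionals\<close>

text \<open>
  A second-order remainder estimate that is linear in the bound \<open>B\<close> for the second derivative. It can
  therefore be integrated with respect to a parameter, so that differentiation under the integral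
  sign needs no limit theorem.
\<close>

lemma second_order_vector_bound:
  fixes g g1 g2 :: "real \<Rightarrow> complex"
  assumes T: "convex T" "s \<in> T" "t \<in> T"
    and g: "\<And>r. r \<in> T \<Longrightarrow> (g has_vector_derivative g1 r) (at r within T)"
    and g1: "\<And>r. r \<in> T \<Longrightarrow> (g1 has_vector_derivative g2 r) (at r within T)"
    and B: "\<And>r. r \<in> T \<Longrightarrow> norm (g2 r) \<le> B"
  shows "norm (g t - g s - (t - s) *\<^sub>R g1 s) \<le> 3 * B * (t - s)\<^sup>2"
proof -
  let ?I = "closed_segment s t"
  have sub: "?I \<subseteq> T" using T by (simp add: closed_segment_subset)
  have B0: "B \<ge> 0" using order_trans[OF norm_ge_zero B[OF T(2)]] by simp
  have g1b: "norm (g1 r - g1 s) \<le> 3 * B * \<bar>t - s\<bar>" if r: "r \<in> ?I" for r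
  proof -
    have "norm (g1 r - g1 s - (r - s) *\<^sub>R g2 s) \<le> norm (r - s) * (2 * B)"
    proof (rule vector_differentiable_bound_linearization[of ?I])
      show "(g1 has_vector_derivative g2 x) (at x within ?I)" if "x \<in> ?I" for x
        using has_vector_derivative_within_subset[OF g1] that sub by blast
      show "closed_segment s r \<subseteq> ?I" using r by (simp add: subset_closed_segment)
      show "norm (g2 x - g2 s) \<le> 2 * B" if "x \<in> ?I" for x
        using norm_triangle_ineq4[of "g2 x" "g2 s"] B[of x] B[of s] that sub T by (smt (verit) subsetD)
    qed simp
    then have "norm (g1 r - g1 s) \<le> norm ((r - s) *\<^sub>R g2 s) + \<bar>r - s\<bar> * (2 * B)"
      using norm_triangle_ineq2[of "g1 r - g1 s" "(r - s) *\<^sub>R g2 s"] by simp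
    also have "norm ((r - s) *\<^sub>R g2 s) \<le> \<bar>r - s\<bar> * B"
      using B[OF T(2)] by (simp add: mult_left_mono)
    also have "\<bar>r - s\<bar> * B + \<bar>r - s\<bar> * (2 * B) = 3 * B * \<bar>r - s\<bar>" by simp
    also have "\<dots> \<le> 3 * B * \<bar>t - s\<bar>"
      using B0 r by (intro mult_left_mono) (auto simp: closed_segment_eq_real_ivl split: if_splits)
    finally show ?thesis by simp
  qed
  have "norm (g t - g s - (t - s) *\<^sub>R g1 s) \<le> norm (t - s) * (3 * B * \<bar>t - s\<bar>)"
  proof (rule vector_differentiable_bound_linearization[of ?I])
    show "(g has_vector_derivative g1 x) (at x within ?I)" if "x \<in> ?I" for x
      using has_vector_derivative_within_subset[OF g] that sub by blast
  qed (use g1b in auto)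
  also have "\<dots> = 3 * B * (\<bar>t - s\<bar> * \<bar>t - s\<bar>)" by simp
  finally show ?thesis by (simp only: abs_mult_self_eq power2_eq_square)
qed

lemma has_vector_derivative_quadratic:
  fixes f :: "real \<Rightarrow> complex"
  assumes q: "\<And>y. y \<in> T \<Longrightarrow> norm (f y - f x - (y - x) *\<^sub>R d) \<le> C * (y - x)\<^sup>2"
  shows "(f has_vector_derivative d) (at x within T)"
  unfolding has_vector_derivative_def
proof (rule has_derivativeI_sandwich[of 1 _ _ _ _ "\<lambda>y. C * \<bar>y - x\<bar>"])
  show "norm (f y - f x - (y - x) *\<^sub>R d) / norm (y - x) \<le> C * \<bar>y - x\<bar>" if "y \<in> T" "y \<noteq> x" for y
  proof -
    have "norm (f y - f x - (y - x) *\<^sub>R d) \<le> (C * \<bar>y - x\<bar>) * \<bar>y - x\<bar>"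
      using q[OF that(1)] by (simp add: power2_eq_square mult.assoc)
    then show ?thesis using that(2) by (simp add: divide_le_eq)
  qed
  show "((\<lambda>y. C * \<bar>y - x\<bar>) \<longlongrightarrow> 0) (at x within T)"
    by (rule tendsto_eq_intros | simp)+
qed (auto intro: bounded_linear_scaleR_left)

text \<open>
  The functions \<open>t \<mapsto> \<integral> w(\<eta>) exp (t b(\<eta>)) d\<eta>\<close> for \<open>t\<close> in a convex set \<open>T\<close>. The majorants \<open>H k\<close> of
  the formal \<open>k\<close>-th derivatives make them smooth. Both Fourier integrals (\<open>b(\<eta>) = - \<i> \<eta>\<close>) and
  superpositions of waves along an affine segment are of this form.
\<close>

locale exp_integral =
  fixes T :: "real set" and w b :: "real \<Rightarrow> complex" and H :: "nat \<Rightarrow> real \<Rightarrow> real"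
  assumes convex: "convex T"
    and meas [measurable]: "w \<in> borel_measurable borel" "b \<in> borel_measurable borel"
    and H_int: "\<And>k. integrable lborel (H k)"
    and H: "\<And>k t \<eta>. t \<in> T \<Longrightarrow> cmod (w \<eta> * b \<eta> ^ k * exp (of_real t * b \<eta>)) \<le> H k \<eta>"
begin

definition K :: "nat \<Rightarrow> real \<Rightarrow> complex" where
  "K k t = (\<integral>\<eta>. w \<eta> * b \<eta> ^ k * exp (of_real t * b \<eta>) \<partial>lborel)"

lemma integrable_K: "t \<in> T \<Longrightarrow> integrable lborel (\<lambda>\<eta>. w \<eta> * b \<eta> ^ k * exp (of_real t * b \<eta>))"
  by (rule Bochner_Integration.integrable_bound[OF H_int[of k]])
     (use order_trans[OF H abs_ge_self] in \<open>auto\<close>)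

lemma K_bound: "t \<in> T \<Longrightarrow> cmod (K k t) \<le> (\<integral>\<eta>. H k \<eta> \<partial>lborel)"
  unfolding K_def by (rule Bochner_Integration.integral_norm_bound_integral[OF integrable_K H_int H])

lemma jet_K: "jet T K"
  unfolding jet_def
proof (intro allI ballI)
  fix k t assume t: "t \<in> T"
  let ?p = "\<lambda>k t \<eta>. w \<eta> * b \<eta> ^ k * exp (of_real t * b \<eta>)"
  have d: "((\<lambda>t. ?p k t \<eta>) has_vector_derivative ?p (Suc k) t \<eta>) (at t within T)" for k t \<eta>
    by (auto intro!: derivative_eq_intros has_vector_derivative_real_field simp: mult_ac)
  show "(K k has_vector_derivative K (Suc k) t) (at t within T)"
  proof (rule has_vector_derivative_quadratic)
    fix y assume y: "y \<in> T"
    have eq: "K k y - K k t - (y - t) *\<^sub>R K (Suc k) t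
        = (\<integral>\<eta>. ?p k y \<eta> - ?p k t \<eta> - (y - t) *\<^sub>R ?p (Suc k) t \<eta> \<partial>lborel)"
      unfolding K_def using integrable_K[OF y] integrable_K[OF t, of k] integrable_K[OF t, of "Suc k"]
      by (simp del: power_Suc)
    have "cmod (\<integral>\<eta>. ?p k y \<eta> - ?p k t \<eta> - (y - t) *\<^sub>R ?p (Suc k) t \<eta> \<partial>lborel)
        \<le> (\<integral>\<eta>. 3 * H (Suc (Suc k)) \<eta> * (y - t)\<^sup>2 \<partial>lborel)"
    proof (rule Bochner_Integration.integral_norm_bound_integral)
      show "integrable lborel (\<lambda>\<eta>. ?p k y \<eta> - ?p k t \<eta> - (y - t) *\<^sub>R ?p (Suc k) t \<eta>)"
        using integrable_K[OF y] integrable_K[OF t, of k] integrable_K[OF t, of "Suc k"]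
        by (simp del: power_Suc)
      show "cmod (?p k y \<eta> - ?p k t \<eta> - (y - t) *\<^sub>R ?p (Suc k) t \<eta>) \<le> 3 * H (Suc (Suc k)) \<eta> * (y - t)\<^sup>2" for \<eta>
        by (rule second_order_vector_bound[OF convex t y d d H])
    qed (use H_int in auto)
    then show "cmod (K k y - K k t - (y - t) *\<^sub>R K (Suc k) t) \<le> (3 * (\<integral>\<eta>. H (Suc (Suc k)) \<eta> \<partial>lborel)) * (y - t)\<^sup>2"
      by (simp only: eq) simp
  qed
qed

lemma exp_integral_restrict: "S \<in> sets borel \<Longrightarrow> exp_integral T (\<lambda>\<eta>. indicator S \<eta> * w \<eta>) b (\<lambda>k \<eta>. indicator S \<eta> * H k \<eta>)"
proof
  assume S [measurable]: "S \<in> sets borel"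
  show "integrable lborel (\<lambda>\<eta>. indicator S \<eta> * H k \<eta>)" for k
    using integrable_real_mult_indicator[OF _ H_int, of S k] by (simp add: mult.commute)
  show "cmod (indicator S \<eta> * w \<eta> * b \<eta> ^ k * exp (of_real t * b \<eta>)) \<le> indicator S \<eta> * H k \<eta>" if "t \<in> T" for k t \<eta>
    using H[OF that, of \<eta> k] by (auto simp: indicator_def)
qed (use convex in auto)

end

lemma jet_exp: "jet T (\<lambda>k t. c * b ^ k * exp (of_real t * b))"
  unfolding jet_def
  by (auto intro!: derivative_eq_intros has_vector_derivative_real_field simp: mult_ac)

lemma jet_exp1: "jet T (\<lambda>k t. b ^ k * exp (of_real t * b))"
  using jet_exp[of T 1] by simp

lemma exp_smooth01: "(\<lambda>t. exp (of_real t * b)) \<in> smooth_on {0..1}"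
  using jet_smooth01[OF jet_exp1[of _ b]] by simp

lemma uniform_in_parameter:
  fixes p :: "'a :: heine_borel \<Rightarrow> real \<Rightarrow> complex"
  assumes p: "continuous_on (cball s 1 \<times> {0..1}) (\<lambda>q. p (fst q) (snd q))" and e: "e > 0"
  shows "\<exists>d>0. \<forall>x t. dist x s < d \<longrightarrow> t \<in> {0..1} \<longrightarrow> cmod (p x t - p s t) < e"
proof -
  have "uniformly_continuous_on (cball s 1 \<times> {0..1}) (\<lambda>q. p (fst q) (snd q))"
    by (intro compact_uniformly_continuous compact_Times p) auto
  from this[unfolded uniformly_continuous_on_def, rule_format, OF e]
  obtain d where d: "d > 0" "\<And>q q'. q \<in> cball s 1 \<times> {0..1} \<Longrightarrow> q' \<in> cball s 1 \<times> {0..1} \<Longrightarrow> dist q' q < d \<Longrightarrow>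
      dist (p (fst q') (snd q')) (p (fst q) (snd q)) < e"
    by auto
  have "cmod (p x t - p s t) < e" if "dist x s < min d 1" "t \<in> {0..1}" for x t
    using d(2)[of "(s, t)" "(x, t)"] that by (auto simp: dist_norm[symmetric] dist_commute dist_Pair_Pair)
  then show ?thesis
    using d(1) by (intro exI[of _ "min d 1"]) auto
qed

text \<open>
  On \<open>[0,1]\<close> the exponential \<open>exp (t b)\<close> and its \<open>t\<close>-derivatives depend uniformly continuously on
  \<open>b\<close> in a compact set, and the functional controls finitely many of these derivatives.
\<close>

lemma continuous_dual01_exp:
  assumes u: "u \<in> dual01"
  shows "continuous_on UNIV (\<lambda>b. u (\<lambda>t. exp (of_real t * b)))"
  unfolding continuous_on_iff
proof (intro ballI allI impI)
  fix b0 :: complex and e :: real assume e: "e > 0"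
  obtain C N where ob: "order_bound u C N"
    using dual01_bounded[OF u] by blast
  note C = order_boundD[OF ob]
  have "C > 0" by (rule order_bound_pos[OF ob])
  have "\<forall>k\<le>N. \<exists>d>0. \<forall>b t. dist b b0 < d \<longrightarrow> t \<in> {0..1} \<longrightarrow> cmod (b ^ k * exp (of_real t * b) - b0 ^ k * exp (of_real t * b0)) < e / (2 * C)"
    using e \<open>C > 0\<close> by (intro allI impI uniform_in_parameter) (auto intro!: continuous_intros)
  then obtain d where d: "\<And>k. k \<le> N \<Longrightarrow> d k > 0"
    "\<And>k b t. k \<le> N \<Longrightarrow> dist b b0 < d k \<Longrightarrow> t \<in> {0..1} \<Longrightarrow> cmod (b ^ k * exp (of_real t * b) - b0 ^ k * exp (of_real t * b0)) < e / (2 * C)"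
    by metis
  show "\<exists>d>0. \<forall>x'\<in>UNIV. dist x' b0 < d \<longrightarrow> dist (u (\<lambda>t. exp (complex_of_real t * x'))) (u (\<lambda>t. exp (complex_of_real t * b0))) < e"
  proof (intro exI conjI ballI impI)
    show "Min (d ` {..N}) > 0" using d(1) by (subst Min_gr_iff) auto
    fix b assume "dist b b0 < Min (d ` {..N})"
    then have b: "dist b b0 < d k" if "k \<le> N" for k using that by (subst (asm) Min_gr_iff) auto
    have "cmod (u (\<lambda>t. b ^ 0 * exp (of_real t * b) - b0 ^ 0 * exp (of_real t * b0))) \<le> C * (e / (2 * C))"
      by (rule C[OF jet_diff[OF jet_exp1 jet_exp1]]) (rule less_imp_le[OF d(2)[OF _ b]])
    also have "\<dots> < e" using e \<open>C > 0\<close> by simp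
    finally show "dist (u (\<lambda>t. exp (complex_of_real t * b))) (u (\<lambda>t. exp (complex_of_real t * b0))) < e"
      using dual01_diff[OF u jet_exp1[of _ b] jet_exp1[of _ b0]] by (simp add: dist_norm)
  qed
qed

text \<open>
  The setting for interchanging a functional \<open>u\<close> with the integral of \<open>w(\<eta>) exp (t b(\<eta>))\<close> over \<open>\<eta>\<close>;
  the result is \<open>functional_exchange\<close> at the end of this section.
\<close>

locale exp_integral01 = exp_integral "{0..1}" w b H for w b :: "real \<Rightarrow> complex" and H +
  fixes u
  assumes w_cont: "continuous_on UNIV w" and b_cont: "continuous_on UNIV b" and u: "u \<in> dual01"
begin

definition V :: "real \<Rightarrow> complex" where
  "V \<eta> = w \<eta> * u (\<lambda>t. exp (of_real t * b \<eta>))"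

definition part :: "real \<Rightarrow> nat \<Rightarrow> real \<Rightarrow> complex" where
  "part s k t = (\<integral>\<eta>. indicator {..s} \<eta> * w \<eta> * b \<eta> ^ k * exp (of_real t * b \<eta>) \<partial>lborel)"

lemma V_cont: "continuous_on UNIV V"
proof -
  have "continuous_on UNIV ((\<lambda>b. u (\<lambda>t. exp (of_real t * b))) \<circ> b)"
    by (intro continuous_on_compose b_cont continuous_on_subset[OF continuous_dual01_exp[OF u]]) auto
  then show ?thesis unfolding V_def by (intro continuous_intros w_cont) (simp add: o_def)
qed

lemma V_meas [measurable]: "V \<in> borel_measurable borel"
  by (rule borel_measurable_continuous_onI[OF V_cont])

lemma V_bound: "\<exists>C N. C > 0 \<and> (\<forall>\<eta>. cmod (V \<eta>) \<le> C * (\<Sum>k\<le>N. H k \<eta>))"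
proof -
  obtain C N where ob: "order_bound u C N"
    using dual01_bounded[OF u] by blast
  note C = order_boundD[OF ob]
  have "C > 0" by (rule order_bound_pos[OF ob])
  have H0: "H k \<eta> \<ge> 0" for k \<eta> using order_trans[OF norm_ge_zero H[of 0 \<eta> k]] by simp
  have "cmod (V \<eta>) \<le> C * (\<Sum>k\<le>N. H k \<eta>)" for \<eta>
  proof -
    have "cmod (u (\<lambda>t. w \<eta> * b \<eta> ^ 0 * exp (of_real t * b \<eta>))) \<le> C * (\<Sum>k\<le>N. H k \<eta>)"
    proof (rule C[OF jet_exp])
      fix k t assume "k \<le> N" "t \<in> {0..1::real}"
      then show "cmod (w \<eta> * b \<eta> ^ k * exp (of_real t * b \<eta>)) \<le> (\<Sum>k\<le>N. H k \<eta>)"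
        using H0 by (intro order_trans[OF H member_le_sum[of k]]) auto
    qed
    then show ?thesis using dual01_cmult[OF u exp_smooth01, of "w \<eta>" "b \<eta>"] by (simp add: V_def)
  qed
  then show ?thesis using \<open>C > 0\<close> by blast
qed

lemma V_integrable: "integrable lborel V"
proof -
  obtain C N where C: "\<And>\<eta>. cmod (V \<eta>) \<le> C * (\<Sum>k\<le>N. H k \<eta>)" using V_bound by blast
  show ?thesis
    by (rule Bochner_Integration.integrable_bound[of _ "\<lambda>\<eta>. C * (\<Sum>k\<le>N. H k \<eta>)"])
       (use H_int order_trans[OF C abs_ge_self] in auto)
qed

lemma part_jet: "jet {0..1} (part s)"
proof -
  interpret R: exp_integral "{0..1}" "\<lambda>\<eta>. indicator {..s} \<eta> * w \<eta>" b "\<lambda>k \<eta>. indicator {..s} \<eta> * H k \<eta>"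
    by (rule exp_integral_restrict) simp
  have "part s = R.K" by (intro ext) (simp add: part_def R.K_def)
  then show ?thesis using R.jet_K by simp
qed

lemma part_diff:
  assumes "t \<in> {0..1}" "a \<le> c"
  shows "part c k t - part a k t = (\<integral>\<eta>. indicator {a<..c} \<eta> *\<^sub>R (w \<eta> * b \<eta> ^ k * exp (of_real t * b \<eta>)) \<partial>lborel)"
proof -
  let ?p = "\<lambda>\<eta>. w \<eta> * b \<eta> ^ k * exp (of_real t * b \<eta>)"
  have i: "integrable lborel (\<lambda>\<eta>. indicator {..s} \<eta> *\<^sub>R ?p \<eta>)" for s
    by (rule integrable_mult_indicator[OF _ integrable_K[OF assms(1)]]) simp
  have p: "part s k t = (\<integral>\<eta>. indicator {..s} \<eta> *\<^sub>R ?p \<eta> \<partial>lborel)" for s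
    unfolding part_def by (rule Bochner_Integration.integral_cong) (auto simp: indicator_def)
  show ?thesis
    unfolding p Bochner_Integration.integral_diff[OF i i, symmetric]
    by (rule Bochner_Integration.integral_cong) (use assms(2) in \<open>auto simp: indicator_def\<close>)
qed

lemma part_estimate:
  assumes t: "t \<in> {0..1}" and "a \<le> c"
    and close: "\<And>\<eta>. \<eta> \<in> {a..c} \<Longrightarrow> cmod (w \<eta> * b \<eta> ^ k * exp (of_real t * b \<eta>) - y) \<le> e"
  shows "cmod (part c k t - part a k t - (c - a) *\<^sub>R y) \<le> e * (c - a)"
proof -
  let ?p = "\<lambda>\<eta>. w \<eta> * b \<eta> ^ k * exp (of_real t * b \<eta>)"
  have e: "e \<ge> 0" using order_trans[OF norm_ge_zero close[of a]] \<open>a \<le> c\<close> by simp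
  have i: "integrable lborel (\<lambda>\<eta>. indicator {a<..c} \<eta> *\<^sub>R ?p \<eta>)"
    by (rule integrable_mult_indicator[OF _ integrable_K[OF t]]) simp
  have iy: "integrable lborel (\<lambda>\<eta>. indicator {a<..c} \<eta> *\<^sub>R y)"
    using \<open>a \<le> c\<close> by (intro integrable_scaleR_left) (auto intro!: integrable_real_indicator)
  have "(\<integral>\<eta>. indicator {a<..c} \<eta> *\<^sub>R y \<partial>lborel) = (c - a) *\<^sub>R y"
    using \<open>a \<le> c\<close> by (subst integral_scaleR_left) (auto intro!: integrable_real_indicator)
  then have "part c k t - part a k t - (c - a) *\<^sub>R y = (\<integral>\<eta>. indicator {a<..c} \<eta> *\<^sub>R ?p \<eta> - indicator {a<..c} \<eta> *\<^sub>R y \<partial>lborel)"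
    using part_diff[OF t \<open>a \<le> c\<close>, of k] i iy by simp
  also have "cmod \<dots> \<le> (\<integral>\<eta>. indicator {a<..c} \<eta> *\<^sub>R e \<partial>lborel)"
  proof (rule Bochner_Integration.integral_norm_bound_integral)
    show "integrable lborel (\<lambda>\<eta>. indicator {a<..c} \<eta> *\<^sub>R e)"
      using \<open>a \<le> c\<close> by (intro integrable_scaleR_left) (auto intro!: integrable_real_indicator)
  qed (use i iy close e \<open>a \<le> c\<close> in \<open>auto simp: indicator_def\<close>)
  also have "\<dots> = e * (c - a)"
    using \<open>a \<le> c\<close> by (subst integral_scaleR_left) (auto intro!: integrable_real_indicator)
  finally show ?thesis .
qed

text \<open>
  The truncated integral \<open>part s\<close> satisfies \<open>part (s + r) = part s + r w(s) exp (t b(s)) + o(r)\<close>,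
  uniformly in \<open>t\<close> and for any finite number of \<open>t\<close>-derivatives. Since \<open>u\<close> has finite order, it may be
  applied to this expansion.
\<close>

lemma part_derivative: "((\<lambda>s. u (part s 0)) has_vector_derivative V s) (at s)"
  unfolding has_vector_derivative_def has_derivative_within_alt
proof (intro conjI allI impI)
  fix e :: real assume e: "e > 0"
  obtain C N where ob: "order_bound u C N"
    using dual01_bounded[OF u] by blast
  note C = order_boundD[OF ob]
  have "C > 0" by (rule order_bound_pos[OF ob])
  let ?p = "\<lambda>\<eta> k t. w \<eta> * b \<eta> ^ k * exp (complex_of_real t * b \<eta>)"
  have "\<forall>k. \<exists>d>0. \<forall>\<eta> t. dist \<eta> s < d \<longrightarrow> t \<in> {0..1} \<longrightarrow> cmod (?p \<eta> k t - ?p s k t) < e / C"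
    using e \<open>C > 0\<close>
    by (intro allI uniform_in_parameter)
       (auto intro!: continuous_intros continuous_on_compose2[OF w_cont] continuous_on_compose2[OF b_cont])
  then obtain d where d: "\<And>k. d k > 0"
    "\<And>k \<eta> t. dist \<eta> s < d k \<Longrightarrow> t \<in> {0..1} \<Longrightarrow> cmod (?p \<eta> k t - ?p s k t) < e / C"
    by metis
  let ?J = "\<lambda>y k t. part y k t - part s k t - of_real (y - s) * ?p s k t"
  show "\<exists>d>0. \<forall>y\<in>UNIV. norm (y - s) < d \<longrightarrow>
      cmod (u (part y 0) - u (part s 0) - (y - s) *\<^sub>R V s) \<le> e * norm (y - s)"
  proof (intro exI conjI ballI impI)
    show "Min (d ` {..N}) > 0" using d(1) by (subst Min_gr_iff) auto
    fix y assume "norm (y - s) < Min (d ` {..N})"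
    then have y: "\<bar>y - s\<bar> < d k" if "k \<le> N" for k using that by (subst (asm) Min_gr_iff) auto
    have J: "jet {0..1} (?J y)"
      by (intro jet_diff part_jet jet_cmult jet_exp)
    have "cmod (u (?J y 0)) \<le> C * (e / C * \<bar>y - s\<bar>)"
    proof (rule C[OF J])
      fix k t assume k: "k \<le> N" and t: "t \<in> {0..1::real}"
      show "cmod (?J y k t) \<le> e / C * \<bar>y - s\<bar>"
      proof (cases "s \<le> y")
        case True
        have "cmod (part y k t - part s k t - (y - s) *\<^sub>R ?p s k t) \<le> e / C * (y - s)"
          by (rule part_estimate[OF t True]) (use d(2)[OF _ t] y[OF k] in \<open>auto simp: dist_real_def intro!: less_imp_le\<close>)
        then show ?thesis using True by (simp add: scaleR_conv_of_real)
      next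
        case False
        have "cmod (part s k t - part y k t - (s - y) *\<^sub>R ?p s k t) \<le> e / C * (s - y)"
          by (rule part_estimate[OF t]) (use d(2)[OF _ t] y[OF k] False in \<open>auto simp: dist_real_def intro!: less_imp_le\<close>)
        moreover have "?J y k t = - (part s k t - part y k t - (s - y) *\<^sub>R ?p s k t)"
          by (simp add: scaleR_conv_of_real algebra_simps)
        ultimately show ?thesis using False by (simp only: norm_minus_cancel) simp
      qed
    qed
    also have "\<dots> = e * \<bar>y - s\<bar>" using \<open>C > 0\<close> by simp
    also have "u (?J y 0) = u (part y 0) - u (part s 0) - (y - s) *\<^sub>R V s"
    proof -
      have "u (?J y 0) = u (\<lambda>t. part y 0 t - part s 0 t) - u (\<lambda>t. of_real (y - s) * ?p s 0 t)"
        by (rule dual01_diff[OF u jet_diff[OF part_jet part_jet] jet_cmult[OF jet_exp]])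
      also have "u (\<lambda>t. part y 0 t - part s 0 t) = u (part y 0) - u (part s 0)"
        by (rule dual01_diff[OF u part_jet part_jet])
      also have "u (\<lambda>t. of_real (y - s) * ?p s 0 t) = of_real (y - s) * u (?p s 0)"
        by (rule dual01_cmult[OF u jet_smooth01[OF jet_exp]])
      also have "u (?p s 0) = V s"
        using dual01_cmult[OF u exp_smooth01, of "w s" "b s"] by (simp add: V_def)
      finally show ?thesis by (simp add: scaleR_conv_of_real)
    qed
    finally show "cmod (u (part y 0) - u (part s 0) - (y - s) *\<^sub>R V s) \<le> e * norm (y - s)" by simp
  qed
qed (simp add: bounded_linear_scaleR_left)

lemma H_tail:
  assumes "\<And>n. S n \<in> sets borel" "\<And>x. eventually (\<lambda>n. x \<notin> S n) sequentially"
  shows "(\<lambda>n. \<integral>\<eta>. indicator (S n) \<eta> * H k \<eta> \<partial>lborel) \<longlonglongrightarrow> 0"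
proof -
  have [measurable]: "S n \<in> sets borel" for n using assms(1) .
  have [measurable]: "H k \<in> borel_measurable borel" using borel_measurable_integrable[OF H_int] by simp
  have "(\<lambda>n. indicator (S n) x * H k x) \<longlonglongrightarrow> 0" for x
    using assms(2)[of x] by (intro tendsto_eventually) (elim eventually_mono, simp)
  then have "AE x in lborel. (\<lambda>n. indicator (S n) x * H k x) \<longlonglongrightarrow> 0" by simp
  from integral_dominated_convergence[OF _ _ integrable_norm[OF H_int[of k]] this]
  have "(\<lambda>n. \<integral>\<eta>. indicator (S n) \<eta> * H k \<eta> \<partial>lborel) \<longlonglongrightarrow> (\<integral>\<eta>. 0 \<partial>lborel)"
    by (auto simp: indicator_def)
  then show ?thesis by simp
qed

text \<open>
  By the fundamental theorem of calculus the integral of \<open>V\<close> over \<open>[-n,n]\<close> is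
  \<open>u (part n) - u (part (-n))\<close>. The tails of the majorants tend to \<open>0\<close>, so the first term tends to
  \<open>u (K 0)\<close> and the second to \<open>0\<close>.
\<close>

lemma functional_exchange: "u (K 0) = (\<integral>\<eta>. V \<eta> \<partial>lborel)"
proof -
  obtain C N where ob: "order_bound u C N"
    using dual01_bounded[OF u] by blast
  note C = order_boundD[OF ob]
  have "C > 0" by (rule order_bound_pos[OF ob])
  have H0: "H k \<eta> \<ge> 0" for k \<eta> using order_trans[OF norm_ge_zero H[of 0 \<eta> k]] by simp
  have lim: "(\<lambda>n. u (F n 0)) \<longlonglongrightarrow> 0"
    if S: "\<And>n. S n \<in> sets borel" "\<And>x. eventually (\<lambda>n. x \<notin> S n) sequentially"
      and F: "\<And>n. jet {0..1} (F n)"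
      "\<And>n k t. t \<in> {0..1} \<Longrightarrow> F n k t = (\<integral>\<eta>. indicator (S n) \<eta> * w \<eta> * b \<eta> ^ k * exp (of_real t * b \<eta>) \<partial>lborel)"
    for S :: "nat \<Rightarrow> real set" and F
  proof (rule Lim_null_comparison[of _ "\<lambda>n. C * (\<Sum>k\<le>N. \<integral>\<eta>. indicator (S n) \<eta> * H k \<eta> \<partial>lborel)"])
    have "(\<lambda>n. C * (\<Sum>k\<le>N. \<integral>\<eta>. indicator (S n) \<eta> * H k \<eta> \<partial>lborel)) \<longlonglongrightarrow> C * (\<Sum>k\<le>N. 0)"
      by (intro tendsto_intros H_tail S)
    then show "(\<lambda>n. C * (\<Sum>k\<le>N. \<integral>\<eta>. indicator (S n) \<eta> * H k \<eta> \<partial>lborel)) \<longlonglongrightarrow> 0" by simp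
    show "\<forall>\<^sub>F n in sequentially. cmod (u (F n 0)) \<le> C * (\<Sum>k\<le>N. \<integral>\<eta>. indicator (S n) \<eta> * H k \<eta> \<partial>lborel)"
    proof (rule always_eventually, rule allI, rule C[OF F(1)])
      fix n k t assume k: "k \<le> N" and t: "t \<in> {0..1::real}"
      interpret R: exp_integral "{0..1}" "\<lambda>\<eta>. indicator (S n) \<eta> * w \<eta>" b "\<lambda>k \<eta>. indicator (S n) \<eta> * H k \<eta>"
        by (rule exp_integral_restrict) (rule S)
      have "cmod (F n k t) \<le> (\<integral>\<eta>. indicator (S n) \<eta> * H k \<eta> \<partial>lborel)"
        using R.K_bound[OF t, of k] F(2)[OF t] by (simp add: R.K_def)
      also have "\<dots> \<le> (\<Sum>k\<le>N. \<integral>\<eta>. indicator (S n) \<eta> * H k \<eta> \<partial>lborel)"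
        using k H0 by (intro member_le_sum[of k]) auto
      finally show "cmod (F n k t) \<le> (\<Sum>k\<le>N. \<integral>\<eta>. indicator (S n) \<eta> * H k \<eta> \<partial>lborel)" .
    qed
  qed
  have "(\<lambda>n. u (part (- real n) 0)) \<longlonglongrightarrow> 0"
  proof (rule lim[of "\<lambda>n. {..- real n}" "\<lambda>n. part (- real n)"])
    show "\<forall>\<^sub>F n in sequentially. x \<notin> {..- real n}" for x
      using eventually_gt_at_top[of "nat \<lceil>- x\<rceil>"] by eventually_elim (simp, linarith)
  qed (auto simp: part_jet part_def)
  moreover have "(\<lambda>n. u ((\<lambda>k t. K k t - part (real n) k t) 0)) \<longlonglongrightarrow> 0"
  proof (rule lim[of "\<lambda>n. {real n<..}"])
    show "\<forall>\<^sub>F n in sequentially. x \<notin> {real n<..}" for x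
      using eventually_gt_at_top[of "nat \<lceil>x\<rceil>"] by eventually_elim (simp, linarith)
    show "jet {0..1} (\<lambda>k t. K k t - part (real n) k t)" for n by (rule jet_diff[OF jet_K part_jet])
    show "K k t - part (real n) k t = (\<integral>\<eta>. indicator {real n<..} \<eta> * w \<eta> * b \<eta> ^ k * exp (of_real t * b \<eta>) \<partial>lborel)"
      if t: "t \<in> {0..1}" for n k t
    proof -
      interpret R: exp_integral "{0..1}" "\<lambda>\<eta>. indicator {..real n} \<eta> * w \<eta>" b "\<lambda>k \<eta>. indicator {..real n} \<eta> * H k \<eta>"
        by (rule exp_integral_restrict) simp
      show ?thesis
        unfolding K_def part_def Bochner_Integration.integral_diff[OF integrable_K[OF t] R.integrable_K[OF t], symmetric]
        by (rule Bochner_Integration.integral_cong) (auto simp: indicator_def)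
    qed
  qed simp
  ultimately have "(\<lambda>n. u (K 0) - u (\<lambda>t. K 0 t - part (real n) 0 t) - u (part (- real n) 0)) \<longlonglongrightarrow> u (K 0) - 0 - 0"
    by (intro tendsto_intros) auto
  moreover have "u (K 0) - u (\<lambda>t. K 0 t - part (real n) 0 t) - u (part (- real n) 0)
      = (\<integral>\<eta>. indicator {- real n..real n} \<eta> *\<^sub>R V \<eta> \<partial>lborel)" for n
  proof -
    have "(\<integral>\<eta>. indicator {- real n..real n} \<eta> *\<^sub>R V \<eta> \<partial>lborel) = u (part (real n) 0) - u (part (- real n) 0)"
      by (rule integral_FTC_atLeastAtMost)
         (auto intro: has_vector_derivative_at_within[OF part_derivative] continuous_on_subset[OF V_cont])
    then show ?thesis using dual01_diff[OF u jet_K part_jet] by simp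
  qed
  ultimately have 1: "(\<lambda>n. \<integral>\<eta>. indicator {- real n..real n} \<eta> *\<^sub>R V \<eta> \<partial>lborel) \<longlonglongrightarrow> u (K 0)"
    by simp
  have 2: "(\<lambda>n. \<integral>\<eta>. indicator {- real n..real n} \<eta> *\<^sub>R V \<eta> \<partial>lborel) \<longlonglongrightarrow> (\<integral>\<eta>. V \<eta> \<partial>lborel)"
  proof (rule integral_dominated_convergence[where w="\<lambda>\<eta>. norm (V \<eta>)"])
    show "AE x in lborel. (\<lambda>n. indicator {- real n..real n} x *\<^sub>R V x) \<longlonglongrightarrow> V x"
    proof (rule AE_I2, rule tendsto_eventually)
      fix x
      show "\<forall>\<^sub>F n in sequentially. indicator {- real n..real n} x *\<^sub>R V x = V x"
        using eventually_gt_at_top[of "nat \<lceil>\<bar>x\<bar>\<rceil>"]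
        by eventually_elim (simp add: indicator_def, linarith)
    qed
  qed (use V_integrable in \<open>auto simp: indicator_def\<close>)
  show ?thesis by (rule LIMSEQ_unique[OF 1 2])
qed

end

section \<open>Rapidly decreasing functions\<close>

lemma integrable_inverse_bracket_sq: "integrable lborel (\<lambda>x::real. 1 / (1 + \<bar>x\<bar>)\<^sup>2)"
proof (rule Bochner_Integration.integrable_bound[of _ "\<lambda>x::real. inverse (1 + x\<^sup>2)"])
  show "integrable lborel (\<lambda>x::real. inverse (1 + x\<^sup>2))"
    using integrable_inverse_1_plus_square by (simp add: set_integrable_def)
  show "AE x::real in lborel. norm (1 / (1 + \<bar>x\<bar>)\<^sup>2) \<le> norm (inverse (1 + x\<^sup>2))"
  proof (rule AE_I2)
    fix x :: real
    have "1 + x\<^sup>2 \<le> (1 + \<bar>x\<bar>)\<^sup>2" by (simp add: power2_eq_square algebra_simps)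
    then show "norm (1 / (1 + \<bar>x\<bar>)\<^sup>2) \<le> norm (inverse (1 + x\<^sup>2))"
      by (simp add: inverse_eq_divide frac_le add_pos_nonneg)
  qed
qed simp

lemma integrable_decay:
  fixes g :: "real \<Rightarrow> 'b :: {banach, second_countable_topology}"
  assumes "g \<in> borel_measurable borel" "\<And>x. (1 + \<bar>x\<bar>) ^ 2 * norm (g x) \<le> C"
  shows "integrable lborel g"
proof (rule Bochner_Integration.integrable_bound[of _ "\<lambda>x. C * (1 / (1 + \<bar>x\<bar>)\<^sup>2)"])
  show "integrable lborel (\<lambda>x. C * (1 / (1 + \<bar>x\<bar>)\<^sup>2))"
    by (rule integrable_mult_right[OF integrable_inverse_bracket_sq])
  show "AE x in lborel. norm (g x) \<le> norm (C * (1 / (1 + \<bar>x\<bar>)\<^sup>2))"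
  proof (rule AE_I2)
    fix x :: real
    have "(1 + \<bar>x\<bar>)\<^sup>2 > 0" by (simp add: add_pos_nonneg)
    then have "norm (g x) \<le> C * (1 / (1 + \<bar>x\<bar>)\<^sup>2)"
      using assms(2)[of x] by (simp add: pos_le_divide_eq mult.commute)
    then show "norm (g x) \<le> norm (C * (1 / (1 + \<bar>x\<bar>)\<^sup>2))" unfolding real_norm_def by linarith
  qed
qed (use assms(1) in simp)

text \<open>
  Rapid decrease of the function alone; for Schwartz functions this is also required of all
  derivatives.
\<close>

definition rapid :: "(real \<Rightarrow> complex) \<Rightarrow> bool" where
  "rapid f \<longleftrightarrow> continuous_on UNIV f \<and> (\<forall>N. \<exists>C. \<forall>x. (1 + \<bar>x\<bar>) ^ N * cmod (f x) \<le> C)"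

lemma rapidD: "rapid f \<Longrightarrow> \<exists>C\<ge>0. \<forall>x. (1 + \<bar>x\<bar>) ^ N * cmod (f x) \<le> C"
  unfolding rapid_def by (metis abs_ge_self abs_ge_zero order_trans)

lemma rapid_measurable: "rapid f \<Longrightarrow> f \<in> borel_measurable borel"
  by (auto simp: rapid_def intro: borel_measurable_continuous_onI)

lemma rapid_integrable: "rapid f \<Longrightarrow> integrable lborel f"
  using rapidD[of f 2] by (auto intro!: integrable_decay rapid_measurable)

lemma rapid_integrable_weight:
  assumes f: "rapid f"
  shows "integrable lborel (\<lambda>x. (1 + \<bar>x\<bar>) ^ N * cmod (f x))"
proof -
  obtain C where C: "\<And>x. (1 + \<bar>x\<bar>) ^ (N + 2) * cmod (f x) \<le> C" using rapidD[OF f] by blast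
  show ?thesis
  proof (rule integrable_decay)
    show "(\<lambda>x. (1 + \<bar>x\<bar>) ^ N * cmod (f x)) \<in> borel_measurable borel"
      using rapid_measurable[OF f] by measurable
    show "(1 + \<bar>x\<bar>) ^ 2 * norm ((1 + \<bar>x\<bar>) ^ N * cmod (f x)) \<le> C" for x
      using C[of x] by (simp add: power_add norm_mult mult_ac power2_eq_square)
  qed
qed

lemma bracket_power_le: "(1 + \<bar>x::real\<bar>) ^ N \<le> 2 ^ N * (1 + \<bar>x\<bar> ^ N)"
proof (cases "\<bar>x\<bar> \<le> 1")
  case True
  have "(1 + \<bar>x\<bar>) ^ N \<le> 2 ^ N" using True by (intro power_mono) auto
  also have "\<dots> \<le> 2 ^ N * (1 + \<bar>x\<bar> ^ N)" by (simp add: algebra_simps)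
  finally show ?thesis .
next
  case False
  have "(1 + \<bar>x\<bar>) ^ N \<le> (2 * \<bar>x\<bar>) ^ N" using False by (intro power_mono) auto
  also have "\<dots> \<le> 2 ^ N * (1 + \<bar>x\<bar> ^ N)" by (simp add: algebra_simps power_mult_distrib)
  finally show ?thesis .
qed

lemma peetre: "1 + \<bar>a + b\<bar> \<le> (1 + \<bar>a\<bar>) * (1 + \<bar>b::real\<bar>)"
proof -
  have "0 \<le> \<bar>a\<bar> * \<bar>b\<bar>" by simp
  moreover have "(1 + \<bar>a\<bar>) * (1 + \<bar>b\<bar>) = 1 + \<bar>a\<bar> + \<bar>b\<bar> + \<bar>a\<bar> * \<bar>b\<bar>" by (simp add: algebra_simps)
  ultimately show ?thesis using abs_triangle_ineq[of a b] by linarith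
qed

text \<open>
  Peetre's inequality, which moves polynomial weights across a convolution.
\<close>

lemma peetre_power: "(1 + \<bar>x\<bar>) ^ N \<le> (1 + \<bar>x - y\<bar>) ^ N * (1 + \<bar>y::real\<bar>) ^ N"
  using peetre[of "x - y" y] power_mono[of "1 + \<bar>x\<bar>" "(1 + \<bar>x - y\<bar>) * (1 + \<bar>y\<bar>)" N]
  by (simp add: power_mult_distrib)

definition poly_growth :: "(real \<Rightarrow> complex) \<Rightarrow> bool" where
  "poly_growth F \<longleftrightarrow> continuous_on UNIV F \<and> (\<exists>K n. \<forall>x. cmod (F x) \<le> K * (1 + \<bar>x\<bar>) ^ n)"

lemma poly_growthD: "poly_growth F \<Longrightarrow> \<exists>K\<ge>0. \<exists>n. \<forall>x. cmod (F x) \<le> K * (1 + \<bar>x\<bar>) ^ n"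
proof -
  assume "poly_growth F"
  then obtain K n where K: "\<And>x. cmod (F x) \<le> K * (1 + \<bar>x\<bar>) ^ n" unfolding poly_growth_def by blast
  have "K \<ge> 0" using order_trans[OF norm_ge_zero K[of 0]] by simp
  then show ?thesis using K by blast
qed

lemma poly_growth_mult:
  assumes F: "poly_growth F" and G: "poly_growth G"
  shows "poly_growth (\<lambda>x. F x * G x)"
proof -
  obtain K n where K: "K \<ge> 0" "\<And>x. cmod (F x) \<le> K * (1 + \<bar>x\<bar>) ^ n" using poly_growthD[OF F] by blast
  obtain L m where L: "L \<ge> 0" "\<And>x. cmod (G x) \<le> L * (1 + \<bar>x\<bar>) ^ m" using poly_growthD[OF G] by blast
  have "cmod (F x * G x) \<le> (K * L) * (1 + \<bar>x\<bar>) ^ (n + m)" for x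
  proof -
    have "cmod (F x * G x) \<le> (K * (1 + \<bar>x\<bar>) ^ n) * (L * (1 + \<bar>x\<bar>) ^ m)"
      unfolding norm_mult using K L by (intro mult_mono) auto
    then show ?thesis by (simp add: power_add mult_ac)
  qed
  then show ?thesis
    using F G unfolding poly_growth_def by (blast intro: continuous_on_mult)
qed

lemma poly_growth_add:
  assumes F: "poly_growth F" and G: "poly_growth G"
  shows "poly_growth (\<lambda>x. F x + G x)"
proof -
  obtain K n where K: "K \<ge> 0" "\<And>x. cmod (F x) \<le> K * (1 + \<bar>x\<bar>) ^ n" using poly_growthD[OF F] by blast
  obtain L m where L: "L \<ge> 0" "\<And>x. cmod (G x) \<le> L * (1 + \<bar>x\<bar>) ^ m" using poly_growthD[OF G] by blast
  have "cmod (F x + G x) \<le> (K + L) * (1 + \<bar>x\<bar>) ^ (n + m)" for x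
  proof -
    have "cmod (F x + G x) \<le> K * (1 + \<bar>x\<bar>) ^ n + L * (1 + \<bar>x\<bar>) ^ m"
      by (rule order_trans[OF norm_triangle_ineq add_mono[OF K(2) L(2)]])
    also have "\<dots> \<le> K * (1 + \<bar>x\<bar>) ^ (n + m) + L * (1 + \<bar>x\<bar>) ^ (n + m)"
      using K(1) L(1) by (intro add_mono mult_left_mono power_increasing) auto
    finally show ?thesis by (simp add: distrib_right)
  qed
  then show ?thesis
    using F G unfolding poly_growth_def by (blast intro: continuous_on_add)
qed

lemma poly_growth_const: "poly_growth (\<lambda>x. c)"
  unfolding poly_growth_def by (intro conjI continuous_intros exI[of _ "cmod c"] exI[of _ 0]) auto

lemma poly_growth_id: "poly_growth of_real"
  unfolding poly_growth_def by (intro conjI continuous_intros exI[of _ 1] exI[of _ 1]) auto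

lemma poly_growth_power: "poly_growth F \<Longrightarrow> poly_growth (\<lambda>x. F x ^ k)"
  by (induction k) (auto intro: poly_growth_const poly_growth_mult)

lemma poly_growth_bounded:
  "continuous_on UNIV F \<Longrightarrow> (\<And>x. cmod (F x) \<le> K) \<Longrightarrow> poly_growth F"
  unfolding poly_growth_def by (intro conjI exI[of _ K] exI[of _ 0]) auto

lemma rapid_reflect:
  assumes h: "rapid h"
  shows "rapid (\<lambda>\<eta>. h (\<xi> - \<eta>))"
  unfolding rapid_def
proof (intro conjI allI)
  show "continuous_on UNIV (\<lambda>\<eta>. h (\<xi> - \<eta>))"
    using h unfolding rapid_def by (auto intro!: continuous_on_compose2[of UNIV h] continuous_intros)
  fix N
  obtain C where C: "\<And>x. (1 + \<bar>x\<bar>) ^ N * cmod (h x) \<le> C" using rapidD[OF h] by blast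
  have "(1 + \<bar>\<eta>\<bar>) ^ N * cmod (h (\<xi> - \<eta>)) \<le> (1 + \<bar>\<xi>\<bar>) ^ N * C" for \<eta>
  proof -
    have "(1 + \<bar>\<eta>\<bar>) ^ N * cmod (h (\<xi> - \<eta>)) \<le> ((1 + \<bar>\<eta> - \<xi>\<bar>) ^ N * (1 + \<bar>\<xi>\<bar>) ^ N) * cmod (h (\<xi> - \<eta>))"
      by (intro mult_right_mono peetre_power) auto
    also have "\<dots> = (1 + \<bar>\<xi>\<bar>) ^ N * ((1 + \<bar>\<xi> - \<eta>\<bar>) ^ N * cmod (h (\<xi> - \<eta>)))"
      by (simp add: abs_minus_commute)
    also have "\<dots> \<le> (1 + \<bar>\<xi>\<bar>) ^ N * C" by (intro mult_left_mono C) auto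
    finally show ?thesis .
  qed
  then show "\<exists>C. \<forall>\<eta>. (1 + \<bar>\<eta>\<bar>) ^ N * cmod (h (\<xi> - \<eta>)) \<le> C" by blast
qed

lemma rapid_mult:
  assumes h: "rapid h" and F: "poly_growth F"
  shows "rapid (\<lambda>x. h x * F x)"
  unfolding rapid_def
proof (intro conjI allI)
  show "continuous_on UNIV (\<lambda>x. h x * F x)"
    using h F unfolding rapid_def poly_growth_def by (blast intro: continuous_on_mult)
  fix N
  obtain K n where K: "K \<ge> 0" "\<And>x. cmod (F x) \<le> K * (1 + \<bar>x\<bar>) ^ n" using poly_growthD[OF F] by blast
  obtain C where C: "\<And>x. (1 + \<bar>x\<bar>) ^ (N + n) * cmod (h x) \<le> C" using rapidD[OF h] by blast
  have "(1 + \<bar>x\<bar>) ^ N * cmod (h x * F x) \<le> K * C" for x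
  proof -
    have "(1 + \<bar>x\<bar>) ^ N * cmod (h x * F x) \<le> (1 + \<bar>x\<bar>) ^ N * (cmod (h x) * (K * (1 + \<bar>x\<bar>) ^ n))"
      unfolding norm_mult by (intro mult_left_mono K) auto
    also have "\<dots> = K * ((1 + \<bar>x\<bar>) ^ (N + n) * cmod (h x))" by (simp add: power_add mult_ac)
    also have "\<dots> \<le> K * C" using K(1) by (intro mult_left_mono C)
    finally show ?thesis .
  qed
  then show "\<exists>C. \<forall>x. (1 + \<bar>x\<bar>) ^ N * cmod (h x * F x) \<le> C" by blast
qed

text \<open>
  The factor \<open>r\<close> stands for a weight \<open>(1 + \<bar>\<xi>\<bar>) ^ M\<close> in an exterior parameter; if it is absorbed by
  \<open>F\<close> at the price of polynomial growth in \<open>x\<close>, then the rapidly decreasing \<open>h\<close> compensates this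
  growth.
\<close>

lemma rapid_integral_bound:
  assumes h: "rapid h" and F: "continuous_on UNIV F" and r: "r \<ge> 1"
    and le: "\<And>x. r * cmod (F x) \<le> C * (1 + \<bar>x\<bar>) ^ K"
  shows "r * cmod (\<integral>x. h x * F x \<partial>lborel) \<le> (\<integral>x. C * ((1 + \<bar>x\<bar>) ^ K * cmod (h x)) \<partial>lborel)"
proof -
  have "cmod (F x) \<le> C * (1 + \<bar>x\<bar>) ^ K" for x
    using le[of x] mult_right_mono[OF r norm_ge_zero[of "F x"]] by simp
  then have "integrable lborel (\<lambda>x. h x * F x)"
    using F by (intro rapid_integrable rapid_mult[OF h]) (auto simp: poly_growth_def)
  then have i: "integrable lborel (\<lambda>x. of_real r * (h x * F x))" by (rule integrable_mult_right)
  have "r * cmod (\<integral>x. h x * F x \<partial>lborel) = cmod (\<integral>x. of_real r * (h x * F x) \<partial>lborel)"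
    using r unfolding integral_mult_right_zero norm_mult norm_of_real by simp
  also have "\<dots> \<le> (\<integral>x. C * ((1 + \<bar>x\<bar>) ^ K * cmod (h x)) \<partial>lborel)"
  proof (rule Bochner_Integration.integral_norm_bound_integral[OF i])
    show "integrable lborel (\<lambda>x. C * ((1 + \<bar>x\<bar>) ^ K * cmod (h x)))"
      by (rule integrable_mult_right[OF rapid_integrable_weight[OF h]])
    show "cmod (of_real r * (h x * F x)) \<le> C * ((1 + \<bar>x\<bar>) ^ K * cmod (h x))" for x
      using mult_left_mono[OF le[of x], of "cmod (h x)"] r by (simp add: norm_mult mult_ac)
  qed
  finally show ?thesis .
qed

lemma rapid_add:
  assumes f: "rapid f" and g: "rapid g"
  shows "rapid (\<lambda>x. f x + g x)"
  unfolding rapid_def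
proof (intro conjI allI)
  show "continuous_on UNIV (\<lambda>x. f x + g x)"
    using f g unfolding rapid_def by (blast intro: continuous_on_add)
  fix N
  obtain C where C: "\<And>x. (1 + \<bar>x\<bar>) ^ N * cmod (f x) \<le> C" using rapidD[OF f] by blast
  obtain D where D: "\<And>x. (1 + \<bar>x\<bar>) ^ N * cmod (g x) \<le> D" using rapidD[OF g] by blast
  have "(1 + \<bar>x\<bar>) ^ N * cmod (f x + g x) \<le> C + D" for x
  proof -
    have "(1 + \<bar>x\<bar>) ^ N * cmod (f x + g x) \<le> (1 + \<bar>x\<bar>) ^ N * (cmod (f x) + cmod (g x))"
      by (intro mult_left_mono norm_triangle_ineq) auto
    then show ?thesis using C[of x] D[of x] by (simp add: distrib_left)
  qed
  then show "\<exists>C. \<forall>x. (1 + \<bar>x\<bar>) ^ N * cmod (f x + g x) \<le> C" by blast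
qed

lemma rapid_sum: "finite A \<Longrightarrow> (\<And>j. j \<in> A \<Longrightarrow> rapid (f j)) \<Longrightarrow> rapid (\<lambda>x. \<Sum>j\<in>A. f j x)"
proof (induction A rule: finite_induct)
  case empty
  then show ?case by (auto simp: rapid_def intro: exI[of _ 0])
next
  case (insert x A)
  then show ?case by (simp add: rapid_add)
qed

text \<open>
  By Leibniz' rule every derivative of the product is a finite sum of products of a rapidly
  decreasing and a polynomially bounded function.
\<close>

lemma schwartz_mult:
  assumes F: "jet UNIV F" "\<And>k. rapid (F k)" and G: "jet UNIV G" "\<And>k. poly_growth (G k)"
  shows "(\<lambda>x. F 0 x * G 0 x) \<in> schwartz_space"
proof -
  let ?H = "\<lambda>k t. \<Sum>j\<le>k. of_nat (k choose j) * (F j t * G (k - j) t)"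
  have "rapid (?H k)" for k
  proof (rule rapid_sum)
    fix j assume "j \<in> {..k}"
    show "rapid (\<lambda>t. of_nat (k choose j) * (F j t * G (k - j) t))"
      using rapid_mult[OF rapid_mult[OF F(2) G(2)] poly_growth_const[of "of_nat (k choose j)"], of j "k - j"]
      by (simp add: mult.commute)
  qed simp
  then have "\<exists>C. \<forall>x. \<bar>x\<bar> ^ j * cmod (?H k x) \<le> C" for j k
  proof -
    obtain C where C: "\<And>x. (1 + \<bar>x\<bar>) ^ j * cmod (?H k x) \<le> C" using rapidD[OF \<open>\<And>k. rapid (?H k)\<close>] by blast
    have "\<bar>x\<bar> ^ j * cmod (?H k x) \<le> C" for x
      by (rule order_trans[OF mult_right_mono C]) (auto intro: power_mono)
    then show ?thesis by blast
  qed
  from jet_imp_schwartz[OF jet_mult[OF F(1) G(1)] this] show ?thesis by simp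
qed

lemma jet_reflect:
  assumes F: "jet UNIV F"
  shows "jet UNIV (\<lambda>k \<eta>. (- 1) ^ k * F k (\<xi> - \<eta>))"
  unfolding jet_def
proof (intro allI ballI)
  fix k and t :: real
  have "((\<lambda>\<eta>. \<xi> - \<eta>) has_vector_derivative - 1) (at t)" by (auto intro!: derivative_eq_intros)
  from vector_diff_chain_at[OF this jetD[OF F, of "\<xi> - t" k, simplified]]
  have "((\<lambda>\<eta>. F k (\<xi> - \<eta>)) has_vector_derivative - F (Suc k) (\<xi> - t)) (at t)" by (simp add: o_def)
  from has_vector_derivative_mult_right[OF this, of "(- 1) ^ k"]
  show "((\<lambda>\<eta>. (- 1) ^ k * F k (\<xi> - \<eta>)) has_vector_derivative (- 1) ^ Suc k * F (Suc k) (\<xi> - t)) (at t)" by simp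
qed

lemma schwartz_rapid: assumes "\<psi> \<in> schwartz_space" shows "rapid \<psi>"
  unfolding rapid_def
proof (intro conjI allI)
  show "continuous_on UNIV \<psi>" using jet_continuous[OF schwartz_jet[OF assms], of 0] by simp
  fix N
  have all: "\<forall>j k. bdd_above (range (\<lambda>x. \<bar>x\<bar> ^ j * cmod (nderiv_within UNIV k \<psi> x)))"
    using assms unfolding schwartz_space_def by simp
  have b: "\<exists>C. \<forall>x. \<bar>x\<bar> ^ j * cmod (\<psi> x) \<le> C" for j
    using all[rule_format, of j 0] unfolding bdd_above_def by auto
  obtain C where C: "\<And>x. \<bar>x\<bar> ^ 0 * cmod (\<psi> x) \<le> C" using b by blast
  obtain D where D: "\<And>x. \<bar>x\<bar> ^ N * cmod (\<psi> x) \<le> D" using b by blast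
  have "(1 + \<bar>x\<bar>) ^ N * cmod (\<psi> x) \<le> 2 ^ N * (C + D)" for x
  proof -
    have "(1 + \<bar>x\<bar>) ^ N * cmod (\<psi> x) \<le> 2 ^ N * (1 + \<bar>x\<bar> ^ N) * cmod (\<psi> x)"
      by (intro mult_right_mono bracket_power_le) auto
    also have "\<dots> = 2 ^ N * (\<bar>x\<bar> ^ 0 * cmod (\<psi> x) + \<bar>x\<bar> ^ N * cmod (\<psi> x))" by (simp add: algebra_simps)
    also have "\<dots> \<le> 2 ^ N * (C + D)" by (intro mult_left_mono add_mono C D) auto
    finally show ?thesis .
  qed
  then show "\<exists>C. \<forall>x. (1 + \<bar>x\<bar>) ^ N * cmod (\<psi> x) \<le> C" by blast
qed

section \<open>Fourier transforms of test functions\<close>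

text \<open>
  Smooth functions supported in \<open>[a,b]\<close>. The support condition is imposed on the whole jet so that
  the class is evidently closed under differentiation.
\<close>

definition test_fun :: "real \<Rightarrow> real \<Rightarrow> (real \<Rightarrow> complex) \<Rightarrow> bool" where
  "test_fun a b f \<longleftrightarrow> (\<exists>P. jet UNIV P \<and> P 0 = f \<and> (\<forall>k x. x \<notin> {a..b} \<longrightarrow> P k x = 0))"

lemma test_function01_test_fun:
  assumes "\<phi> \<in> test_functions01"
  obtains a b where "0 < a" "a < b" "b < 1" "test_fun a b \<phi>"
proof -
  let ?K = "closure {x. \<phi> x \<noteq> 0}"
  have sm: "\<phi> \<in> smooth_on UNIV" and K: "?K \<subseteq> {0<..<1}"
    using assms by (auto simp: test_functions01_def)
  have cK: "compact ?K"
  proof -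
    have "bounded ?K" by (rule bounded_subset[OF _ K]) simp
    then show ?thesis by (simp add: compact_eq_bounded_closed)
  qed
  \<comment> \<open>The left end point is halved only to ensure \<open>a < b\<close>.\<close>
  obtain a b where ab: "0 < a" "a < b" "b < 1" "?K \<subseteq> {a..b}"
  proof (cases "?K = {}")
    case True
    then show ?thesis using that[of "1/3" "2/3"] by simp
  next
    case False
    obtain l where l: "l \<in> ?K" "\<And>x. x \<in> ?K \<Longrightarrow> l \<le> x"
      using compact_attains_inf[OF cK False] by blast
    obtain r where r: "r \<in> ?K" "\<And>x. x \<in> ?K \<Longrightarrow> x \<le> r"
      using compact_attains_sup[OF cK False] by blast
    have "0 < l" "r < 1" "l < 1" "l \<le> r" using K l r by auto
    then show ?thesis
      using order_trans[of "l / 2" l, OF _ l(2)] r(2) by (intro that[of "l / 2" r]) (auto simp: subset_iff)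
  qed
  let ?P = "\<lambda>k. nderiv_within UNIV k \<phi>"
  have P: "jet UNIV ?P" by (rule jet_nderiv_within[OF sm])
  have "?P k x = 0" if "x \<notin> {a..b}" for k x
    using that
  proof (induction k arbitrary: x)
    case 0
    then show ?case using ab(4) closure_subset[of "{x. \<phi> x \<noteq> 0}"] by auto
  next
    case (Suc k)
    have "(?P k has_vector_derivative 0) (at x)"
      by (rule has_vector_derivative_transform_within_open[of "\<lambda>_. 0" 0 x "- {a..b}"])
         (use Suc in auto)
    moreover have "(?P k has_vector_derivative ?P (Suc k) x) (at x)" using jetD[OF P] by simp
    ultimately show ?case using vector_derivative_unique_at by blast
  qed
  then have "test_fun a b \<phi>" unfolding test_fun_def using P by (intro exI[of _ ?P]) auto
  then show ?thesis using that ab by blast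
qed

lemma test_fun_continuous: "test_fun a b f \<Longrightarrow> continuous_on UNIV f"
  unfolding test_fun_def using jet_continuous[of UNIV _ 0] by blast

lemma test_fun_vanish: "test_fun a b f \<Longrightarrow> x \<notin> {a..b} \<Longrightarrow> f x = 0"
  unfolding test_fun_def by blast

lemma test_fun_deriv:
  assumes "test_fun a b f"
  obtains g where "test_fun a b g" "\<And>x. (f has_vector_derivative g x) (at x)"
proof -
  obtain P where P: "jet UNIV P" "P 0 = f" "\<forall>k x. x \<notin> {a..b} \<longrightarrow> P k x = 0"
    using assms unfolding test_fun_def by blast
  have "test_fun a b (P 1)"
    unfolding test_fun_def using P jet_shift[OF P(1), of 1] by (intro exI[of _ "\<lambda>k. P (k + 1)"]) auto
  moreover have "(f has_vector_derivative P 1 x) (at x)" for x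
    using jetD[OF P(1), of x 0] P(2) by simp
  ultimately show ?thesis using that by blast
qed

lemma test_fun_bounded:
  assumes "test_fun a b f" "0 \<le> a" "b \<le> 1"
  shows "\<exists>B\<ge>0. \<forall>x. cmod (f x) \<le> B * indicator {0..1} x"
proof -
  have "bounded (f ` {0..1})"
    by (intro compact_imp_bounded compact_continuous_image
        continuous_on_subset[OF test_fun_continuous[OF assms(1)]]) auto
  then obtain B where B: "B > 0" "\<And>x. x \<in> {0..1} \<Longrightarrow> cmod (f x) \<le> B"
    unfolding bounded_pos by blast
  have "cmod (f x) \<le> B * indicator {0..1} x" for x
    using B(2)[of x] test_fun_vanish[OF assms(1), of x] assms(2,3) by (auto simp: indicator_def)
  then show ?thesis using B(1) by (intro exI[of _ B]) auto
qed

lemma test_fun_integrable: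
  assumes "test_fun a b f" "0 \<le> a" "b \<le> 1"
  shows "integrable lborel f"
proof -
  obtain B where B: "\<And>x. cmod (f x) \<le> B * indicator {0..1} x" using test_fun_bounded[OF assms] by blast
  show ?thesis
    by (rule Bochner_Integration.integrable_bound[of _ "\<lambda>x. B * indicator {0..1} x"])
       (use B order_trans[OF B abs_ge_self] borel_measurable_continuous_onI[OF test_fun_continuous[OF assms(1)]]
        in \<open>auto intro!: integrable_mult_right integrable_real_indicator\<close>)
qed

lemma test_fun_mult_x:
  assumes "test_fun a b f"
  shows "test_fun a b (\<lambda>x. (- \<i> * of_real x) * f x)"
proof -
  obtain P where P: "jet UNIV P" "P 0 = f" "\<And>k x. x \<notin> {a..b} \<Longrightarrow> P k x = 0"
    using assms unfolding test_fun_def by blast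
  define L where "L = (\<lambda>k::nat. \<lambda>x::real. if k = 0 then - \<i> * of_real x else if k = 1 then - \<i> else 0)"
  have L: "jet UNIV L"
    unfolding jet_def
  proof (intro allI ballI)
    fix k and t :: real
    show "(L k has_vector_derivative L (Suc k) t) (at t)"
      by (cases "k = 0"; cases "k = 1") (auto simp: L_def intro!: derivative_eq_intros has_vector_derivative_real_field)
  qed
  show ?thesis
    unfolding test_fun_def using jet_mult[OF L P(1)] P(2,3)
    by (intro exI[of _ "\<lambda>k t. \<Sum>j\<le>k. of_nat (k choose j) * (L j t * P (k - j) t)"])
       (auto simp: L_def fun_eq_iff)
qed

lemma test_fun_mult_x_power:
  "test_fun a b f \<Longrightarrow> test_fun a b (\<lambda>x. f x * (- \<i> * of_real x) ^ k)"
proof (induction k)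
  case (Suc k)
  show ?case
    using test_fun_mult_x[OF Suc.IH[OF Suc.prems]] by (simp add: mult_ac)
qed simp

text \<open>
  Integration by parts; there are no boundary terms, as \<open>f\<close> vanishes at \<open>0\<close> and \<open>1\<close>.
\<close>

lemma fourier_deriv:
  assumes f: "test_fun a b f" and ab: "0 < a" "b < 1" and fg: "\<And>x. (f has_vector_derivative g x) (at x)"
    and g: "test_fun a b g"
  shows "fourier g \<zeta> = \<i> * of_real \<zeta> * fourier f \<zeta>"
proof -
  let ?e = "\<lambda>x. exp (- \<i> * of_real (x * \<zeta>))"
  let ?F = "\<lambda>x. ?e x * g x - \<i> * of_real \<zeta> * (?e x * f x)"
  have int: "integrable lborel (\<lambda>x. ?e x * h x)" if "test_fun a b h" for h
    by (rule Bochner_Integration.integrable_bound[OF test_fun_integrable[OF that]])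
       (use ab borel_measurable_continuous_onI[OF test_fun_continuous[OF that]] in \<open>auto simp: norm_mult\<close>)
  have "(\<integral>x. indicator {0..1} x *\<^sub>R ?F x \<partial>lborel) = ?e 1 * f 1 - ?e 0 * f 0"
  proof (rule integral_FTC_atLeastAtMost)
    show "((\<lambda>x. ?e x * f x) has_vector_derivative ?F x) (at x within {0..1})" for x
    proof -
      have "(?e has_vector_derivative (- \<i> * of_real \<zeta> * ?e x)) (at x within {0..1})"
        by (auto intro!: derivative_eq_intros has_vector_derivative_real_field)
      from has_vector_derivative_mult[OF this has_vector_derivative_at_within[OF fg[of x]]]
      show ?thesis by (simp add: algebra_simps)
    qed
    show "continuous_on {0..1} ?F"
      by (intro continuous_intros continuous_on_subset[OF test_fun_continuous[OF f]] continuous_on_subset[OF test_fun_continuous[OF g]]) auto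
  qed simp
  also have "\<dots> = 0" using test_fun_vanish[OF f] ab by simp
  also have "(\<integral>x. indicator {0..1} x *\<^sub>R ?F x \<partial>lborel) = (\<integral>x. ?F x \<partial>lborel)"
    by (rule Bochner_Integration.integral_cong)
       (use test_fun_vanish[OF f] test_fun_vanish[OF g] ab in \<open>auto simp: indicator_def\<close>)
  also have "\<dots> = fourier g \<zeta> - \<i> * of_real \<zeta> * fourier f \<zeta>"
    unfolding fourier_def using int[OF f] int[OF g] by simp
  finally show ?thesis by simp
qed

lemma fourier_jet:
  assumes f: "test_fun a b f" and ab: "0 < a" "b < 1"
  shows "jet UNIV (\<lambda>k. fourier (\<lambda>x. f x * (- \<i> * of_real x) ^ k))"
proof -
  obtain B where B: "\<And>x. cmod (f x) \<le> B * indicator {0..1} x" using test_fun_bounded[OF f] ab by force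
  interpret E: exp_integral UNIV f "\<lambda>x. - \<i> * of_real x" "\<lambda>k x. cmod (f x * (- \<i> * of_real x) ^ k)"
  proof
    show "f \<in> borel_measurable borel"
      by (rule borel_measurable_continuous_onI[OF test_fun_continuous[OF f]])
    show "integrable lborel (\<lambda>x. cmod (f x * (- \<i> * of_real x) ^ k))" for k
      by (rule integrable_norm, rule test_fun_integrable[OF test_fun_mult_x_power[OF f]]) (use ab in auto)
    show "cmod (f x * (- \<i> * of_real x) ^ k * exp (of_real t * (- \<i> * of_real x))) \<le> cmod (f x * (- \<i> * of_real x) ^ k)" for k t x
      by (simp add: norm_mult)
  qed auto
  have "E.K = (\<lambda>k. fourier (\<lambda>x. f x * (- \<i> * of_real x) ^ k))"
    unfolding E.K_def fourier_def by (intro ext) (simp add: mult_ac)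
  then show ?thesis using E.jet_K by simp
qed

lemma fourier_bounded:
  assumes f: "test_fun a b f" and ab: "0 < a" "b < 1"
  shows "\<exists>C\<ge>0. \<forall>\<zeta>. cmod (fourier f \<zeta>) \<le> C"
proof (intro exI conjI allI)
  have i: "integrable lborel f" by (rule test_fun_integrable[OF f]) (use ab in auto)
  show "cmod (fourier f \<zeta>) \<le> (\<integral>x. cmod (f x) \<partial>lborel)" for \<zeta>
  proof -
    have "cmod (fourier f \<zeta>) \<le> (\<integral>x. cmod (exp (- \<i> * of_real (x * \<zeta>)) * f x) \<partial>lborel)"
      unfolding fourier_def by (rule integral_norm_bound)
    then show ?thesis by (simp add: norm_mult)
  qed
  show "0 \<le> (\<integral>x. cmod (f x) \<partial>lborel)" by simp
qed

lemma test_fun_deriv_power: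
  assumes f: "test_fun a b f" and ab: "0 < a" "b < 1"
  shows "\<exists>g. test_fun a b g \<and> (\<forall>\<zeta>. fourier g \<zeta> = (\<i> * of_real \<zeta>) ^ k * fourier f \<zeta>)"
proof (induction k)
  case 0
  show ?case using f by (intro exI[of _ f]) simp
next
  case (Suc k)
  then obtain g where g: "test_fun a b g" "\<And>\<zeta>. fourier g \<zeta> = (\<i> * of_real \<zeta>) ^ k * fourier f \<zeta>" by blast
  obtain h where h: "test_fun a b h" "\<And>x. (g has_vector_derivative h x) (at x)" using test_fun_deriv[OF g(1)] by blast
  show ?case using fourier_deriv[OF g(1) ab h(2) h(1)] g(2) h(1) by (intro exI[of _ h]) (simp add: mult_ac)
qed

text \<open>
  The \<open>N\<close>-th derivative of \<open>f\<close> has the bounded Fourier transform \<open>(\<i> \<zeta>) ^ N * fourier f \<zeta>\<close>.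
\<close>

lemma fourier_rapid:
  assumes f: "test_fun a b f" and ab: "0 < a" "b < 1"
  shows "rapid (fourier f)"
  unfolding rapid_def
proof (intro conjI allI)
  show "continuous_on UNIV (fourier f)"
    using jet_continuous[OF fourier_jet[OF assms], of 0] by simp
  fix N
  obtain g where g: "test_fun a b g" "\<And>\<zeta>. fourier g \<zeta> = (\<i> * of_real \<zeta>) ^ N * fourier f \<zeta>"
    using test_fun_deriv_power[OF assms] by blast
  obtain C where C: "\<And>\<zeta>. cmod (fourier f \<zeta>) \<le> C" using fourier_bounded[OF f ab] by blast
  obtain D where D: "\<And>\<zeta>. cmod (fourier g \<zeta>) \<le> D" using fourier_bounded[OF g(1) ab] by blast
  have "(1 + \<bar>x\<bar>) ^ N * cmod (fourier f x) \<le> 2 ^ N * (C + D)" for x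
  proof -
    have "(1 + \<bar>x\<bar>) ^ N * cmod (fourier f x) \<le> 2 ^ N * (1 + \<bar>x\<bar> ^ N) * cmod (fourier f x)"
      by (intro mult_right_mono bracket_power_le) auto
    also have "\<dots> = 2 ^ N * (cmod (fourier f x) + cmod (fourier g x))"
      by (simp add: g(2) norm_mult norm_power algebra_simps)
    also have "\<dots> \<le> 2 ^ N * (C + D)" by (intro mult_left_mono add_mono C D) auto
    finally show ?thesis .
  qed
  then show "\<exists>C. \<forall>x. (1 + \<bar>x\<bar>) ^ N * cmod (fourier f x) \<le> C" by blast
qed

text \<open>
  Read off from the characteristic function of the standard normal distribution.
\<close>

lemma gauss_fourier:
  "(\<integral>y. iexp (t * y) * of_real (exp (- y\<^sup>2 / 2)) \<partial>lborel) = of_real (sqrt (2 * pi) * exp (- t\<^sup>2 / 2))"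
proof -
  have "of_real (exp (- t\<^sup>2 / 2)) = (\<integral>y. std_normal_density y *\<^sub>R iexp (t * y) \<partial>lborel)"
    using fun_cong[OF char_std_normal_distribution, of t]
    by (simp add: char_def integral_density)
  also have "\<dots> = (\<integral>y. of_real (1 / sqrt (2 * pi)) * (iexp (t * y) * of_real (exp (- y\<^sup>2 / 2))) \<partial>lborel)"
    by (rule Bochner_Integration.integral_cong) (auto simp: std_normal_density_def scaleR_conv_of_real)
  also have "\<dots> = of_real (1 / sqrt (2 * pi)) * (\<integral>y. iexp (t * y) * of_real (exp (- y\<^sup>2 / 2)) \<partial>lborel)"
    by simp
  finally have "of_real (sqrt (2 * pi)) * complex_of_real (exp (- t\<^sup>2 / 2))
     = of_real (sqrt (2 * pi)) * (of_real (1 / sqrt (2 * pi)) * (\<integral>y. iexp (t * y) * of_real (exp (- y\<^sup>2 / 2)) \<partial>lborel))"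
    by (rule arg_cong)
  then show ?thesis
    unfolding mult.assoc[symmetric] of_real_mult[symmetric] by simp
qed

lemma gauss_fourier_scaled:
  assumes e: "e > 0"
  shows "(\<integral>\<eta>. iexp (s * \<eta>) * of_real (exp (- (e * \<eta>)\<^sup>2 / 2)) \<partial>lborel)
    = of_real (sqrt (2 * pi) / e * exp (- (s / e)\<^sup>2 / 2))"
proof -
  have "(\<integral>\<eta>. iexp (s * \<eta>) * of_real (exp (- (e * \<eta>)\<^sup>2 / 2)) \<partial>lborel)
     = \<bar>1 / e\<bar> *\<^sub>R (\<integral>y. iexp (s * (0 + 1 / e * y)) * of_real (exp (- (e * (0 + 1 / e * y))\<^sup>2 / 2)) \<partial>lborel)"
    by (rule lborel_integral_real_affine) (use e in auto)
  also have "(\<integral>y. iexp (s * (0 + 1 / e * y)) * of_real (exp (- (e * (0 + 1 / e * y))\<^sup>2 / 2)) \<partial>lborel)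
     = of_real (sqrt (2 * pi) * exp (- (s / e)\<^sup>2 / 2))"
    using gauss_fourier[of "s / e"] e by simp
  finally show ?thesis using e by (simp add: scaleR_conv_of_real)
qed

lemma gauss_integrable:
  fixes e :: real
  assumes e: "e > 0"
  shows "integrable lborel (\<lambda>\<eta>. exp (- (e * \<eta>)\<^sup>2 / 2))"
proof -
  have "integrable lborel (\<lambda>x. sqrt (2 * pi) * std_normal_density x)"
    by (intro integrable_mult_right integrable_normal_density) simp
  then have "integrable lborel (\<lambda>x::real. exp (- x\<^sup>2 / 2))" by (simp add: std_normal_density_def)
  from lborel_integrable_real_affine[OF this, of e 0] e show ?thesis by simp
qed

text \<open>
  Inserting a Gaussian factor makes the double integral absolutely convergent. Fubini's theorem and
  the Fourier transform of the Gaussian turn it into an average of \<open>f\<close> near \<open>\<tau>\<close>.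
\<close>

lemma fourier_inversion_regularised:
  assumes f: "test_fun a b f" and ab: "0 < a" "b < 1" and e: "e > 0"
  shows "(\<integral>\<eta>. fourier f \<eta> * iexp (\<tau> * \<eta>) * of_real (exp (- (e * \<eta>)\<^sup>2 / 2)) \<partial>lborel)
     = of_real (2 * pi) * (\<integral>v. f (\<tau> + e * v) * of_real (std_normal_density v) \<partial>lborel)"
proof -
  let ?g = "\<lambda>\<eta>. exp (- (e * \<eta>)\<^sup>2 / 2)"
  let ?h = "\<lambda>x \<eta>. f x * (iexp ((\<tau> - x) * \<eta>) * of_real (?g \<eta>))"
  have [measurable]: "f \<in> borel_measurable borel"
    by (rule borel_measurable_continuous_onI[OF test_fun_continuous[OF f]])
  have fi: "integrable lborel f" by (rule test_fun_integrable[OF f]) (use ab in auto)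
  have nh: "cmod (?h x \<eta>) = cmod (f x) * ?g \<eta>" for x \<eta> by (simp add: norm_mult)
  have int: "integrable (lborel \<Otimes>\<^sub>M lborel) (\<lambda>(x, \<eta>). ?h x \<eta>)"
  proof (rule lborel_pair.Fubini_integrable)
    show "(\<lambda>(x, \<eta>). ?h x \<eta>) \<in> borel_measurable (lborel \<Otimes>\<^sub>M lborel)"
      by measurable
    show "integrable lborel (\<lambda>x. \<integral>\<eta>. norm (case (x, \<eta>) of (x, \<eta>) \<Rightarrow> ?h x \<eta>) \<partial>lborel)"
      unfolding prod.case nh using fi by simp
    show "AE x in lborel. integrable lborel (\<lambda>\<eta>. case (x, \<eta>) of (x, \<eta>) \<Rightarrow> ?h x \<eta>)"
    proof (rule AE_I2)
      fix x
      show "integrable lborel (\<lambda>\<eta>. case (x, \<eta>) of (x, \<eta>) \<Rightarrow> ?h x \<eta>)"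
        unfolding prod.case
        by (rule Bochner_Integration.integrable_bound[OF integrable_mult_right[OF gauss_integrable[OF e], of "cmod (f x)"]])
           (auto simp: norm_mult)
    qed
  qed
  have "(\<integral>\<eta>. fourier f \<eta> * iexp (\<tau> * \<eta>) * of_real (?g \<eta>) \<partial>lborel)
      = (\<integral>\<eta>. (\<integral>x. ?h x \<eta> \<partial>lborel) \<partial>lborel)"
  proof (rule Bochner_Integration.integral_cong[OF refl])
    fix \<eta>
    have "fourier f \<eta> * iexp (\<tau> * \<eta>) * of_real (?g \<eta>)
        = (\<integral>x. exp (- \<i> * of_real (x * \<eta>)) * f x \<partial>lborel) * (iexp (\<tau> * \<eta>) * of_real (?g \<eta>))"
      by (simp only: fourier_def mult.assoc)
    also have "\<dots> = (\<integral>x. exp (- \<i> * of_real (x * \<eta>)) * f x * (iexp (\<tau> * \<eta>) * of_real (?g \<eta>)) \<partial>lborel)"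
      by (rule integral_mult_left_zero[symmetric])
    also have "\<dots> = (\<integral>x. ?h x \<eta> \<partial>lborel)"
    proof (rule Bochner_Integration.integral_cong[OF refl])
      fix x
      have eq: "exp (- \<i> * complex_of_real (x * \<eta>)) * iexp (\<tau> * \<eta>) = iexp ((\<tau> - x) * \<eta>)"
        by (simp add: exp_add[symmetric] algebra_simps)
      have "exp (- \<i> * of_real (x * \<eta>)) * f x * (iexp (\<tau> * \<eta>) * of_real (?g \<eta>))
          = f x * ((exp (- \<i> * complex_of_real (x * \<eta>)) * iexp (\<tau> * \<eta>)) * of_real (?g \<eta>))"
        by (simp only: mult_ac)
      then show "exp (- \<i> * of_real (x * \<eta>)) * f x * (iexp (\<tau> * \<eta>) * of_real (?g \<eta>)) = ?h x \<eta>"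
        by (simp only: eq)
    qed
    finally show "fourier f \<eta> * iexp (\<tau> * \<eta>) * of_real (?g \<eta>) = (\<integral>x. ?h x \<eta> \<partial>lborel)" .
  qed
  also have "\<dots> = (\<integral>x. (\<integral>\<eta>. ?h x \<eta> \<partial>lborel) \<partial>lborel)"
    by (rule lborel_pair.Fubini_integral[OF int])
  also have "\<dots> = (\<integral>x. f x * of_real (sqrt (2 * pi) / e * exp (- ((\<tau> - x) / e)\<^sup>2 / 2)) \<partial>lborel)"
    by (simp only: integral_mult_right_zero gauss_fourier_scaled[OF e])
  also have "\<dots> = \<bar>e\<bar> *\<^sub>R (\<integral>v. f (\<tau> + e * v) * of_real (sqrt (2 * pi) / e * exp (- ((\<tau> - (\<tau> + e * v)) / e)\<^sup>2 / 2)) \<partial>lborel)"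
    by (rule lborel_integral_real_affine) (use e in auto)
  also have "\<dots> = (\<integral>v. of_real (2 * pi) * (f (\<tau> + e * v) * of_real (std_normal_density v)) \<partial>lborel)"
    unfolding integral_scaleR_right[symmetric]
  proof (rule Bochner_Integration.integral_cong[OF refl])
    fix v
    have "(\<tau> - (\<tau> + e * v)) / e = - v" using e by simp
    moreover have "2 * pi / sqrt (2 * pi) = sqrt (2 * pi)"
      by (rule real_div_sqrt) simp
    then have "2 * pi * std_normal_density v = \<bar>e\<bar> * (sqrt (2 * pi) / e * exp (- v\<^sup>2 / 2))"
      using e by (simp add: std_normal_density_def field_simps)
    ultimately show "\<bar>e\<bar> *\<^sub>R (f (\<tau> + e * v) * of_real (sqrt (2 * pi) / e * exp (- ((\<tau> - (\<tau> + e * v)) / e)\<^sup>2 / 2)))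
        = of_real (2 * pi) * (f (\<tau> + e * v) * of_real (std_normal_density v))"
      by (metis (no_types, opaque_lifting) mult.left_commute of_real_mult power2_minus scaleR_conv_of_real)
  qed
  finally show ?thesis by simp
qed

text \<open>
  The width \<open>e\<close> of the average in \<open>fourier_inversion_regularised\<close> tends to \<open>0\<close>; dominated
  convergence applies on both sides.
\<close>

lemma fourier_inversion:
  assumes f: "test_fun a b f" and ab: "0 < a" "b < 1"
  shows "(\<integral>\<eta>. fourier f \<eta> * iexp (\<tau> * \<eta>) \<partial>lborel) = of_real (2 * pi) * f \<tau>"
proof -
  have [measurable]: "f \<in> borel_measurable borel"
    by (rule borel_measurable_continuous_onI[OF test_fun_continuous[OF f]])
  have R: "rapid (fourier f)" by (rule fourier_rapid[OF assms])
  note [measurable] = rapid_measurable[OF R]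
  define e where "e = (\<lambda>n. 1 / real (Suc n))"
  have e: "e n > 0" for n by (simp add: e_def)
  have e0: "e \<longlonglongrightarrow> 0" unfolding e_def by (rule LIMSEQ_Suc[OF lim_1_over_n])
  have 1: "(\<lambda>n. \<integral>\<eta>. fourier f \<eta> * iexp (\<tau> * \<eta>) * of_real (exp (- (e n * \<eta>)\<^sup>2 / 2)) \<partial>lborel)
     \<longlonglongrightarrow> (\<integral>\<eta>. fourier f \<eta> * iexp (\<tau> * \<eta>) \<partial>lborel)"
  proof (rule integral_dominated_convergence[where w = "\<lambda>\<eta>. cmod (fourier f \<eta>)"])
    show "AE \<eta> in lborel. (\<lambda>n. fourier f \<eta> * iexp (\<tau> * \<eta>) * of_real (exp (- (e n * \<eta>)\<^sup>2 / 2))) \<longlonglongrightarrow> fourier f \<eta> * iexp (\<tau> * \<eta>)"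
    proof (rule AE_I2)
      fix \<eta>
      have "(\<lambda>n. fourier f \<eta> * iexp (\<tau> * \<eta>) * of_real (exp (- (e n * \<eta>)\<^sup>2 / 2))) \<longlonglongrightarrow> fourier f \<eta> * iexp (\<tau> * \<eta>) * of_real (exp (- (0 * \<eta>)\<^sup>2 / 2))"
        by (intro tendsto_intros e0) simp
      then show "(\<lambda>n. fourier f \<eta> * iexp (\<tau> * \<eta>) * of_real (exp (- (e n * \<eta>)\<^sup>2 / 2))) \<longlonglongrightarrow> fourier f \<eta> * iexp (\<tau> * \<eta>)" by simp
    qed
    show "AE \<eta> in lborel. cmod (fourier f \<eta> * iexp (\<tau> * \<eta>) * of_real (exp (- (e n * \<eta>)\<^sup>2 / 2))) \<le> cmod (fourier f \<eta>)" for n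
      by (rule AE_I2) (auto simp: norm_mult intro!: mult_left_le)
  qed (use rapid_integrable[OF R] in auto)
  obtain B where B: "\<And>x. cmod (f x) \<le> B * indicator {0..1} x" "B \<ge> 0" using test_fun_bounded[OF f] ab by force
  have Bf: "cmod (f x) \<le> B" for x using B(1)[of x] B(2) by (cases "x \<in> {0..1}") auto
  have nd: "integrable lborel std_normal_density" by (intro integrable_normal_density) simp
  have 2: "(\<lambda>n. \<integral>v. f (\<tau> + e n * v) * of_real (std_normal_density v) \<partial>lborel)
     \<longlonglongrightarrow> (\<integral>v. f \<tau> * of_real (std_normal_density v) \<partial>lborel)"
  proof (rule integral_dominated_convergence[where w = "\<lambda>v. B * std_normal_density v"])
    show "AE v in lborel. (\<lambda>n. f (\<tau> + e n * v) * of_real (std_normal_density v)) \<longlonglongrightarrow> f \<tau> * of_real (std_normal_density v)"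
    proof (rule AE_I2)
      fix v
      have "(\<lambda>n. \<tau> + e n * v) \<longlonglongrightarrow> \<tau> + 0 * v" by (intro tendsto_intros e0)
      then have "(\<lambda>n. f (\<tau> + e n * v)) \<longlonglongrightarrow> f \<tau>"
        using continuous_on_tendsto_compose[OF test_fun_continuous[OF f]] by simp
      then show "(\<lambda>n. f (\<tau> + e n * v) * of_real (std_normal_density v)) \<longlonglongrightarrow> f \<tau> * of_real (std_normal_density v)"
        by (intro tendsto_intros)
    qed
    show "AE v in lborel. cmod (f (\<tau> + e n * v) * of_real (std_normal_density v)) \<le> B * std_normal_density v" for n
      by (rule AE_I2) (auto simp: norm_mult normal_density_nonneg intro!: mult_right_mono Bf)
  qed (use nd in auto)
  have 3: "(\<integral>v. f \<tau> * of_real (std_normal_density v) \<partial>lborel) = f \<tau>"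
    using nd integral_normal_density[of 1 0] by simp
  have "(\<lambda>n. \<integral>\<eta>. fourier f \<eta> * iexp (\<tau> * \<eta>) * of_real (exp (- (e n * \<eta>)\<^sup>2 / 2)) \<partial>lborel) \<longlonglongrightarrow> of_real (2 * pi) * f \<tau>"
    unfolding fourier_inversion_regularised[OF assms e] using tendsto_mult_left[OF 2, of "of_real (2 * pi)"] 3 by simp
  then show ?thesis using LIMSEQ_unique[OF 1] by blast
qed

lemma fourier_fourier_shift:
  assumes f: "test_fun a b f" and ab: "0 < a" "b < 1"
  shows "fourier (\<lambda>\<eta>. fourier f (\<xi> - \<eta>)) \<tau> = of_real (2 * pi) * (f \<tau> * exp (of_real \<tau> * (- \<i> * of_real \<xi>)))"
proof -
  have "fourier (\<lambda>\<eta>. fourier f (\<xi> - \<eta>)) \<tau>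
     = \<bar>-1\<bar> *\<^sub>R (\<integral>\<zeta>. exp (- \<i> * of_real ((\<xi> + (-1) * \<zeta>) * \<tau>)) * fourier f (\<xi> - (\<xi> + (-1) * \<zeta>)) \<partial>lborel)"
    unfolding fourier_def[of "\<lambda>\<eta>. fourier f (\<xi> - \<eta>)"] by (rule lborel_integral_real_affine) simp
  also have "\<dots> = (\<integral>\<zeta>. exp (of_real \<tau> * (- \<i> * of_real \<xi>)) * (fourier f \<zeta> * iexp (\<tau> * \<zeta>)) \<partial>lborel)"
  proof (simp only: abs_minus_cancel abs_one scaleR_one, rule Bochner_Integration.integral_cong[OF refl])
    fix \<zeta>
    have "exp (- \<i> * complex_of_real ((\<xi> + - 1 * \<zeta>) * \<tau>)) = exp (of_real \<tau> * (- \<i> * of_real \<xi>)) * iexp (\<tau> * \<zeta>)"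
      by (simp add: exp_add[symmetric] algebra_simps)
    then show "exp (- \<i> * complex_of_real ((\<xi> + - 1 * \<zeta>) * \<tau>)) * fourier f (\<xi> - (\<xi> + - 1 * \<zeta>))
        = exp (of_real \<tau> * (- \<i> * of_real \<xi>)) * (fourier f \<zeta> * iexp (\<tau> * \<zeta>))"
      by (simp add: mult_ac)
  qed
  also have "\<dots> = exp (of_real \<tau> * (- \<i> * of_real \<xi>)) * (of_real (2 * pi) * f \<tau>)"
    using fourier_inversion[OF assms, of \<tau>] by simp
  finally show ?thesis by (simp add: mult_ac)
qed

text \<open>
  Up to a constant, the \<open>k\<close>-th moment is the \<open>k\<close>-th derivative of \<open>f\<close> at \<open>X\<close>. This is the source
  of decay for points of other sides that are close to the line through the given side.
\<close>

lemma fourier_moment_vanishes: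
  assumes f: "test_fun a b f" and ab: "0 < a" "b < 1" and X: "X \<notin> {a..b}"
  shows "(\<integral>\<zeta>. fourier f \<zeta> * of_real \<zeta> ^ k * iexp (X * \<zeta>) \<partial>lborel) = 0"
proof -
  obtain g where g: "test_fun a b g" "\<And>\<zeta>. fourier g \<zeta> = (\<i> * of_real \<zeta>) ^ k * fourier f \<zeta>"
    using test_fun_deriv_power[OF f ab] by blast
  have "\<i> ^ k * (\<integral>\<zeta>. fourier f \<zeta> * of_real \<zeta> ^ k * iexp (X * \<zeta>) \<partial>lborel) = (\<integral>\<zeta>. fourier g \<zeta> * iexp (X * \<zeta>) \<partial>lborel)"
    unfolding integral_mult_right_zero[symmetric]
    by (rule Bochner_Integration.integral_cong) (auto simp: g(2) power_mult_distrib)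
  also have "\<dots> = of_real (2 * pi) * g X" by (rule fourier_inversion[OF g(1) ab])
  also have "\<dots> = 0" using test_fun_vanish[OF g(1) X] by simp
  finally show ?thesis by simp
qed

section \<open>Fourier transforms of functionals\<close>

text \<open>
  The Fourier transform of a distribution supported in \<open>[0,1]\<close>, which is a continuous function.
\<close>

definition dual_fourier :: "((real \<Rightarrow> complex) \<Rightarrow> complex) \<Rightarrow> real \<Rightarrow> complex" where
  "dual_fourier u \<eta> = u (\<lambda>t. exp (of_real t * (- \<i> * of_real \<eta>)))"

lemma dual_fourier_continuous:
  assumes "u \<in> dual01" shows "continuous_on UNIV (dual_fourier u)"
proof -
  have "continuous_on UNIV ((\<lambda>b. u (\<lambda>t. exp (of_real t * b))) \<circ> (\<lambda>\<eta>. - \<i> * complex_of_real \<eta>))"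
    by (intro continuous_on_compose continuous_intros continuous_on_subset[OF continuous_dual01_exp[OF assms]]) auto
  then show ?thesis by (simp add: o_def dual_fourier_def[abs_def])
qed

lemma rapid_exp_integral:
  assumes \<psi>: "rapid \<psi>" and T: "convex T"
  shows "exp_integral T \<psi> (\<lambda>\<eta>. - \<i> * of_real \<eta>) (\<lambda>k \<eta>. cmod (\<psi> \<eta> * (- \<i> * of_real \<eta>) ^ k))"
proof
  have "poly_growth (\<lambda>\<eta>. (- \<i> * of_real \<eta>) ^ k)" for k
    by (intro poly_growth_power poly_growth_mult poly_growth_const poly_growth_id)
  then show "integrable lborel (\<lambda>\<eta>. cmod (\<psi> \<eta> * (- \<i> * of_real \<eta>) ^ k))" for k
    by (rule integrable_norm[OF rapid_integrable[OF rapid_mult[OF \<psi>]]])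
  show "cmod (\<psi> \<eta> * (- \<i> * of_real \<eta>) ^ k * exp (of_real t * (- \<i> * of_real \<eta>))) \<le> cmod (\<psi> \<eta> * (- \<i> * of_real \<eta>) ^ k)"
    for k \<eta> and t :: real
    by (simp add: norm_mult)
qed (use T rapid_measurable[OF \<psi>] in auto)

lemma rapid_exp_integral_K:
  assumes "rapid \<psi>"
  shows "exp_integral.K \<psi> (\<lambda>\<eta>. - \<i> * of_real \<eta>) 0 = fourier \<psi>"
  unfolding exp_integral.K_def[OF rapid_exp_integral[OF assms convex_UNIV]] fourier_def by (intro ext) (simp add: mult_ac)

lemma rapid_fourier_smooth:
  assumes \<psi>: "rapid \<psi>" shows "fourier \<psi> \<in> smooth_on UNIV"
  using smooth_on_UNIV_I[OF exp_integral.jet_K[OF rapid_exp_integral[OF \<psi> convex_UNIV]]]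
  unfolding rapid_exp_integral_K[OF \<psi>] .

lemma dual_fourier_exchange:
  assumes u: "u \<in> dual01" and \<psi>: "rapid \<psi>"
  shows "integrable lborel (\<lambda>\<eta>. \<psi> \<eta> * dual_fourier u \<eta>)"
    and "u (fourier \<psi>) = (\<integral>\<eta>. \<psi> \<eta> * dual_fourier u \<eta> \<partial>lborel)"
proof -
  let ?b = "\<lambda>\<eta>. - \<i> * complex_of_real \<eta>"
  have T: "convex {0..1::real}" by simp
  have \<psi>c: "continuous_on UNIV \<psi>" using \<psi> by (simp add: rapid_def)
  have E: "exp_integral01 \<psi> ?b (\<lambda>k \<eta>. cmod (\<psi> \<eta> * ?b \<eta> ^ k)) u"
    by (intro exp_integral01.intro rapid_exp_integral[OF \<psi> T] exp_integral01_axioms.intro u \<psi>c continuous_intros)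
  have V: "exp_integral01.V \<psi> ?b u = (\<lambda>\<eta>. \<psi> \<eta> * dual_fourier u \<eta>)"
    by (intro ext) (simp only: exp_integral01.V_def[OF E] dual_fourier_def)
  show "integrable lborel (\<lambda>\<eta>. \<psi> \<eta> * dual_fourier u \<eta>)"
    using exp_integral01.V_integrable[OF E] unfolding V .
  show "u (fourier \<psi>) = (\<integral>\<eta>. \<psi> \<eta> * dual_fourier u \<eta> \<partial>lborel)"
    using exp_integral01.functional_exchange[OF E] unfolding V rapid_exp_integral_K[OF \<psi>] .
qed

text \<open>
  The Fourier transform of the distribution \<open>w\<close> is given by the function \<open>dual_fourier v\<close>: this is
  the case \<open>b(\<eta>) = - \<i> \<eta>\<close> of the interchange of functionals and integrals.
\<close>

lemma sobolev_criterion: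
  assumes v: "v \<in> dual01" and w: "\<And>f. f \<in> smooth_on UNIV \<Longrightarrow> w f = v f"
    and int: "integrable lborel (\<lambda>\<xi>. (1 + \<xi>\<^sup>2) powr s * (cmod (dual_fourier v \<xi>))\<^sup>2)"
  shows "w \<in> sobolev s"
  unfolding sobolev_def mem_Collect_eq
proof (intro conjI bexI ballI)
  show "w \<in> tempered_distributions" by (rule dual01_tempered[OF v w])
  show "dual_fourier v \<in> borel_measurable lborel"
    using borel_measurable_continuous_onI[OF dual_fourier_continuous[OF v]] by simp
  fix \<phi> assume "\<phi> \<in> schwartz_space"
  then have r: "rapid \<phi>" by (rule schwartz_rapid)
  show "w (fourier \<phi>) = (\<integral>\<xi>. dual_fourier v \<xi> * \<phi> \<xi> \<partial>lborel)"
    unfolding w[OF rapid_fourier_smooth[OF r]] dual_fourier_exchange(2)[OF v r] by (simp only: mult.commute)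
qed (rule int)

section \<open>Symbols of the dispersion relation\<close>

lemma power_mult_exp_le_fact:
  assumes "x \<ge> (0::real)"
  shows "x ^ q * exp (- x) \<le> fact q"
proof -
  have "(\<Sum>n<Suc q. x ^ n /\<^sub>R fact n) \<le> exp x"
    unfolding exp_def by (rule sum_le_suminf[OF summable_exp_generic]) (use assms in auto)
  moreover have "x ^ q /\<^sub>R fact q \<le> (\<Sum>n<Suc q. x ^ n /\<^sub>R fact n)"
    using assms by (intro member_le_sum) auto
  ultimately have "x ^ q / fact q \<le> exp x" by (simp add: divide_inverse mult.commute)
  then have "x ^ q / fact q * exp (- x) \<le> exp x * exp (- x)" by (intro mult_right_mono) auto
  then show ?thesis by (simp add: exp_minus field_simps)
qed

text \<open>
  The dispersion relation \<open>S \<eta> = sqrt (A \<eta>\<^sup>2 + B)\<close>. On a side of length \<open>l\<close> the constants are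
  \<open>A = 1 / l\<^sup>2\<close> and \<open>B = 4 \<beta>\<^sup>2\<close>; positivity of \<open>B\<close> keeps \<open>S\<close> smooth at \<open>\<eta> = 0\<close>.
\<close>

locale dispersion =
  fixes A B :: real
  assumes A: "A > 0" and B: "B > 0"
begin

definition S :: "real \<Rightarrow> real" where "S \<eta> = sqrt (A * \<eta>\<^sup>2 + B)"

lemma S_pos: "S \<eta> > 0"
  unfolding S_def using A B by (simp add: add_nonneg_pos)

lemma S_sq: "(S \<eta>)\<^sup>2 = A * \<eta>\<^sup>2 + B"
  unfolding S_def using A B by (simp add: add_nonneg_pos less_imp_le)

lemma S_deriv: "(S has_real_derivative A * \<eta> / S \<eta>) (at \<eta>)"
proof -
  have pos: "A * \<eta>\<^sup>2 + B > 0" using A B by (simp add: add_nonneg_pos)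
  have "((\<lambda>\<eta>. A * \<eta>\<^sup>2 + B) has_real_derivative A * (2 * \<eta>)) (at \<eta>)"
    by (auto intro!: derivative_eq_intros)
  from DERIV_chain2[OF DERIV_real_sqrt[OF pos] this]
  have "((\<lambda>\<eta>. sqrt (A * \<eta>\<^sup>2 + B)) has_real_derivative (inverse (sqrt (A * \<eta>\<^sup>2 + B)) / 2) * (A * (2 * \<eta>))) (at \<eta>)" .
  moreover have "inverse (sqrt (A * \<eta>\<^sup>2 + B)) / 2 * (A * (2 * \<eta>)) = A * \<eta> / sqrt (A * \<eta>\<^sup>2 + B)"
    by (simp only: divide_inverse) simp
  ultimately show ?thesis unfolding S_def[abs_def] by (simp only:)
qed

lemma S_cont: "continuous_on UNIV S"
  unfolding S_def by (intro continuous_intros)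

lemma eta_le_S: "\<bar>\<eta>\<bar> \<le> S \<eta> / sqrt A"
proof -
  have "sqrt A * \<bar>\<eta>\<bar> = sqrt (A * \<eta>\<^sup>2)" by (simp add: real_sqrt_mult)
  also have "\<dots> \<le> S \<eta>" unfolding S_def using B by (intro real_sqrt_le_mono) simp
  finally show ?thesis using A by (simp add: field_simps)
qed

lemma S_le: "S \<eta> \<le> (sqrt A + sqrt B) * (1 + \<bar>\<eta>\<bar>)"
proof -
  have "S \<eta> \<le> sqrt (A * \<eta>\<^sup>2) + sqrt B" unfolding S_def using A B by (intro sqrt_add_le_add_sqrt) auto
  also have "\<dots> = sqrt A * \<bar>\<eta>\<bar> + sqrt B" by (simp add: real_sqrt_mult)
  also have "\<dots> \<le> (sqrt A + sqrt B) * (1 + \<bar>\<eta>\<bar>)" using A B by (simp add: algebra_simps)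
  finally show ?thesis .
qed

lemma bracket_le_S: "1 + \<bar>\<eta>\<bar> \<le> (1 / sqrt A + 1 / sqrt B) * S \<eta>"
proof -
  have "sqrt B \<le> S \<eta>" unfolding S_def using A by (intro real_sqrt_le_mono) simp
  then have "1 \<le> S \<eta> / sqrt B" using B by simp
  then show ?thesis using eta_le_S[of \<eta>] by (simp add: distrib_right)
qed

lemma S_powr_le: "\<exists>C\<ge>0. \<forall>\<eta>. S \<eta> powr d \<le> C * (1 + \<bar>\<eta>\<bar>) powr d"
proof (cases "d \<ge> 0")
  case True
  have "S \<eta> powr d \<le> (sqrt A + sqrt B) powr d * (1 + \<bar>\<eta>\<bar>) powr d" for \<eta>
    using powr_mono2[OF True _ S_le[of \<eta>]] S_pos[of \<eta>] A B by (simp add: powr_mult)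
  then show ?thesis by (intro exI[of _ "(sqrt A + sqrt B) powr d"]) auto
next
  case False
  let ?c = "1 / sqrt A + 1 / sqrt B"
  have c: "?c > 0" using A B by (simp add: add_pos_pos)
  have "S \<eta> powr d \<le> ?c powr (- d) * (1 + \<bar>\<eta>\<bar>) powr d" for \<eta>
  proof -
    have "(?c * S \<eta>) powr d \<le> (1 + \<bar>\<eta>\<bar>) powr d"
      using powr_mono2'[of d "1 + \<bar>\<eta>\<bar>" "?c * S \<eta>"] False bracket_le_S[of \<eta>] by simp
    then have "?c powr (- d) * (?c powr d * S \<eta> powr d) \<le> ?c powr (- d) * (1 + \<bar>\<eta>\<bar>) powr d"
      using c S_pos[of \<eta>] by (intro mult_left_mono) (simp_all add: powr_mult)
    moreover have "?c powr (- d) * (?c powr d * S \<eta> powr d) = S \<eta> powr d"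
      using c by (simp only: mult.assoc[symmetric] powr_add[symmetric]) simp
    ultimately show ?thesis by simp
  qed
  then show ?thesis by (intro exI[of _ "?c powr (- d)"]) auto
qed

text \<open>
  Symbols of degree \<open>d\<close> in \<open>\<eta>\<close>, uniformly in the height \<open>y \<ge> 0\<close>. The factor \<open>exp (- y S)\<close> allows
  each power of \<open>y\<close> to be traded for a power of \<open>1 / S\<close>, so \<open>y\<close> counts as having degree \<open>-1\<close>. The
  class is generated by explicit monomials in order to be closed under differentiation.
\<close>

inductive exp_symbol :: "real \<Rightarrow> (real \<Rightarrow> real \<Rightarrow> real) \<Rightarrow> bool" where
  monom: "exp_symbol (real p + c - real q) (\<lambda>y \<eta>. y ^ q * \<eta> ^ p * S \<eta> powr c * exp (- y * S \<eta>))"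
| add: "exp_symbol d f \<Longrightarrow> exp_symbol d g \<Longrightarrow> exp_symbol d (\<lambda>y \<eta>. f y \<eta> + g y \<eta>)"
| cmult: "exp_symbol d f \<Longrightarrow> exp_symbol d (\<lambda>y \<eta>. r * f y \<eta>)"

lemma exp_symbol_monom: "d = real p + c - real q \<Longrightarrow> exp_symbol d (\<lambda>y \<eta>. y ^ q * \<eta> ^ p * S \<eta> powr c * exp (- y * S \<eta>))"
  using exp_symbol.monom by simp

lemma exp_symbol_zero: "exp_symbol d (\<lambda>y \<eta>. 0)"
  using exp_symbol.cmult[OF exp_symbol_monom[of d 0 d 0], of 0] by simp

text \<open>
  Each of the factors \<open>\<eta> ^ p\<close>, \<open>S powr c\<close> and \<open>exp (- y S)\<close> contributes one monomial, and as
  \<open>S' = A \<eta> / S\<close> has degree \<open>0\<close>, all three have degree one less than the original one.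
\<close>

lemma exp_symbol_deriv:
  "exp_symbol d f \<Longrightarrow> \<exists>g. exp_symbol (d - 1) g \<and> (\<forall>y \<eta>. (f y has_real_derivative g y \<eta>) (at \<eta>))"
proof (induction rule: exp_symbol.induct)
  case (monom p c q)
  let ?m = "\<lambda>q p c y \<eta>. y ^ q * \<eta> ^ p * S \<eta> powr c * exp (- y * S \<eta>)"
  let ?g = "\<lambda>y \<eta>. (real p * ?m q (p - 1) c y \<eta> + (c * A) * ?m q (p + 1) (c - 2) y \<eta>) + (- A) * ?m (q + 1) (p + 1) (c - 1) y \<eta>"
  show ?case
  proof (intro exI[of _ ?g] conjI allI)
    have "exp_symbol (real p + c - real q - 1) (\<lambda>y \<eta>. real p * ?m q (p - 1) c y \<eta>)"
    proof (cases "p = 0")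
      case True
      then show ?thesis using exp_symbol_zero by simp
    next
      case False
      then show ?thesis by (intro exp_symbol.cmult exp_symbol_monom) simp
    qed
    then show "exp_symbol (real p + c - real q - 1) ?g"
      by (rule exp_symbol.add[OF exp_symbol.add]; intro exp_symbol.cmult exp_symbol_monom; simp)
    fix y \<eta>
    have P: "((\<lambda>\<eta>. S \<eta> powr c) has_real_derivative c * S \<eta> powr (c - 1) * (A * \<eta> / S \<eta>)) (at \<eta>)"
      by (rule DERIV_chain2[OF has_real_derivative_powr[OF S_pos] S_deriv])
    have p: "S \<eta> powr (c - 1) * (A * \<eta> / S \<eta>) = A * \<eta> * S \<eta> powr (c - 2)" "S \<eta> powr c / S \<eta> = S \<eta> powr (c - 1)"
      using S_pos[of \<eta>] by (simp_all add: powr_diff power2_eq_square)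
    have "(?m q p c y has_real_derivative
       y ^ q * (real p * \<eta> ^ (p - 1)) * S \<eta> powr c * exp (- y * S \<eta>)
       + y ^ q * \<eta> ^ p * (c * S \<eta> powr (c - 1) * (A * \<eta> / S \<eta>)) * exp (- y * S \<eta>)
       + y ^ q * \<eta> ^ p * S \<eta> powr c * (exp (- y * S \<eta>) * (- y * (A * \<eta> / S \<eta>)))) (at \<eta>)"
      by (auto intro!: derivative_eq_intros P S_deriv simp: S_pos algebra_simps)
    moreover have "y ^ q * (real p * \<eta> ^ (p - 1)) * S \<eta> powr c * exp (- y * S \<eta>)
       + y ^ q * \<eta> ^ p * (c * S \<eta> powr (c - 1) * (A * \<eta> / S \<eta>)) * exp (- y * S \<eta>)
       + y ^ q * \<eta> ^ p * S \<eta> powr c * (exp (- y * S \<eta>) * (- y * (A * \<eta> / S \<eta>))) = ?g y \<eta>"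
    proof -
      have "y ^ q * \<eta> ^ p * (c * S \<eta> powr (c - 1) * (A * \<eta> / S \<eta>)) * exp (- y * S \<eta>)
        = y ^ q * \<eta> ^ p * (c * (S \<eta> powr (c - 1) * (A * \<eta> / S \<eta>))) * exp (- y * S \<eta>)" by simp
      moreover have "y ^ q * \<eta> ^ p * S \<eta> powr c * (exp (- y * S \<eta>) * (- y * (A * \<eta> / S \<eta>)))
        = y ^ q * \<eta> ^ p * (exp (- y * S \<eta>) * (- y * (A * \<eta> * (S \<eta> powr c / S \<eta>))))" by simp
      ultimately show ?thesis unfolding p by (simp add: mult_ac)
    qed
    ultimately show "(?m q p c y has_real_derivative ?g y \<eta>) (at \<eta>)" by (simp only:)
  qed
next
  case (add d f g)
  then obtain f' g' where "exp_symbol (d - 1) f'" "\<And>y \<eta>. (f y has_real_derivative f' y \<eta>) (at \<eta>)"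
    "exp_symbol (d - 1) g'" "\<And>y \<eta>. (g y has_real_derivative g' y \<eta>) (at \<eta>)" by blast
  then show ?case
    by (intro exI[of _ "\<lambda>y \<eta>. f' y \<eta> + g' y \<eta>"]) (auto intro!: exp_symbol.add derivative_eq_intros)
next
  case (cmult d f r)
  then obtain f' where "exp_symbol (d - 1) f'" "\<And>y \<eta>. (f y has_real_derivative f' y \<eta>) (at \<eta>)" by blast
  then show ?case
    by (intro exI[of _ "\<lambda>y \<eta>. r * f' y \<eta>"]) (auto intro!: exp_symbol.cmult derivative_eq_intros)
qed

lemma exp_symbol_derivs:
  assumes "exp_symbol d f"
  shows "\<exists>D. D 0 = f \<and> (\<forall>k. exp_symbol (d - real k) (D k)) \<and>
    (\<forall>k y \<eta>. (D k y has_real_derivative D (Suc k) y \<eta>) (at \<eta>))"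
proof -
  have "\<exists>D. \<forall>n. (exp_symbol (d - real n) (D n) \<and> (n = 0 \<longrightarrow> D n = f)) \<and>
     (\<forall>y \<eta>. (D n y has_real_derivative D (Suc n) y \<eta>) (at \<eta>))"
  proof (rule dependent_nat_choice)
    show "\<exists>x. exp_symbol (d - real 0) x \<and> (0 = (0::nat) \<longrightarrow> x = f)" using assms by auto
    show "\<exists>g'. (exp_symbol (d - real (Suc n)) g' \<and> (Suc n = 0 \<longrightarrow> g' = f)) \<and> (\<forall>y \<eta>. (g y has_real_derivative g' y \<eta>) (at \<eta>))"
      if "exp_symbol (d - real n) g \<and> (n = 0 \<longrightarrow> g = f)" for g n
    proof -
      have "d - real n - 1 = d - real (Suc n)" by simp
      then show ?thesis using exp_symbol_deriv[of "d - real n" g] that by (metis nat.distinct(1))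
    qed
  qed
  then show ?thesis by blast
qed

text \<open>
  For a monomial, \<open>(y S) ^ q exp (- y S) \<le> q!\<close> and \<open>\<bar>\<eta>\<bar> \<le> S / sqrt A\<close>,
  and \<open>S\<close> is comparable to \<open>1 + \<bar>\<eta>\<bar>\<close>.
\<close>

lemma exp_symbol_bound:
  "exp_symbol d f \<Longrightarrow> \<exists>C\<ge>0. \<forall>y\<ge>0. \<forall>\<eta>. \<bar>f y \<eta>\<bar> \<le> C * (1 + \<bar>\<eta>\<bar>) powr d"
proof (induction rule: exp_symbol.induct)
  case (monom p c q)
  let ?d = "real p + c - real q"
  obtain C where C: "C \<ge> 0" "\<And>\<eta>. S \<eta> powr ?d \<le> C * (1 + \<bar>\<eta>\<bar>) powr ?d" using S_powr_le by blast
  have "\<bar>y ^ q * \<eta> ^ p * S \<eta> powr c * exp (- y * S \<eta>)\<bar> \<le> fact q * ((1 / sqrt A) ^ p * C) * (1 + \<bar>\<eta>\<bar>) powr ?d"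
    if y: "y \<ge> 0" for y \<eta>
  proof -
    have Sp: "S \<eta> > 0" by (rule S_pos)
    have "\<bar>y ^ q * \<eta> ^ p * S \<eta> powr c * exp (- y * S \<eta>)\<bar> = ((y * S \<eta>) ^ q * exp (- (y * S \<eta>))) * (\<bar>\<eta>\<bar> ^ p * S \<eta> powr (c - real q))"
      using y Sp by (simp add: abs_mult power_abs power_mult_distrib powr_diff powr_realpow)
    also have "\<dots> \<le> fact q * (\<bar>\<eta>\<bar> ^ p * S \<eta> powr (c - real q))"
      using y Sp by (intro mult_right_mono power_mult_exp_le_fact) auto
    also have "\<dots> \<le> fact q * ((S \<eta> / sqrt A) ^ p * S \<eta> powr (c - real q))"
      by (intro mult_left_mono mult_right_mono power_mono eta_le_S) auto
    also have "(S \<eta> / sqrt A) ^ p * S \<eta> powr (c - real q) = (1 / sqrt A) ^ p * S \<eta> powr ?d"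
    proof -
      have "S \<eta> powr ?d = S \<eta> powr (real p + (c - real q))" by (simp add: algebra_simps)
      also have "\<dots> = S \<eta> ^ p * S \<eta> powr (c - real q)" using Sp by (simp only: powr_add powr_realpow)
      finally show ?thesis by (simp add: power_divide)
    qed
    also have "fact q * ((1 / sqrt A) ^ p * S \<eta> powr ?d) \<le> fact q * ((1 / sqrt A) ^ p * (C * (1 + \<bar>\<eta>\<bar>) powr ?d))"
      using A by (intro mult_left_mono C) auto
    finally show ?thesis by (simp add: mult_ac)
  qed
  moreover have "fact q * ((1 / sqrt A) ^ p * C) \<ge> 0" using C A by simp
  ultimately show ?case by blast
next
  case (add d f g)
  then obtain C D where C: "C \<ge> 0" "\<And>y \<eta>. y \<ge> 0 \<Longrightarrow> \<bar>f y \<eta>\<bar> \<le> C * (1 + \<bar>\<eta>\<bar>) powr d"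
    and D: "D \<ge> 0" "\<And>y \<eta>. y \<ge> 0 \<Longrightarrow> \<bar>g y \<eta>\<bar> \<le> D * (1 + \<bar>\<eta>\<bar>) powr d" by blast
  have "\<bar>f y \<eta> + g y \<eta>\<bar> \<le> (C + D) * (1 + \<bar>\<eta>\<bar>) powr d" if "y \<ge> 0" for y \<eta>
    using C(2)[OF that, of \<eta>] D(2)[OF that, of \<eta>] by (simp add: distrib_right)
  then show ?case using C(1) D(1) by (intro exI[of _ "C + D"]) auto
next
  case (cmult d f r)
  then obtain C where C: "C \<ge> 0" "\<And>y \<eta>. y \<ge> 0 \<Longrightarrow> \<bar>f y \<eta>\<bar> \<le> C * (1 + \<bar>\<eta>\<bar>) powr d" by blast
  have "\<bar>r * f y \<eta>\<bar> \<le> (\<bar>r\<bar> * C) * (1 + \<bar>\<eta>\<bar>) powr d" if "y \<ge> 0" for y \<eta>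
    using mult_left_mono[OF C(2)[OF that, of \<eta>], of "\<bar>r\<bar>"] by (simp add: abs_mult mult_ac)
  then show ?case using C(1) by (intro exI[of _ "\<bar>r\<bar> * C"]) auto
qed

lemma exp_symbol_mult_y: "exp_symbol d f \<Longrightarrow> exp_symbol (d - real m) (\<lambda>y \<eta>. y ^ m * f y \<eta>)"
proof (induction rule: exp_symbol.induct)
  case (monom p c q)
  show ?case
    using exp_symbol_monom[of "real p + c - real q - real m" p c "q + m"] by (simp add: power_add mult_ac)
next
  case (add d f g)
  then show ?case using exp_symbol.add by (simp add: distrib_left)
next
  case (cmult d f r)
  then show ?case using exp_symbol.cmult[OF cmult.IH, of r] by (simp add: mult_ac)
qed

lemma exp_symbol_cont: "exp_symbol d f \<Longrightarrow> continuous_on UNIV (f y)"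
  using exp_symbol_deriv by (meson DERIV_continuous_on has_field_derivative_at_within)

text \<open>
  Multiplication by \<open>y ^ m\<close> lowers the degree by \<open>m\<close>, and for \<open>y \<ge> \<delta>\<close> it can be undone at the cost of
  the constant \<open>1 / \<delta> ^ m\<close>.
\<close>

lemma exp_symbol_decay:
  assumes f: "exp_symbol d f" and \<delta>: "\<delta> > 0"
  shows "\<exists>C\<ge>0. \<forall>y\<ge>\<delta>. \<forall>\<eta>. (1 + \<bar>\<eta>\<bar>) ^ M * \<bar>f y \<eta>\<bar> \<le> C"
proof -
  define m where "m = nat \<lceil>d + real M\<rceil>"
  have m: "d - real m \<le> - real M" unfolding m_def by linarith
  obtain C where C: "C \<ge> 0" "\<And>y \<eta>. y \<ge> 0 \<Longrightarrow> \<bar>y ^ m * f y \<eta>\<bar> \<le> C * (1 + \<bar>\<eta>\<bar>) powr (d - real m)"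
    using exp_symbol_bound[OF exp_symbol_mult_y[OF f, of m]] by blast
  have "(1 + \<bar>\<eta>\<bar>) ^ M * \<bar>f y \<eta>\<bar> \<le> C / \<delta> ^ m" if y: "y \<ge> \<delta>" for y \<eta>
  proof -
    have "\<delta> ^ m * \<bar>f y \<eta>\<bar> \<le> \<bar>y ^ m * f y \<eta>\<bar>"
      using y \<delta> by (auto simp: abs_mult intro!: mult_right_mono power_mono)
    also have "\<dots> \<le> C * (1 + \<bar>\<eta>\<bar>) powr (d - real m)" using y \<delta> by (intro C) auto
    also have "\<dots> \<le> C * (1 + \<bar>\<eta>\<bar>) powr (- real M)" using C(1) m by (intro mult_left_mono powr_mono) auto
    finally have "(1 + \<bar>\<eta>\<bar>) ^ M * (\<delta> ^ m * \<bar>f y \<eta>\<bar>) \<le> (1 + \<bar>\<eta>\<bar>) ^ M * (C * (1 + \<bar>\<eta>\<bar>) powr (- real M))"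
      by (intro mult_left_mono) auto
    also have "\<dots> = C" by (simp add: powr_minus powr_realpow add_pos_nonneg)
    finally show ?thesis using \<delta> by (simp add: field_simps)
  qed
  then show ?thesis using C(1) \<delta> by (intro exI[of _ "C / \<delta> ^ m"]) auto
qed

text \<open>
  Taylor's formula at \<open>\<xi>\<close>. The remainder involves the \<open>N\<close>-th derivative, of degree \<open>d - N \<le> - M\<close>, at
  a point between \<open>\<xi>\<close> and \<open>\<xi> - \<zeta>\<close>; Peetre's inequality replaces this point by \<open>\<xi>\<close>.
\<close>

lemma exp_symbol_taylor:
  assumes f: "exp_symbol d f"
  shows "\<exists>N C. \<exists>c :: nat \<Rightarrow> real \<Rightarrow> real \<Rightarrow> real. C \<ge> 0 \<and> (\<forall>y\<ge>0. \<forall>\<xi> \<zeta>.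
    (1 + \<bar>\<xi>\<bar>) ^ M * \<bar>f y (\<xi> - \<zeta>) - (\<Sum>k<N. c k y \<xi> * \<zeta> ^ k)\<bar> \<le> C * (1 + \<bar>\<zeta>\<bar>) ^ (M + N))"
proof -
  define N where "N = Suc (nat \<lceil>d + real M\<rceil>)"
  have N: "d - real N \<le> - real M" "N > 0" unfolding N_def by linarith+
  obtain D where D0: "D 0 = f" and Ds: "\<And>k. exp_symbol (d - real k) (D k)"
    and Dd: "\<And>k y \<eta>. (D k y has_real_derivative D (Suc k) y \<eta>) (at \<eta>)"
    using exp_symbol_derivs[OF f] by blast
  obtain C where C: "C \<ge> 0" "\<And>y \<eta>. y \<ge> 0 \<Longrightarrow> \<bar>D N y \<eta>\<bar> \<le> C * (1 + \<bar>\<eta>\<bar>) powr (d - real N)"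
    using exp_symbol_bound[OF Ds] by blast
  define c where "c = (\<lambda>k y \<xi>. D k y \<xi> / fact k * (- 1) ^ k)"
  have "(1 + \<bar>\<xi>\<bar>) ^ M * \<bar>f y (\<xi> - \<zeta>) - (\<Sum>k<N. c k y \<xi> * \<zeta> ^ k)\<bar> \<le> C * (1 + \<bar>\<zeta>\<bar>) ^ (M + N)"
    if y: "y \<ge> 0" for y \<xi> \<zeta>
  proof (cases "\<zeta> = 0")
    case True
    have "(\<Sum>k<N. c k y \<xi> * 0 ^ k) = c 0 y \<xi>"
      using N(2) by (simp add: power_0_left if_distrib cong: if_cong)
    then show ?thesis using True C(1) by (simp add: c_def D0)
  next
    case False
    obtain t where t: "if \<xi> - \<zeta> < \<xi> then \<xi> - \<zeta> < t \<and> t < \<xi> else \<xi> < t \<and> t < \<xi> - \<zeta>"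
      "D 0 y (\<xi> - \<zeta>) = (\<Sum>k<N. D k y \<xi> / fact k * (\<xi> - \<zeta> - \<xi>) ^ k) + D N y t / fact N * (\<xi> - \<zeta> - \<xi>) ^ N"
      using Taylor[of N "\<lambda>k. D k y" "D 0 y" "min \<xi> (\<xi> - \<zeta>)" "max \<xi> (\<xi> - \<zeta>)" \<xi> "\<xi> - \<zeta>"] N(2) Dd False
      by auto
    have tz: "\<bar>\<xi> - t\<bar> \<le> \<bar>\<zeta>\<bar>" using t(1) by (auto split: if_splits)
    have "f y (\<xi> - \<zeta>) - (\<Sum>k<N. c k y \<xi> * \<zeta> ^ k) = D N y t / fact N * (- \<zeta>) ^ N"
    proof -
      have "(- \<zeta>) ^ k = (- 1) ^ k * \<zeta> ^ k" for k by (rule power_minus)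
      then show ?thesis using t(2) by (simp add: D0 c_def mult.assoc)
    qed
    then have "\<bar>f y (\<xi> - \<zeta>) - (\<Sum>k<N. c k y \<xi> * \<zeta> ^ k)\<bar> = \<bar>D N y t\<bar> / fact N * \<bar>\<zeta>\<bar> ^ N"
      by (simp add: abs_mult power_abs)
    also have "\<dots> \<le> \<bar>D N y t\<bar> * (1 + \<bar>\<zeta>\<bar>) ^ N"
    proof (rule mult_mono)
      have "(1::real) \<le> fact N" by simp
      then show "\<bar>D N y t\<bar> / fact N \<le> \<bar>D N y t\<bar>" by (simp add: divide_le_eq mult_le_cancel_left1)
    qed (auto intro: power_mono)
    also have "\<bar>D N y t\<bar> \<le> C * (1 + \<bar>t\<bar>) powr (- real M)"
      using C(2)[OF y, of t] powr_mono[OF N(1), of "1 + \<bar>t\<bar>"] C(1) by (auto intro: order_trans mult_left_mono)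
    finally have 1: "\<bar>f y (\<xi> - \<zeta>) - (\<Sum>k<N. c k y \<xi> * \<zeta> ^ k)\<bar> \<le> C * (1 + \<bar>t\<bar>) powr (- real M) * (1 + \<bar>\<zeta>\<bar>) ^ N"
      by (simp add: mult_right_mono)
    have 2: "(1 + \<bar>\<xi>\<bar>) ^ M \<le> (1 + \<bar>\<zeta>\<bar>) ^ M * (1 + \<bar>t\<bar>) ^ M"
      by (rule order_trans[OF peetre_power[of \<xi> M t]]) (use tz in \<open>auto intro!: mult_right_mono power_mono\<close>)
    have "(1 + \<bar>\<xi>\<bar>) ^ M * \<bar>f y (\<xi> - \<zeta>) - (\<Sum>k<N. c k y \<xi> * \<zeta> ^ k)\<bar>
       \<le> ((1 + \<bar>\<zeta>\<bar>) ^ M * (1 + \<bar>t\<bar>) ^ M) * (C * (1 + \<bar>t\<bar>) powr (- real M) * (1 + \<bar>\<zeta>\<bar>) ^ N)"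
      using 1 2 by (intro mult_mono) auto
    also have "\<dots> = C * (1 + \<bar>\<zeta>\<bar>) ^ (M + N)"
      by (simp add: powr_minus powr_realpow add_pos_nonneg power_add)
    finally show ?thesis .
  qed
  then show ?thesis using C(1) by blast
qed

end

section \<open>Localised waves\<close>

lemma reflect_integral:
  fixes F :: "real \<Rightarrow> complex"
  shows "(\<integral>\<eta>. F \<eta> \<partial>lborel) = (\<integral>\<zeta>. F (\<xi> - \<zeta>) \<partial>lborel)"
  using lborel_integral_real_affine[of "-1" F \<xi>] by simp

text \<open>
  A test function \<open>f\<close> on the open side, in the coordinate \<open>X\<close> with values in \<open>(0,1)\<close>, serves to
  localise the distributions on this side.
\<close>

locale dispersion_test = dispersion A B for A B +
  fixes a b :: real and f :: "real \<Rightarrow> complex"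
  assumes f: "test_fun a b f" and ab: "0 < a" "b < 1"
begin

abbreviation "h \<equiv> fourier f"

lemma h_rapid: "rapid h" by (rule fourier_rapid[OF f ab])

text \<open>
  In the Taylor expansion of the symbol at \<open>\<xi>\<close> the polynomial part integrates to \<open>0\<close> by
  \<open>fourier_moment_vanishes\<close>, since \<open>X\<close> is outside the support of \<open>f\<close>. The remainder carries the factor
  \<open>(1 + \<bar>\<xi>\<bar>) ^ -M\<close>. The bound is uniform in \<open>X\<close> because \<open>X\<close> enters only through a factor of modulus
  \<open>1\<close>.
\<close>

lemma decay_off_support:
  assumes g: "exp_symbol d g"
  shows "\<exists>C\<ge>0. \<forall>\<xi> X y. y \<ge> 0 \<longrightarrow> X \<notin> {a..b} \<longrightarrow>
    (1 + \<bar>\<xi>\<bar>) ^ M * cmod (\<integral>\<zeta>. h \<zeta> * (of_real (g y (\<xi> - \<zeta>)) * iexp (X * \<zeta>)) \<partial>lborel) \<le> C"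
proof -
  obtain N C and c :: "nat \<Rightarrow> real \<Rightarrow> real \<Rightarrow> real" where C: "C \<ge> 0"
    and R: "\<And>y \<xi> \<zeta>. y \<ge> 0 \<Longrightarrow> (1 + \<bar>\<xi>\<bar>) ^ M * \<bar>g y (\<xi> - \<zeta>) - (\<Sum>k<N. c k y \<xi> * \<zeta> ^ k)\<bar> \<le> C * (1 + \<bar>\<zeta>\<bar>) ^ (M + N)"
    using exp_symbol_taylor[OF g, of M] by blast
  define D where "D = (\<integral>\<zeta>. C * ((1 + \<bar>\<zeta>\<bar>) ^ (M + N) * cmod (h \<zeta>)) \<partial>lborel)"
  have "(1 + \<bar>\<xi>\<bar>) ^ M * cmod (\<integral>\<zeta>. h \<zeta> * (of_real (g y (\<xi> - \<zeta>)) * iexp (X * \<zeta>)) \<partial>lborel) \<le> D"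
    if y: "y \<ge> 0" and X: "X \<notin> {a..b}" for \<xi> X y
  proof -
    let ?r = "\<lambda>\<zeta>. g y (\<xi> - \<zeta>) - (\<Sum>k<N. c k y \<xi> * \<zeta> ^ k)"
    have gc: "continuous_on UNIV (g y)" by (rule exp_symbol_cont[OF g])
    have rb: "\<bar>?r \<zeta>\<bar> \<le> C * (1 + \<bar>\<zeta>\<bar>) ^ (M + N)" for \<zeta>
    proof -
      have "\<bar>?r \<zeta>\<bar> \<le> (1 + \<bar>\<xi>\<bar>) ^ M * \<bar>?r \<zeta>\<bar>" by (simp add: mult_le_cancel_right1)
      then show ?thesis using R[OF y, of \<xi> \<zeta>] by linarith
    qed
    have pr: "poly_growth (\<lambda>\<zeta>. of_real (?r \<zeta>) * iexp (X * \<zeta>))"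
      unfolding poly_growth_def
    proof (intro conjI exI allI)
      show "continuous_on UNIV (\<lambda>\<zeta>. of_real (?r \<zeta>) * iexp (X * \<zeta>))"
        by (intro continuous_intros continuous_on_compose2[OF gc]) auto
      show "cmod (of_real (?r \<zeta>) * iexp (X * \<zeta>)) \<le> C * (1 + \<bar>\<zeta>\<bar>) ^ (M + N)" for \<zeta>
        using rb[of \<zeta>] by (simp only: norm_mult norm_of_real norm_exp_i_times mult_1_right)
    qed
    have pk: "poly_growth (\<lambda>\<zeta>. of_real \<zeta> ^ k * iexp (X * \<zeta>))" for k
      by (intro poly_growth_mult poly_growth_power poly_growth_id)
         (auto intro!: poly_growth_bounded[of _ 1] continuous_intros)
    have ir: "integrable lborel (\<lambda>\<zeta>. h \<zeta> * (of_real (?r \<zeta>) * iexp (X * \<zeta>)))"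
      by (rule rapid_integrable[OF rapid_mult[OF h_rapid pr]])
    have ik: "integrable lborel (\<lambda>\<zeta>. h \<zeta> * (of_real \<zeta> ^ k * iexp (X * \<zeta>)))" for k
      by (rule rapid_integrable[OF rapid_mult[OF h_rapid pk]])
    have "h \<zeta> * (of_real (g y (\<xi> - \<zeta>)) * iexp (X * \<zeta>)) = h \<zeta> * (of_real (?r \<zeta>) * iexp (X * \<zeta>))
        + (\<Sum>k<N. of_real (c k y \<xi>) * (h \<zeta> * (of_real \<zeta> ^ k * iexp (X * \<zeta>))))" for \<zeta>
    proof -
      have "of_real (g y (\<xi> - \<zeta>)) = of_real (?r \<zeta>) + (\<Sum>k<N. of_real (c k y \<xi>) * complex_of_real \<zeta> ^ k)" by simp
      then have "h \<zeta> * (of_real (g y (\<xi> - \<zeta>)) * iexp (X * \<zeta>)) =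
        h \<zeta> * (of_real (?r \<zeta>) * iexp (X * \<zeta>)) + h \<zeta> * iexp (X * \<zeta>) * (\<Sum>k<N. of_real (c k y \<xi>) * complex_of_real \<zeta> ^ k)"
        by (simp only: distrib_left distrib_right) (simp only: mult_ac)
      then show ?thesis by (simp only: sum_distrib_left mult_ac)
    qed
    then have "(\<integral>\<zeta>. h \<zeta> * (of_real (g y (\<xi> - \<zeta>)) * iexp (X * \<zeta>)) \<partial>lborel)
       = (\<integral>\<zeta>. h \<zeta> * (of_real (?r \<zeta>) * iexp (X * \<zeta>)) + (\<Sum>k<N. of_real (c k y \<xi>) * (h \<zeta> * (of_real \<zeta> ^ k * iexp (X * \<zeta>)))) \<partial>lborel)"
      by (simp only:)
    also have "\<dots> = (\<integral>\<zeta>. h \<zeta> * (of_real (?r \<zeta>) * iexp (X * \<zeta>)) \<partial>lborel)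
        + (\<integral>\<zeta>. (\<Sum>k<N. of_real (c k y \<xi>) * (h \<zeta> * (of_real \<zeta> ^ k * iexp (X * \<zeta>)))) \<partial>lborel)"
      by (rule Bochner_Integration.integral_add[OF ir]) (intro Bochner_Integration.integrable_sum integrable_mult_right ik)
    also have "(\<integral>\<zeta>. (\<Sum>k<N. of_real (c k y \<xi>) * (h \<zeta> * (of_real \<zeta> ^ k * iexp (X * \<zeta>)))) \<partial>lborel)
        = (\<Sum>k<N. of_real (c k y \<xi>) * (\<integral>\<zeta>. h \<zeta> * (of_real \<zeta> ^ k * iexp (X * \<zeta>)) \<partial>lborel))"
      by (rule trans[OF Bochner_Integration.integral_sum[OF integrable_mult_right[OF ik]]]) (simp only: integral_mult_right_zero)
    also have "\<dots> = 0"
      using fourier_moment_vanishes[OF f ab X] by (intro sum.neutral ballI) (simp add: mult.assoc)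
    finally have eq: "(\<integral>\<zeta>. h \<zeta> * (of_real (g y (\<xi> - \<zeta>)) * iexp (X * \<zeta>)) \<partial>lborel) = (\<integral>\<zeta>. h \<zeta> * (of_real (?r \<zeta>) * iexp (X * \<zeta>)) \<partial>lborel)"
      by simp
    show ?thesis
      unfolding eq D_def
    proof (rule rapid_integral_bound[OF h_rapid])
      show "continuous_on UNIV (\<lambda>\<zeta>. of_real (?r \<zeta>) * iexp (X * \<zeta>))" using pr by (simp only: poly_growth_def)
      show "(1 + \<bar>\<xi>\<bar>) ^ M * cmod (of_real (?r \<zeta>) * iexp (X * \<zeta>)) \<le> C * (1 + \<bar>\<zeta>\<bar>) ^ (M + N)" for \<zeta>
        using R[OF y, of \<xi> \<zeta>] by (simp only: norm_mult norm_of_real norm_exp_i_times mult_1_right)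
    qed simp
  qed
  moreover have "D \<ge> 0" unfolding D_def using C by (intro integral_nonneg_AE) auto
  ultimately show ?thesis by blast
qed

lemma decay_off_axis:
  assumes g: "exp_symbol d g" and \<delta>: "\<delta> > 0"
  shows "\<exists>C\<ge>0. \<forall>\<xi> X y. y \<ge> \<delta> \<longrightarrow>
    (1 + \<bar>\<xi>\<bar>) ^ M * cmod (\<integral>\<zeta>. h \<zeta> * (of_real (g y (\<xi> - \<zeta>)) * iexp (X * \<zeta>)) \<partial>lborel) \<le> C"
proof -
  obtain C where C: "C \<ge> 0" "\<And>y \<eta>. y \<ge> \<delta> \<Longrightarrow> (1 + \<bar>\<eta>\<bar>) ^ M * \<bar>g y \<eta>\<bar> \<le> C"
    using exp_symbol_decay[OF g \<delta>, of M] by blast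
  define D where "D = (\<integral>\<zeta>. C * ((1 + \<bar>\<zeta>\<bar>) ^ M * cmod (h \<zeta>)) \<partial>lborel)"
  have "(1 + \<bar>\<xi>\<bar>) ^ M * cmod (\<integral>\<zeta>. h \<zeta> * (of_real (g y (\<xi> - \<zeta>)) * iexp (X * \<zeta>)) \<partial>lborel) \<le> D"
    if y: "y \<ge> \<delta>" for \<xi> X y
  proof -
    have gc: "continuous_on UNIV (g y)" by (rule exp_symbol_cont[OF g])
    show ?thesis
      unfolding D_def
    proof (rule rapid_integral_bound[OF h_rapid])
      show "continuous_on UNIV (\<lambda>\<zeta>. of_real (g y (\<xi> - \<zeta>)) * iexp (X * \<zeta>))"
        by (intro continuous_intros continuous_on_compose2[OF gc]) auto
      show "(1 + \<bar>\<xi>\<bar>) ^ M * cmod (of_real (g y (\<xi> - \<zeta>)) * iexp (X * \<zeta>)) \<le> C * (1 + \<bar>\<zeta>\<bar>) ^ M" for \<zeta>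
      proof -
        have "(1 + \<bar>\<xi>\<bar>) ^ M * \<bar>g y (\<xi> - \<zeta>)\<bar> \<le> (1 + \<bar>\<zeta>\<bar>) ^ M * (1 + \<bar>\<xi> - \<zeta>\<bar>) ^ M * \<bar>g y (\<xi> - \<zeta>)\<bar>"
          using peetre_power[of \<xi> M "\<xi> - \<zeta>"] by (intro mult_right_mono) auto
        also have "\<dots> = (1 + \<bar>\<zeta>\<bar>) ^ M * ((1 + \<bar>\<xi> - \<zeta>\<bar>) ^ M * \<bar>g y (\<xi> - \<zeta>)\<bar>)" by (simp only: mult_ac)
        also have "\<dots> \<le> (1 + \<bar>\<zeta>\<bar>) ^ M * C" by (intro mult_left_mono C y) auto
        finally show ?thesis by (simp add: norm_mult mult.commute)
      qed
    qed simp
  qed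
  moreover have "D \<ge> 0" unfolding D_def using C by (intro integral_nonneg_AE) auto
  ultimately show ?thesis by blast
qed

text \<open>
  The exponential kernel of the global relation at the point with coordinates \<open>(X, y)\<close>, for the
  spectral parameter attached to the frequency \<open>\<eta>\<close>. For \<open>y = 0\<close> it is the Fourier kernel.
\<close>

definition wave :: "real \<Rightarrow> real \<Rightarrow> real \<Rightarrow> complex" where
  "wave X y \<eta> = exp (- (\<i> * of_real (X * \<eta>) + of_real (y * S \<eta>)))"

lemma cmod_wave: "y \<ge> 0 \<Longrightarrow> cmod (wave X y \<eta>) \<le> 1"
  using S_pos[of \<eta>] by (simp add: wave_def)

lemma wave_cont: "continuous_on UNIV (wave X y)"
  unfolding wave_def by (intro continuous_intros S_cont)

lemma wave_poly_growth: "y \<ge> 0 \<Longrightarrow> poly_growth (wave X y)"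
  by (rule poly_growth_bounded[of _ 1, OF wave_cont cmod_wave])

text \<open>
  A point off the segment \<open>a \<le> X \<le> b\<close>, \<open>y = 0\<close> that carries the test function, with a distance \<open>\<delta>\<close>
  quantified in the direction of \<open>y\<close> only.
\<close>

definition away :: "real \<Rightarrow> real \<Rightarrow> real \<Rightarrow> bool" where
  "away \<delta> X y \<longleftrightarrow> y \<ge> 0 \<and> (y \<ge> \<delta> \<or> X \<notin> {a..b})"

text \<open>
  The polynomials in \<open>\<eta>\<close> and \<open>S \<eta>\<close> with complex coefficients. They arise as coefficients in the
  global relation and from differentiating waves along a side.
\<close>

inductive poly_symbol :: "(real \<Rightarrow> complex) \<Rightarrow> bool" where
  monom: "poly_symbol (\<lambda>\<eta>. of_real (\<eta> ^ p * S \<eta> ^ r))"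
| add: "poly_symbol m \<Longrightarrow> poly_symbol m' \<Longrightarrow> poly_symbol (\<lambda>\<eta>. m \<eta> + m' \<eta>)"
| cmult: "poly_symbol m \<Longrightarrow> poly_symbol (\<lambda>\<eta>. c * m \<eta>)"

lemma S_poly_growth: "poly_growth (\<lambda>\<eta>. of_real (S \<eta>))"
  unfolding poly_growth_def
proof (intro conjI exI allI)
  show "continuous_on UNIV (\<lambda>\<eta>. complex_of_real (S \<eta>))" by (intro continuous_intros S_cont)
  show "cmod (of_real (S \<eta>)) \<le> (sqrt A + sqrt B) * (1 + \<bar>\<eta>\<bar>) ^ 1" for \<eta>
    using S_le[of \<eta>] S_pos[of \<eta>] by simp
qed

lemma poly_symbol_poly_growth: "poly_symbol m \<Longrightarrow> poly_growth m"
proof (induction rule: poly_symbol.induct)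
  case (monom p r)
  have "poly_growth (\<lambda>\<eta>. of_real \<eta> ^ p * of_real (S \<eta>) ^ r)"
    by (intro poly_growth_mult poly_growth_power poly_growth_id S_poly_growth)
  then show ?case by simp
qed (auto intro: poly_growth_add poly_growth_mult poly_growth_const)

lemma poly_symbol_mult_linear:
  "poly_symbol m \<Longrightarrow> poly_symbol (\<lambda>\<eta>. m \<eta> * (c * of_real \<eta> + c' * of_real (S \<eta>)))"
proof (induction rule: poly_symbol.induct)
  case (monom p r)
  have "poly_symbol (\<lambda>\<eta>. c * of_real (\<eta> ^ (p + 1) * S \<eta> ^ r) + c' * of_real (\<eta> ^ p * S \<eta> ^ (r + 1)))"
    by (intro poly_symbol.intros)
  then show ?case by (simp add: algebra_simps)
next
  case (add m m')
  then show ?case using poly_symbol.add[OF add.IH] by (simp add: algebra_simps)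
next
  case (cmult m d)
  then show ?case using poly_symbol.cmult[OF cmult.IH, of d] by (simp add: mult.assoc)
qed

lemma poly_symbol_mult_linear_power:
  "poly_symbol m \<Longrightarrow> poly_symbol (\<lambda>\<eta>. m \<eta> * (c * of_real \<eta> + c' * of_real (S \<eta>)) ^ k)"
proof (induction k)
  case (Suc k)
  then show ?case using poly_symbol_mult_linear[OF Suc.IH[OF Suc.prems], of c c'] by (simp add: mult_ac)
qed simp

lemma poly_symbol_wave_rapid: "poly_symbol m \<Longrightarrow> y \<ge> 0 \<Longrightarrow> rapid (\<lambda>\<eta>. h (\<xi> - \<eta>) * (m \<eta> * wave X y \<eta>))"
  by (intro rapid_mult rapid_reflect h_rapid poly_growth_mult poly_symbol_poly_growth wave_poly_growth)

text \<open>
  By linearity only monomials matter. For these the reflection \<open>\<eta> = \<xi> - \<zeta>\<close> brings the integral into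
  the form treated in \<open>decay_off_support\<close> and \<open>decay_off_axis\<close>.
\<close>

lemma poly_symbol_decay:
  assumes \<delta>: "\<delta> > 0"
  shows "poly_symbol m \<Longrightarrow> \<exists>C\<ge>0. \<forall>\<xi> X y. away \<delta> X y \<longrightarrow>
    (1 + \<bar>\<xi>\<bar>) ^ M * cmod (\<integral>\<eta>. h (\<xi> - \<eta>) * (m \<eta> * wave X y \<eta>) \<partial>lborel) \<le> C"
proof (induction rule: poly_symbol.induct)
  case (monom p r)
  let ?g = "\<lambda>y \<eta>. y ^ 0 * \<eta> ^ p * S \<eta> powr real r * exp (- y * S \<eta>)"
  have g: "exp_symbol (real p + real r - real 0) ?g" by (rule exp_symbol.monom)
  obtain C where C: "C \<ge> 0" "\<And>\<xi> X y. y \<ge> 0 \<Longrightarrow> X \<notin> {a..b} \<Longrightarrow>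
    (1 + \<bar>\<xi>\<bar>) ^ M * cmod (\<integral>\<zeta>. h \<zeta> * (of_real (?g y (\<xi> - \<zeta>)) * iexp (X * \<zeta>)) \<partial>lborel) \<le> C"
    using decay_off_support[OF g, of M] by blast
  obtain D where D: "D \<ge> 0" "\<And>\<xi> X y. y \<ge> \<delta> \<Longrightarrow>
    (1 + \<bar>\<xi>\<bar>) ^ M * cmod (\<integral>\<zeta>. h \<zeta> * (of_real (?g y (\<xi> - \<zeta>)) * iexp (X * \<zeta>)) \<partial>lborel) \<le> D"
    using decay_off_axis[OF g \<delta>, of M] by blast
  have "(1 + \<bar>\<xi>\<bar>) ^ M * cmod (\<integral>\<eta>. h (\<xi> - \<eta>) * (of_real (\<eta> ^ p * S \<eta> ^ r) * wave X y \<eta>) \<partial>lborel) \<le> C + D"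
    if aw: "away \<delta> X y" for \<xi> X y
  proof -
    have "(\<integral>\<eta>. h (\<xi> - \<eta>) * (of_real (\<eta> ^ p * S \<eta> ^ r) * wave X y \<eta>) \<partial>lborel)
       = (\<integral>\<zeta>. h (\<xi> - (\<xi> - \<zeta>)) * (of_real ((\<xi> - \<zeta>) ^ p * S (\<xi> - \<zeta>) ^ r) * wave X y (\<xi> - \<zeta>)) \<partial>lborel)"
      by (rule reflect_integral)
    also have "\<dots> = (\<integral>\<zeta>. exp (- \<i> * of_real (X * \<xi>)) * (h \<zeta> * (of_real (?g y (\<xi> - \<zeta>)) * iexp (X * \<zeta>))) \<partial>lborel)"
    proof (rule Bochner_Integration.integral_cong[OF refl])
      fix \<zeta>
      have "wave X y (\<xi> - \<zeta>) = exp (- \<i> * of_real (X * \<xi>)) * (of_real (exp (- y * S (\<xi> - \<zeta>))) * iexp (X * \<zeta>))"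
        by (simp add: wave_def exp_of_real[symmetric] exp_add[symmetric] algebra_simps)
      moreover have "S (\<xi> - \<zeta>) powr real r = S (\<xi> - \<zeta>) ^ r" using S_pos by (simp add: powr_realpow)
      ultimately show "h (\<xi> - (\<xi> - \<zeta>)) * (of_real ((\<xi> - \<zeta>) ^ p * S (\<xi> - \<zeta>) ^ r) * wave X y (\<xi> - \<zeta>))
        = exp (- \<i> * of_real (X * \<xi>)) * (h \<zeta> * (of_real (?g y (\<xi> - \<zeta>)) * iexp (X * \<zeta>)))"
        by (simp add: mult_ac)
    qed
    also have "\<dots> = exp (- \<i> * of_real (X * \<xi>)) * (\<integral>\<zeta>. h \<zeta> * (of_real (?g y (\<xi> - \<zeta>)) * iexp (X * \<zeta>)) \<partial>lborel)"
      by (rule integral_mult_right_zero)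
    finally have "cmod (\<integral>\<eta>. h (\<xi> - \<eta>) * (of_real (\<eta> ^ p * S \<eta> ^ r) * wave X y \<eta>) \<partial>lborel)
       = cmod (\<integral>\<zeta>. h \<zeta> * (of_real (?g y (\<xi> - \<zeta>)) * iexp (X * \<zeta>)) \<partial>lborel)"
      by (simp add: norm_mult)
    moreover have "(1 + \<bar>\<xi>\<bar>) ^ M * cmod (\<integral>\<zeta>. h \<zeta> * (of_real (?g y (\<xi> - \<zeta>)) * iexp (X * \<zeta>)) \<partial>lborel) \<le> C + D"
      using aw C(1) C(2)[of y X \<xi>] D(1) D(2)[of y \<xi> X] unfolding away_def by linarith
    ultimately show ?thesis by simp
  qed
  then show ?case using C(1) D(1) by (intro exI[of _ "C + D"]) auto
next
  case (add m m')
  then obtain C D where C: "C \<ge> 0" "\<And>\<xi> X y. away \<delta> X y \<Longrightarrow> (1 + \<bar>\<xi>\<bar>) ^ M * cmod (\<integral>\<eta>. h (\<xi> - \<eta>) * (m \<eta> * wave X y \<eta>) \<partial>lborel) \<le> C"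
    and D: "D \<ge> 0" "\<And>\<xi> X y. away \<delta> X y \<Longrightarrow> (1 + \<bar>\<xi>\<bar>) ^ M * cmod (\<integral>\<eta>. h (\<xi> - \<eta>) * (m' \<eta> * wave X y \<eta>) \<partial>lborel) \<le> D"
    by blast
  have "(1 + \<bar>\<xi>\<bar>) ^ M * cmod (\<integral>\<eta>. h (\<xi> - \<eta>) * ((m \<eta> + m' \<eta>) * wave X y \<eta>) \<partial>lborel) \<le> C + D"
    if aw: "away \<delta> X y" for \<xi> X y
  proof -
    have y: "y \<ge> 0" using aw by (simp add: away_def)
    have "(\<integral>\<eta>. h (\<xi> - \<eta>) * ((m \<eta> + m' \<eta>) * wave X y \<eta>) \<partial>lborel)
       = (\<integral>\<eta>. h (\<xi> - \<eta>) * (m \<eta> * wave X y \<eta>) + h (\<xi> - \<eta>) * (m' \<eta> * wave X y \<eta>) \<partial>lborel)"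
      by (simp only: distrib_left distrib_right)
    also have "\<dots> = (\<integral>\<eta>. h (\<xi> - \<eta>) * (m \<eta> * wave X y \<eta>) \<partial>lborel) + (\<integral>\<eta>. h (\<xi> - \<eta>) * (m' \<eta> * wave X y \<eta>) \<partial>lborel)"
      by (rule Bochner_Integration.integral_add[OF rapid_integrable rapid_integrable])
         (use poly_symbol_wave_rapid add.hyps y in blast)+
    finally have "(1 + \<bar>\<xi>\<bar>) ^ M * cmod (\<integral>\<eta>. h (\<xi> - \<eta>) * ((m \<eta> + m' \<eta>) * wave X y \<eta>) \<partial>lborel)
      \<le> (1 + \<bar>\<xi>\<bar>) ^ M * (cmod (\<integral>\<eta>. h (\<xi> - \<eta>) * (m \<eta> * wave X y \<eta>) \<partial>lborel) + cmod (\<integral>\<eta>. h (\<xi> - \<eta>) * (m' \<eta> * wave X y \<eta>) \<partial>lborel))"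
      by (simp only:) (intro mult_left_mono norm_triangle_ineq, simp)
    then show ?thesis using C(2)[OF aw, of \<xi>] D(2)[OF aw, of \<xi>] unfolding distrib_left by linarith
  qed
  then show ?case using C(1) D(1) by (intro exI[of _ "C + D"]) auto
next
  case (cmult m c)
  then obtain C where C: "C \<ge> 0" "\<And>\<xi> X y. away \<delta> X y \<Longrightarrow> (1 + \<bar>\<xi>\<bar>) ^ M * cmod (\<integral>\<eta>. h (\<xi> - \<eta>) * (m \<eta> * wave X y \<eta>) \<partial>lborel) \<le> C"
    by blast
  have "(1 + \<bar>\<xi>\<bar>) ^ M * cmod (\<integral>\<eta>. h (\<xi> - \<eta>) * (c * m \<eta> * wave X y \<eta>) \<partial>lborel) \<le> cmod c * C"
    if aw: "away \<delta> X y" for \<xi> X y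
  proof -
    have "(\<integral>\<eta>. h (\<xi> - \<eta>) * (c * m \<eta> * wave X y \<eta>) \<partial>lborel) = c * (\<integral>\<eta>. h (\<xi> - \<eta>) * (m \<eta> * wave X y \<eta>) \<partial>lborel)"
      unfolding integral_mult_right_zero[symmetric] by (simp only: mult_ac)
    then show ?thesis using mult_left_mono[OF C(2)[OF aw, of \<xi>], of "cmod c"] by (simp add: norm_mult mult_ac)
  qed
  then show ?case using C(1) by (intro exI[of _ "cmod c * C"]) auto
qed

text \<open>
  The maximum of \<open>y\<close>, \<open>a - X\<close> and \<open>X - b\<close> is a positive continuous function on the compact
  segment; \<open>\<delta>\<close> is its minimum.
\<close>

lemma away_segment:
  assumes y: "\<And>t. t \<in> {0..1} \<Longrightarrow> y0 + t * y1 \<ge> 0"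
    and X: "\<And>t. t \<in> {0..1} \<Longrightarrow> y0 + t * y1 = 0 \<Longrightarrow> X0 + t * X1 \<notin> {a..b}"
  shows "\<exists>\<delta>>0. \<forall>t\<in>{0..1}. away \<delta> (X0 + t * X1) (y0 + t * y1)"
proof -
  let ?F = "\<lambda>t. max (y0 + t * y1) (max (a - (X0 + t * X1)) ((X0 + t * X1) - b))"
  have "continuous_on {0..1} ?F" by (intro continuous_intros)
  then obtain t0 where t0: "t0 \<in> {0..1}" "\<And>t. t \<in> {0..1} \<Longrightarrow> ?F t0 \<le> ?F t"
    using continuous_attains_inf[of "{0..1::real}" ?F] by auto
  have p: "?F t0 > 0" using y[OF t0(1)] X[OF t0(1)] by (auto simp: less_max_iff_disj)
  have "away (?F t0) (X0 + t * X1) (y0 + t * y1)" if t: "t \<in> {0..1}" for t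
    using t0(2)[OF t] p y[OF t] unfolding away_def by auto
  then show ?thesis using p by blast
qed

lemma poly_symbol_const: "poly_symbol (\<lambda>\<eta>. c)"
  using poly_symbol.cmult[OF poly_symbol.monom[of 0 0], of c] by simp

lemma poly_symbol_linear: "poly_symbol (\<lambda>\<eta>. c * of_real \<eta> + c' * of_real (S \<eta>))"
  using poly_symbol_mult_linear[OF poly_symbol_const[of 1], of c c'] by simp

lemma wave_smooth:
  "(\<lambda>t. wave (X0 + t * X1) (y0 + t * y1) \<eta>) \<in> smooth_on {0..1}"
proof -
  have "wave (X0 + t * X1) (y0 + t * y1) \<eta>
      = wave X0 y0 \<eta> * exp (of_real t * - (\<i> * of_real (X1 * \<eta>) + of_real (y1 * S \<eta>)))" for t
    unfolding wave_def by (simp add: exp_add[symmetric] algebra_simps)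
  then show ?thesis
    using jet_smooth01[OF jet_exp[of "{0..1}" "wave X0 y0 \<eta>" "- (\<i> * of_real (X1 * \<eta>) + of_real (y1 * S \<eta>))"]]
    by simp
qed

text \<open>
  Functions of the frequency which, after localisation by the test function, are rapidly decreasing:
  the Fourier transforms of distributions that are smooth near the support of the test function.
\<close>

definition negligible :: "(real \<Rightarrow> complex) \<Rightarrow> bool" where
  "negligible G \<longleftrightarrow> (\<forall>\<xi>. integrable lborel (\<lambda>\<eta>. h (\<xi> - \<eta>) * G \<eta>)) \<and>
     (\<forall>M. \<exists>C\<ge>0. \<forall>\<xi>. (1 + \<bar>\<xi>\<bar>) ^ M * cmod (\<integral>\<eta>. h (\<xi> - \<eta>) * G \<eta> \<partial>lborel) \<le> C)"

lemma negligible_add: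
  assumes F: "negligible F" and G: "negligible G"
  shows "negligible (\<lambda>\<eta>. F \<eta> + G \<eta>)"
proof -
  have i: "integrable lborel (\<lambda>\<eta>. h (\<xi> - \<eta>) * F \<eta>)" "integrable lborel (\<lambda>\<eta>. h (\<xi> - \<eta>) * G \<eta>)" for \<xi>
    using F G by (auto simp: negligible_def)
  have eq: "(\<integral>\<eta>. h (\<xi> - \<eta>) * (F \<eta> + G \<eta>) \<partial>lborel)
      = (\<integral>\<eta>. h (\<xi> - \<eta>) * F \<eta> \<partial>lborel) + (\<integral>\<eta>. h (\<xi> - \<eta>) * G \<eta> \<partial>lborel)" for \<xi>
    unfolding distrib_left by (rule Bochner_Integration.integral_add[OF i])
  have "\<exists>C\<ge>0. \<forall>\<xi>. (1 + \<bar>\<xi>\<bar>) ^ M * cmod (\<integral>\<eta>. h (\<xi> - \<eta>) * (F \<eta> + G \<eta>) \<partial>lborel) \<le> C" for M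
  proof -
    obtain C where C: "C \<ge> 0" "\<And>\<xi>. (1 + \<bar>\<xi>\<bar>) ^ M * cmod (\<integral>\<eta>. h (\<xi> - \<eta>) * F \<eta> \<partial>lborel) \<le> C"
      using F unfolding negligible_def by blast
    obtain D where D: "D \<ge> 0" "\<And>\<xi>. (1 + \<bar>\<xi>\<bar>) ^ M * cmod (\<integral>\<eta>. h (\<xi> - \<eta>) * G \<eta> \<partial>lborel) \<le> D"
      using G unfolding negligible_def by blast
    have "(1 + \<bar>\<xi>\<bar>) ^ M * cmod (\<integral>\<eta>. h (\<xi> - \<eta>) * (F \<eta> + G \<eta>) \<partial>lborel) \<le> C + D" for \<xi>
    proof -
      have "(1 + \<bar>\<xi>\<bar>) ^ M * cmod (\<integral>\<eta>. h (\<xi> - \<eta>) * (F \<eta> + G \<eta>) \<partial>lborel)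
        \<le> (1 + \<bar>\<xi>\<bar>) ^ M * (cmod (\<integral>\<eta>. h (\<xi> - \<eta>) * F \<eta> \<partial>lborel) + cmod (\<integral>\<eta>. h (\<xi> - \<eta>) * G \<eta> \<partial>lborel))"
        unfolding eq by (intro mult_left_mono norm_triangle_ineq) simp
      then show ?thesis using C(2)[of \<xi>] D(2)[of \<xi>] unfolding distrib_left[of "(1 + \<bar>\<xi>\<bar>) ^ M"] by linarith
    qed
    then show ?thesis using C(1) D(1) by (intro exI[of _ "C + D"]) auto
  qed
  moreover have "integrable lborel (\<lambda>\<eta>. h (\<xi> - \<eta>) * (F \<eta> + G \<eta>))" for \<xi>
    unfolding distrib_left by (rule Bochner_Integration.integrable_add[OF i])
  ultimately show ?thesis unfolding negligible_def by blast
qed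

lemma negligible_cmult:
  assumes F: "negligible F"
  shows "negligible (\<lambda>\<eta>. c * F \<eta>)"
proof -
  have eq: "(\<lambda>\<eta>. h (\<xi> - \<eta>) * (c * F \<eta>)) = (\<lambda>\<eta>. c * (h (\<xi> - \<eta>) * F \<eta>))" for \<xi>
    by (simp only: mult_ac)
  have "\<exists>C\<ge>0. \<forall>\<xi>. (1 + \<bar>\<xi>\<bar>) ^ M * cmod (\<integral>\<eta>. h (\<xi> - \<eta>) * (c * F \<eta>) \<partial>lborel) \<le> C" for M
  proof -
    obtain C where C: "C \<ge> 0" "\<And>\<xi>. (1 + \<bar>\<xi>\<bar>) ^ M * cmod (\<integral>\<eta>. h (\<xi> - \<eta>) * F \<eta> \<partial>lborel) \<le> C"
      using F unfolding negligible_def by blast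
    have "(1 + \<bar>\<xi>\<bar>) ^ M * cmod (\<integral>\<eta>. h (\<xi> - \<eta>) * (c * F \<eta>) \<partial>lborel) \<le> cmod c * C" for \<xi>
      unfolding eq integral_mult_right_zero norm_mult
      using mult_left_mono[OF C(2)[of \<xi>], of "cmod c"] by (simp add: mult_ac)
    then show ?thesis using C(1) by (intro exI[of _ "cmod c * C"]) auto
  qed
  moreover have "integrable lborel (\<lambda>\<eta>. h (\<xi> - \<eta>) * (c * F \<eta>))" for \<xi>
    unfolding eq using F by (intro integrable_mult_right) (simp add: negligible_def)
  ultimately show ?thesis unfolding negligible_def by blast
qed

lemma negligible_sum: "finite J \<Longrightarrow> (\<And>j. j \<in> J \<Longrightarrow> negligible (F j)) \<Longrightarrow> negligible (\<lambda>\<eta>. \<Sum>j\<in>J. F j \<eta>)"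
proof (induction J rule: finite_induct)
  case empty
  then show ?case by (auto simp: negligible_def)
next
  case (insert j J)
  then show ?case by (simp add: negligible_add)
qed

text \<open>
  Along an affine segment a wave is \<open>exp (t b(\<eta>))\<close> up to a factor independent of \<open>t\<close>, where \<open>b\<close> is
  linear in \<open>\<eta>\<close> and \<open>S \<eta>\<close>. Hence the functional may be interchanged with the convolution integral,
  and it is applied to a function of \<open>t\<close> whose derivatives decrease rapidly in \<open>\<xi>\<close> by
  \<open>poly_symbol_decay\<close>, since each derivative produces only one more factor \<open>b(\<eta>)\<close>.
\<close>

lemma segment_negligible:
  assumes u: "u \<in> dual01" and m: "poly_symbol m" and \<delta>: "\<delta> > 0"
    and far: "\<And>t. t \<in> {0..1} \<Longrightarrow> away \<delta> (X0 + t * X1) (y0 + t * y1)"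
  shows "negligible (\<lambda>\<eta>. m \<eta> * u (\<lambda>t. wave (X0 + t * X1) (y0 + t * y1) \<eta>))"
proof -
  define G where "G \<eta> = m \<eta> * u (\<lambda>t. wave (X0 + t * X1) (y0 + t * y1) \<eta>)" for \<eta>
  define c where "c = - (\<i> * complex_of_real X1)"
  define c' where "c' = - complex_of_real y1"
  let ?b = "\<lambda>\<eta>. c * of_real \<eta> + c' * of_real (S \<eta>)"
  let ?w = "\<lambda>\<xi> \<eta>. h (\<xi> - \<eta>) * (m \<eta> * wave X0 y0 \<eta>)"
  have w: "wave (X0 + t * X1) (y0 + t * y1) \<eta> = wave X0 y0 \<eta> * exp (of_real t * ?b \<eta>)" for t \<eta>
    unfolding wave_def c_def c'_def by (simp add: exp_add[symmetric] algebra_simps)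
  have y0: "y0 \<ge> 0" using far[of 0] by (simp add: away_def)
  have pw: "poly_symbol (\<lambda>\<eta>. m \<eta> * ?b \<eta> ^ k)" for k by (rule poly_symbol_mult_linear_power[OF m])
  have E: "exp_integral01 (?w \<xi>) ?b (\<lambda>k \<eta>. cmod (h (\<xi> - \<eta>) * (m \<eta> * ?b \<eta> ^ k))) u" for \<xi>
  proof
    have cw: "continuous_on UNIV (?w \<xi>)" using poly_symbol_wave_rapid[OF m y0, of \<xi> X0] by (simp add: rapid_def)
    have cb: "continuous_on UNIV ?b" by (intro continuous_intros S_cont)
    show "continuous_on UNIV (?w \<xi>)" "continuous_on UNIV ?b" by (rule cw, rule cb)
    show "?w \<xi> \<in> borel_measurable borel" "?b \<in> borel_measurable borel"
      by (rule borel_measurable_continuous_onI[OF cw], rule borel_measurable_continuous_onI[OF cb])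
    show "integrable lborel (\<lambda>\<eta>. cmod (h (\<xi> - \<eta>) * (m \<eta> * ?b \<eta> ^ k)))" for k
      by (rule integrable_norm[OF rapid_integrable[OF rapid_mult[OF rapid_reflect[OF h_rapid] poly_symbol_poly_growth[OF pw]]]])
    show "cmod (?w \<xi> \<eta> * ?b \<eta> ^ k * exp (of_real t * ?b \<eta>)) \<le> cmod (h (\<xi> - \<eta>) * (m \<eta> * ?b \<eta> ^ k))" if t: "t \<in> {0..1}" for k t \<eta>
    proof -
      have "?w \<xi> \<eta> * ?b \<eta> ^ k * exp (of_real t * ?b \<eta>) = h (\<xi> - \<eta>) * (m \<eta> * ?b \<eta> ^ k) * wave (X0 + t * X1) (y0 + t * y1) \<eta>"
        unfolding w by (simp only: mult_ac)
      moreover have "cmod (wave (X0 + t * X1) (y0 + t * y1) \<eta>) \<le> 1"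
        using far[OF t] by (intro cmod_wave) (simp add: away_def)
      ultimately show ?thesis
        using mult_left_le[of "cmod (wave (X0 + t * X1) (y0 + t * y1) \<eta>)" "cmod (h (\<xi> - \<eta>) * (m \<eta> * ?b \<eta> ^ k))"]
        by (simp only: norm_mult[of "h (\<xi> - \<eta>) * (m \<eta> * ?b \<eta> ^ k)"] norm_ge_zero)
    qed
    show "u \<in> dual01" by (rule u)
  qed auto
  have V: "exp_integral01.V (?w \<xi>) ?b u = (\<lambda>\<eta>. h (\<xi> - \<eta>) * G \<eta>)" for \<xi>
  proof
    fix \<eta>
    have "u (\<lambda>t. wave (X0 + t * X1) (y0 + t * y1) \<eta>) = wave X0 y0 \<eta> * u (\<lambda>t. exp (of_real t * ?b \<eta>))"
      unfolding w by (rule dual01_cmult[OF u exp_smooth01])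
    then show "exp_integral01.V (?w \<xi>) ?b u \<eta> = h (\<xi> - \<eta>) * G \<eta>"
      unfolding exp_integral01.V_def[OF E] G_def by (simp only: mult_ac)
  qed
  have int: "integrable lborel (\<lambda>\<eta>. h (\<xi> - \<eta>) * G \<eta>)" for \<xi>
    using exp_integral01.V_integrable[OF E, of \<xi>] unfolding V .
  have K: "exp_integral.K (?w \<xi>) ?b k t = (\<integral>\<eta>. h (\<xi> - \<eta>) * ((m \<eta> * ?b \<eta> ^ k) * wave (X0 + t * X1) (y0 + t * y1) \<eta>) \<partial>lborel)" for \<xi> k t
    unfolding exp_integral.K_def[OF exp_integral01.axioms(1)[OF E]] w by (simp only: mult_ac)
  have "\<exists>C\<ge>0. \<forall>\<xi>. (1 + \<bar>\<xi>\<bar>) ^ M * cmod (\<integral>\<eta>. h (\<xi> - \<eta>) * G \<eta> \<partial>lborel) \<le> C" for M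
  proof -
  obtain C N where ob: "order_bound u C N" using dual01_bounded[OF u] by blast
  define Q where "Q k D \<longleftrightarrow> D \<ge> 0 \<and> (\<forall>\<xi> X y. away \<delta> X y \<longrightarrow>
    (1 + \<bar>\<xi>\<bar>) ^ M * cmod (\<integral>\<eta>. h (\<xi> - \<eta>) * ((m \<eta> * ?b \<eta> ^ k) * wave X y \<eta>) \<partial>lborel) \<le> D)" for k D
  have "\<forall>k. \<exists>D. Q k D" unfolding Q_def using poly_symbol_decay[OF \<delta> pw] by blast
  then obtain D where QD: "\<forall>k. Q k (D k)" by (elim choice[elim_format] exE)
  have D: "D k \<ge> 0" "away \<delta> X y \<Longrightarrow>
    (1 + \<bar>\<xi>\<bar>) ^ M * cmod (\<integral>\<eta>. h (\<xi> - \<eta>) * ((m \<eta> * ?b \<eta> ^ k) * wave X y \<eta>) \<partial>lborel) \<le> D k" for k \<xi> X y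
    using QD unfolding Q_def by blast+
  have "(1 + \<bar>\<xi>\<bar>) ^ M * cmod (\<integral>\<eta>. h (\<xi> - \<eta>) * G \<eta> \<partial>lborel) \<le> C * (\<Sum>k\<le>N. D k)" for \<xi>
  proof -
    let ?B = "(\<Sum>k\<le>N. D k) / (1 + \<bar>\<xi>\<bar>) ^ M"
    have p: "(1 + \<bar>\<xi>\<bar>) ^ M > 0" by (simp add: add_pos_nonneg)
    have "cmod (u (exp_integral.K (?w \<xi>) ?b 0)) \<le> C * ?B"
    proof (rule order_boundD[OF ob exp_integral.jet_K[OF exp_integral01.axioms(1)[OF E]]])
      fix k t assume k: "k \<le> N" and t: "t \<in> {0..1::real}"
      have "D k \<le> (\<Sum>k\<le>N. D k)" using k D(1) by (intro member_le_sum) auto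
      then have "cmod (exp_integral.K (?w \<xi>) ?b k t) * (1 + \<bar>\<xi>\<bar>) ^ M \<le> (\<Sum>k\<le>N. D k)"
        using D(2)[OF far[OF t], of \<xi> k] unfolding K by (simp only: mult.commute)
      then show "cmod (exp_integral.K (?w \<xi>) ?b k t) \<le> ?B" using p by (simp only: pos_le_divide_eq)
    qed
    then have "cmod (\<integral>\<eta>. h (\<xi> - \<eta>) * G \<eta> \<partial>lborel) \<le> C * (\<Sum>k\<le>N. D k) / (1 + \<bar>\<xi>\<bar>) ^ M"
      unfolding exp_integral01.functional_exchange[OF E] V by simp
    then show ?thesis using p by (simp add: pos_le_divide_eq mult.commute)
  qed
  moreover have "C * (\<Sum>k\<le>N. D k) \<ge> 0"
    using order_bound_pos[OF ob] D(1) by (intro mult_nonneg_nonneg sum_nonneg) auto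
  ultimately show ?thesis by blast
  qed
  then have "negligible G" using int unfolding negligible_def by blast
  then show ?thesis by (simp only: G_def[abs_def])
qed

end

section \<open>Multiplication by the dispersion relation on Sobolev spaces\<close>

text \<open>
  Peetre's inequality for arbitrary real exponents; for negative ones the roles of \<open>\<xi>\<close> and \<open>\<eta>\<close> are
  exchanged.
\<close>

lemma peetre_weight:
  fixes \<xi> \<eta> r :: real
  shows "(1 + \<xi>\<^sup>2) powr r \<le> 2 powr \<bar>r\<bar> * (1 + (\<xi> - \<eta>)\<^sup>2) powr \<bar>r\<bar> * (1 + \<eta>\<^sup>2) powr r"
proof -
  have pos: "1 + x\<^sup>2 > 0" for x :: real by (simp add: add_pos_nonneg)
  have key: "1 + x\<^sup>2 \<le> 2 * (1 + (x - y)\<^sup>2) * (1 + y\<^sup>2)" for x y :: real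
  proof -
    have "2 * (1 + (x - y)\<^sup>2) * (1 + y\<^sup>2) - (1 + x\<^sup>2) = 1 + (x - 2 * y)\<^sup>2 + 2 * ((x - y) * y)\<^sup>2"
      by (simp add: power2_eq_square algebra_simps)
    moreover have "\<dots> \<ge> 0" by simp
    ultimately show ?thesis by linarith
  qed
  show ?thesis
  proof (cases "r \<ge> 0")
    case True
    have "(1 + \<xi>\<^sup>2) powr r \<le> (2 * (1 + (\<xi> - \<eta>)\<^sup>2) * (1 + \<eta>\<^sup>2)) powr r"
      using pos[of \<xi>] by (intro powr_mono2 key True) auto
    also have "\<dots> = 2 powr r * (1 + (\<xi> - \<eta>)\<^sup>2) powr r * (1 + \<eta>\<^sup>2) powr r"
      by (simp only: powr_mult)
    finally show ?thesis using True by simp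
  next
    case False
    define t where "t = - r"
    have t: "t \<ge> 0" "r = - t" using False by (auto simp: t_def)
    have "(1 + \<eta>\<^sup>2) powr t \<le> (2 * (1 + (\<eta> - \<xi>)\<^sup>2) * (1 + \<xi>\<^sup>2)) powr t"
      using pos[of \<eta>] by (intro powr_mono2 key t) auto
    also have "\<dots> = 2 powr t * (1 + (\<xi> - \<eta>)\<^sup>2) powr t * (1 + \<xi>\<^sup>2) powr t"
      by (simp only: powr_mult power2_commute[of \<eta> \<xi>])
    finally have "(1 + \<eta>\<^sup>2) powr t / (1 + \<xi>\<^sup>2) powr t \<le> 2 powr t * (1 + (\<xi> - \<eta>)\<^sup>2) powr t"
      using pos[of \<xi>] by (simp add: pos_divide_le_eq)
    then have "(1 + \<eta>\<^sup>2) powr (-t) * ((1 + \<eta>\<^sup>2) powr t * (1 + \<xi>\<^sup>2) powr (-t)) \<le> (1 + \<eta>\<^sup>2) powr (-t) * (2 powr t * (1 + (\<xi> - \<eta>)\<^sup>2) powr t)"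
      by (intro mult_left_mono) (auto simp: powr_minus divide_inverse)
    moreover have "(1 + \<eta>\<^sup>2) powr (-t) * ((1 + \<eta>\<^sup>2) powr t * (1 + \<xi>\<^sup>2) powr (-t)) = (1 + \<xi>\<^sup>2) powr (-t)"
      using pos[of \<eta>] by (simp only: mult.assoc[symmetric] powr_add[symmetric]) simp
    ultimately have "(1 + \<xi>\<^sup>2) powr (-t) \<le> (1 + \<eta>\<^sup>2) powr (-t) * (2 powr t * (1 + (\<xi> - \<eta>)\<^sup>2) powr t)"
      by (simp only:)
    then show ?thesis using t by (simp add: mult_ac)
  qed
qed

text \<open>
  Young's inequality: the Cauchy--Schwarz inequality with \<open>k = sqrt k * sqrt k\<close> and Tonelli's theorem.
\<close>

lemma young_L2:
  fixes k v :: "real \<Rightarrow> ennreal"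
  assumes [measurable]: "k \<in> borel_measurable borel" "v \<in> borel_measurable borel"
    and k: "\<And>x. k x < \<infinity>"
  shows "(\<integral>\<^sup>+\<xi>. (\<integral>\<^sup>+\<eta>. k (\<xi> - \<eta>) * v \<eta> \<partial>lborel)\<^sup>2 \<partial>lborel)
     \<le> (\<integral>\<^sup>+x. k x \<partial>lborel)\<^sup>2 * (\<integral>\<^sup>+\<eta>. (v \<eta>)\<^sup>2 \<partial>lborel)"
proof -
  let ?K = "\<integral>\<^sup>+x. k x \<partial>lborel"
  define r where "r = (\<lambda>x. ennreal (sqrt (enn2real (k x))))"
  have [measurable]: "r \<in> borel_measurable borel" unfolding r_def by measurable
  have r: "r x * r x = k x" for x
    using k[of x] by (simp add: r_def ennreal_mult[symmetric])
  have shift: "(\<integral>\<^sup>+\<eta>. k (\<xi> - \<eta>) \<partial>lborel) = ?K" for \<xi>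
    using nn_integral_real_affine[of k "-1" \<xi>] by simp
  have shift': "(\<integral>\<^sup>+\<xi>. k (\<xi> - \<eta>) \<partial>lborel) = ?K" for \<eta>
    using nn_integral_real_affine[of k 1 "-\<eta>"] by (simp add: add.commute)
  have cs: "(\<integral>\<^sup>+\<eta>. k (\<xi> - \<eta>) * v \<eta> \<partial>lborel)\<^sup>2 \<le> ?K * (\<integral>\<^sup>+\<eta>. k (\<xi> - \<eta>) * (v \<eta>)\<^sup>2 \<partial>lborel)" for \<xi>
  proof -
    have "(\<integral>\<^sup>+\<eta>. r (\<xi> - \<eta>) * (r (\<xi> - \<eta>) * v \<eta>) \<partial>lborel)\<^sup>2
      \<le> (\<integral>\<^sup>+\<eta>. (r (\<xi> - \<eta>))\<^sup>2 \<partial>lborel) * (\<integral>\<^sup>+\<eta>. (r (\<xi> - \<eta>) * v \<eta>)\<^sup>2 \<partial>lborel)"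
      by (rule Cauchy_Schwarz_nn_integral) measurable
    moreover have "r x * (r x * c) = k x * c" "(r x)\<^sup>2 = k x" "(r x * c)\<^sup>2 = k x * c\<^sup>2" for x c
      using r[of x] by (simp_all add: power2_eq_square mult_ac)
    ultimately show ?thesis using shift by simp
  qed
  have "(\<integral>\<^sup>+\<xi>. (\<integral>\<^sup>+\<eta>. k (\<xi> - \<eta>) * v \<eta> \<partial>lborel)\<^sup>2 \<partial>lborel)
     \<le> (\<integral>\<^sup>+\<xi>. ?K * (\<integral>\<^sup>+\<eta>. k (\<xi> - \<eta>) * (v \<eta>)\<^sup>2 \<partial>lborel) \<partial>lborel)"
    by (intro nn_integral_mono cs)
  also have "\<dots> = ?K * (\<integral>\<^sup>+\<xi>. (\<integral>\<^sup>+\<eta>. k (\<xi> - \<eta>) * (v \<eta>)\<^sup>2 \<partial>lborel) \<partial>lborel)"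
    by (rule nn_integral_cmult) measurable
  also have "(\<integral>\<^sup>+\<xi>. (\<integral>\<^sup>+\<eta>. k (\<xi> - \<eta>) * (v \<eta>)\<^sup>2 \<partial>lborel) \<partial>lborel) = (\<integral>\<^sup>+\<eta>. (\<integral>\<^sup>+\<xi>. k (\<xi> - \<eta>) * (v \<eta>)\<^sup>2 \<partial>lborel) \<partial>lborel)"
    by (rule lborel_pair.Fubini') measurable
  also have "\<dots> = (\<integral>\<^sup>+\<eta>. ?K * (v \<eta>)\<^sup>2 \<partial>lborel)"
    by (intro nn_integral_cong) (simp add: nn_integral_multc shift')
  also have "\<dots> = ?K * (\<integral>\<^sup>+\<eta>. (v \<eta>)\<^sup>2 \<partial>lborel)"
    by (rule nn_integral_cmult) measurable
  finally show ?thesis by (simp add: power2_eq_square mult.assoc)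
qed

lemma powr_half_sq: "x > 0 \<Longrightarrow> (x powr (r / 2))\<^sup>2 = (x::real) powr r"
  by (simp add: power2_eq_square powr_add[symmetric])

context dispersion_test
begin

text \<open>
  This makes \<open>h (\<xi> - \<eta>) * S \<eta>\<close> an admissible test function for the distributional Fourier transform
  of a Sobolev distribution.
\<close>

lemma S_multiplier_schwartz: "(\<lambda>\<eta>. h (\<xi> - \<eta>) * of_real (S \<eta>)) \<in> schwartz_space"
proof -
  let ?g = "\<lambda>y \<eta>. y ^ 0 * \<eta> ^ 0 * S \<eta> powr 1 * exp (- y * S \<eta>)"
  have g: "exp_symbol (real 0 + 1 - real 0) ?g" by (rule exp_symbol.monom)
  obtain D where D0: "D 0 = ?g" and Ds: "\<And>k. exp_symbol (real 0 + 1 - real 0 - real k) (D k)"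
    and Dd: "\<And>k y \<eta>. (D k y has_real_derivative D (Suc k) y \<eta>) (at \<eta>)"
    using exp_symbol_derivs[OF g] by blast
  have j: "jet UNIV (\<lambda>k \<eta>. complex_of_real (D k 0 \<eta>))"
    unfolding jet_def using Dd by (auto intro: has_vector_derivative_of_real)
  have p: "poly_growth (\<lambda>\<eta>. complex_of_real (D k 0 \<eta>))" for k
    unfolding poly_growth_def
  proof (intro conjI)
    show "continuous_on UNIV (\<lambda>\<eta>. complex_of_real (D k 0 \<eta>))" by (intro continuous_intros exp_symbol_cont[OF Ds])
    obtain C where C: "C \<ge> 0" "\<And>y \<eta>. y \<ge> 0 \<Longrightarrow> \<bar>D k y \<eta>\<bar> \<le> C * (1 + \<bar>\<eta>\<bar>) powr (real 0 + 1 - real 0 - real k)"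
      using exp_symbol_bound[OF Ds] by blast
    have "cmod (of_real (D k 0 \<eta>)) \<le> C * (1 + \<bar>\<eta>\<bar>) ^ 1" for \<eta>
    proof -
      have "(1 + \<bar>\<eta>\<bar>) powr (real 0 + 1 - real 0 - real k) \<le> (1 + \<bar>\<eta>\<bar>) powr 1" by (intro powr_mono) auto
      then show ?thesis using C(2)[of 0 \<eta>] mult_left_mono[OF _ C(1)] by fastforce
    qed
    then show "\<exists>K n. \<forall>x. cmod (of_real (D k 0 x)) \<le> K * (1 + \<bar>x\<bar>) ^ n" by blast
  qed
  have r: "rapid (\<lambda>\<eta>. (- 1) ^ k * fourier (\<lambda>x. f x * (- \<i> * of_real x) ^ k) (\<xi> - \<eta>))" for k
  proof -
    have "rapid (\<lambda>\<eta>. fourier (\<lambda>x. f x * (- \<i> * of_real x) ^ k) (\<xi> - \<eta>) * (- 1) ^ k)"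
      by (intro rapid_mult rapid_reflect fourier_rapid[OF _ ab] test_fun_mult_x_power f poly_growth_const)
    then show ?thesis by (simp only: mult.commute)
  qed
  show ?thesis
    using schwartz_mult[OF jet_reflect[OF fourier_jet[OF f ab], of \<xi>] r j p] less_imp_le[OF S_pos] by (simp add: D0)
qed

lemma rapid_weight_bounded_integral:
  "(\<integral>\<^sup>+x. ennreal (c * cmod (h x) * (1 + x\<^sup>2) powr r) \<partial>lborel) < \<infinity>" if "c \<ge> 0" "r \<ge> 0"
proof -
  define N where "N = 2 * nat \<lceil>r\<rceil>"
  have rN: "2 * r \<le> real N" unfolding N_def by linarith
  have "(1 + x\<^sup>2) powr r \<le> (1 + \<bar>x\<bar>) ^ N" for x :: real
  proof -
    have "(1 + x\<^sup>2) powr r \<le> ((1 + \<bar>x\<bar>)\<^sup>2) powr r"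
      using that by (intro powr_mono2) (auto simp: power2_eq_square algebra_simps)
    also have "\<dots> = (1 + \<bar>x\<bar>) powr (2 * r)" by (simp add: powr_powr[symmetric] powr_numeral)
    also have "\<dots> \<le> (1 + \<bar>x\<bar>) powr real N" by (intro powr_mono rN) auto
    finally show ?thesis by (simp add: powr_realpow)
  qed
  then have "(\<integral>\<^sup>+x. ennreal (c * cmod (h x) * (1 + x\<^sup>2) powr r) \<partial>lborel)
     \<le> (\<integral>\<^sup>+x. ennreal (c * ((1 + \<bar>x\<bar>) ^ N * cmod (h x))) \<partial>lborel)"
    using that by (intro nn_integral_mono ennreal_leI) (simp add: mult.assoc mult_left_mono mult.commute)
  also have "\<dots> = ennreal (\<integral>x. c * ((1 + \<bar>x\<bar>) ^ N * cmod (h x)) \<partial>lborel)"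
    using that by (intro nn_integral_eq_integral integrable_mult_right rapid_integrable_weight[OF h_rapid]) auto
  finally show ?thesis by (rule le_less_trans) simp
qed

text \<open>
  Peetre's inequality distributes the weight \<open>(1 + \<xi>\<^sup>2) powr ((s - 1) / 2)\<close> over the two factors of the
  convolution. The one falling on \<open>h\<close> is harmless, and the one falling on \<open>S g\<close> combines with
  \<open>S\<^sup>2 \<le> (A + B) (1 + \<eta>\<^sup>2)\<close> to the weight of order \<open>s\<close> that \<open>g\<close> can bear.
\<close>

lemma multiplier_convolution:
  assumes g [measurable]: "g \<in> borel_measurable borel"
    and int: "integrable lborel (\<lambda>\<xi>. (1 + \<xi>\<^sup>2) powr s * (cmod (g \<xi>))\<^sup>2)"
  shows "(\<integral>\<^sup>+\<xi>. ennreal ((1 + \<xi>\<^sup>2) powr (s - 1)) *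
     (\<integral>\<^sup>+\<eta>. ennreal (cmod (g \<eta> * (h (\<xi> - \<eta>) * of_real (S \<eta>)))) \<partial>lborel)\<^sup>2 \<partial>lborel) < \<infinity>"
proof -
  let ?r = "(s - 1) / 2"
  note [measurable] = rapid_measurable[OF h_rapid] borel_measurable_continuous_onI[OF S_cont]
  have pos: "1 + x\<^sup>2 > 0" for x :: real by (simp add: add_pos_nonneg)
  define k where "k = (\<lambda>x. ennreal (2 powr \<bar>?r\<bar> * cmod (h x) * (1 + x\<^sup>2) powr \<bar>?r\<bar>))"
  define v where "v = (\<lambda>\<eta>. ennreal ((1 + \<eta>\<^sup>2) powr ?r * (S \<eta> * cmod (g \<eta>))))"
  have [measurable]: "k \<in> borel_measurable borel" "v \<in> borel_measurable borel"
    unfolding k_def v_def by measurable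
  have K: "(\<integral>\<^sup>+x. k x \<partial>lborel) < \<infinity>"
    unfolding k_def by (rule rapid_weight_bounded_integral) auto
  have "(v \<eta>)\<^sup>2 \<le> ennreal ((A + B) * ((1 + \<eta>\<^sup>2) powr s * (cmod (g \<eta>))\<^sup>2))" for \<eta>
  proof -
    have "(v \<eta>)\<^sup>2 = ennreal (((1 + \<eta>\<^sup>2) powr ?r * (S \<eta> * cmod (g \<eta>)))\<^sup>2)"
      unfolding v_def using S_pos[of \<eta>] by (intro ennreal_power) simp
    also have "((1 + \<eta>\<^sup>2) powr ?r * (S \<eta> * cmod (g \<eta>)))\<^sup>2 = (1 + \<eta>\<^sup>2) powr (s - 1) * ((A * \<eta>\<^sup>2 + B) * (cmod (g \<eta>))\<^sup>2)"
      using powr_half_sq[OF pos, of \<eta> "s - 1"] by (simp add: power_mult_distrib S_sq)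
    also have "\<dots> \<le> (1 + \<eta>\<^sup>2) powr (s - 1) * (((A + B) * (1 + \<eta>\<^sup>2)) * (cmod (g \<eta>))\<^sup>2)"
      using A B by (intro mult_left_mono mult_right_mono) (auto simp: algebra_simps)
    also have "\<dots> = (A + B) * ((1 + \<eta>\<^sup>2) powr (s - 1) * (1 + \<eta>\<^sup>2) powr 1 * (cmod (g \<eta>))\<^sup>2)"
      using pos[of \<eta>] by (simp add: mult_ac)
    also have "(1 + \<eta>\<^sup>2) powr (s - 1) * (1 + \<eta>\<^sup>2) powr 1 = (1 + \<eta>\<^sup>2) powr s"
      by (simp only: powr_add[symmetric]) simp
    finally show ?thesis by (simp add: ennreal_leI)
  qed
  then have "(\<integral>\<^sup>+\<eta>. (v \<eta>)\<^sup>2 \<partial>lborel) \<le> (\<integral>\<^sup>+\<eta>. ennreal ((A + B) * ((1 + \<eta>\<^sup>2) powr s * (cmod (g \<eta>))\<^sup>2)) \<partial>lborel)"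
    by (intro nn_integral_mono)
  also have "\<dots> = ennreal (\<integral>\<eta>. (A + B) * ((1 + \<eta>\<^sup>2) powr s * (cmod (g \<eta>))\<^sup>2) \<partial>lborel)"
    using A B by (intro nn_integral_eq_integral integrable_mult_right int) auto
  finally have V: "(\<integral>\<^sup>+\<eta>. (v \<eta>)\<^sup>2 \<partial>lborel) < \<infinity>" by (rule le_less_trans) simp
  have le: "ennreal ((1 + \<xi>\<^sup>2) powr (s - 1)) * (\<integral>\<^sup>+\<eta>. ennreal (cmod (g \<eta> * (h (\<xi> - \<eta>) * of_real (S \<eta>)))) \<partial>lborel)\<^sup>2
     \<le> (\<integral>\<^sup>+\<eta>. k (\<xi> - \<eta>) * v \<eta> \<partial>lborel)\<^sup>2" for \<xi>
  proof -
    have "ennreal ((1 + \<xi>\<^sup>2) powr (s - 1)) = (ennreal ((1 + \<xi>\<^sup>2) powr ?r))\<^sup>2"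
      by (subst ennreal_power) (simp_all add: powr_half_sq[OF pos])
    then have "ennreal ((1 + \<xi>\<^sup>2) powr (s - 1)) * (\<integral>\<^sup>+\<eta>. ennreal (cmod (g \<eta> * (h (\<xi> - \<eta>) * of_real (S \<eta>)))) \<partial>lborel)\<^sup>2
       = (ennreal ((1 + \<xi>\<^sup>2) powr ?r) * (\<integral>\<^sup>+\<eta>. ennreal (cmod (g \<eta> * (h (\<xi> - \<eta>) * of_real (S \<eta>)))) \<partial>lborel))\<^sup>2"
      by (simp add: power_mult_distrib)
    also have "ennreal ((1 + \<xi>\<^sup>2) powr ?r) * (\<integral>\<^sup>+\<eta>. ennreal (cmod (g \<eta> * (h (\<xi> - \<eta>) * of_real (S \<eta>)))) \<partial>lborel)
       = (\<integral>\<^sup>+\<eta>. ennreal ((1 + \<xi>\<^sup>2) powr ?r) * ennreal (cmod (g \<eta> * (h (\<xi> - \<eta>) * of_real (S \<eta>)))) \<partial>lborel)"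
      by (rule nn_integral_cmult[symmetric]) measurable
    also have "\<dots> \<le> (\<integral>\<^sup>+\<eta>. k (\<xi> - \<eta>) * v \<eta> \<partial>lborel)"
    proof (rule nn_integral_mono)
      fix \<eta>
      have "(1 + \<xi>\<^sup>2) powr ?r * cmod (g \<eta> * (h (\<xi> - \<eta>) * of_real (S \<eta>)))
        \<le> (2 powr \<bar>?r\<bar> * (1 + (\<xi> - \<eta>)\<^sup>2) powr \<bar>?r\<bar> * (1 + \<eta>\<^sup>2) powr ?r) * cmod (g \<eta> * (h (\<xi> - \<eta>) * of_real (S \<eta>)))"
        by (intro mult_right_mono peetre_weight) auto
      also have "\<dots> = (2 powr \<bar>?r\<bar> * cmod (h (\<xi> - \<eta>)) * (1 + (\<xi> - \<eta>)\<^sup>2) powr \<bar>?r\<bar>) * ((1 + \<eta>\<^sup>2) powr ?r * (S \<eta> * cmod (g \<eta>)))"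
        using S_pos[of \<eta>] by (simp add: norm_mult)
      finally show "ennreal ((1 + \<xi>\<^sup>2) powr ?r) * ennreal (cmod (g \<eta> * (h (\<xi> - \<eta>) * of_real (S \<eta>)))) \<le> k (\<xi> - \<eta>) * v \<eta>"
        unfolding k_def v_def using S_pos[of \<eta>] by (subst (1 2) ennreal_mult[symmetric]) (auto intro: ennreal_leI)
    qed
    finally show ?thesis by (simp add: power_mono)
  qed
  have "(\<integral>\<^sup>+\<xi>. ennreal ((1 + \<xi>\<^sup>2) powr (s - 1)) * (\<integral>\<^sup>+\<eta>. ennreal (cmod (g \<eta> * (h (\<xi> - \<eta>) * of_real (S \<eta>)))) \<partial>lborel)\<^sup>2 \<partial>lborel)
     \<le> (\<integral>\<^sup>+\<xi>. (\<integral>\<^sup>+\<eta>. k (\<xi> - \<eta>) * v \<eta> \<partial>lborel)\<^sup>2 \<partial>lborel)"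
    by (intro nn_integral_mono le)
  also have "\<dots> \<le> (\<integral>\<^sup>+x. k x \<partial>lborel)\<^sup>2 * (\<integral>\<^sup>+\<eta>. (v \<eta>)\<^sup>2 \<partial>lborel)"
    by (rule young_L2) (auto simp: k_def)
  also have "\<dots> < \<infinity>" using K V by (simp add: ennreal_mult_less_top power_less_top_ennreal)
  finally show ?thesis .
qed

text \<open>
  Up to the factor \<open>2 \<pi>\<close>, the Fourier transform of \<open>f u\<close> is the convolution of \<open>h\<close> with that of \<open>u\<close>.
  The term \<open>S * dual_fourier q\<close> then contributes \<open>q\<close> applied to the Fourier transform of the Schwartz
  function \<open>h (\<xi> - \<eta>) * S \<eta>\<close>, which the hypothesis on \<open>q\<close> expresses through its density \<open>g\<close>.
\<close>

lemma local_regularity: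
  assumes u: "u \<in> dual01" and q: "q \<in> dual01" and qs: "natural_extension q \<in> sobolev s"
    and rel: "\<And>\<eta>. dual_fourier u \<eta> = of_real (S \<eta>) * dual_fourier q \<eta> + G \<eta>"
    and G: "negligible G"
    and fs: "f \<in> smooth_on UNIV"
  shows "mult_distribution f (natural_extension u) \<in> sobolev (s - 1)"
proof -
  have f01: "f \<in> smooth_on {0..1}" by (rule smooth_on_UNIV_imp_01[OF fs])
  define v where "v = (\<lambda>\<phi>. u (\<lambda>x. f x * \<phi> x))"
  have v: "v \<in> dual01" unfolding v_def by (rule dual01_mult[OF u f01])
  have w: "mult_distribution f (natural_extension u) \<phi> = v \<phi>" if "\<phi> \<in> smooth_on UNIV" for \<phi>
  proof -
    have "(\<lambda>x. f x * \<phi> x) \<in> smooth_on UNIV"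
      using smooth_on_UNIV_I[OF jet_mult[OF jet_nderiv_within[OF fs] jet_nderiv_within[OF that]]] by simp
    then show ?thesis unfolding mult_distribution_def v_def by (rule natural_extension_eq[OF u])
  qed
  obtain g where g: "g \<in> borel_measurable lborel"
    and gi: "integrable lborel (\<lambda>\<xi>. (1 + \<xi>\<^sup>2) powr s * (cmod (g \<xi>))\<^sup>2)"
    and gq: "\<And>\<phi>. \<phi> \<in> schwartz_space \<Longrightarrow> natural_extension q (fourier \<phi>) = (\<integral>\<xi>. g \<xi> * \<phi> \<xi> \<partial>lborel)"
    using qs unfolding sobolev_def by blast
  have gm [measurable]: "g \<in> borel_measurable borel" using g by simp
  note [measurable] = rapid_measurable[OF h_rapid] borel_measurable_continuous_onI[OF S_cont]
  let ?R = "\<lambda>\<xi>. \<integral>\<eta>. h (\<xi> - \<eta>) * G \<eta> \<partial>lborel"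
  let ?P = "\<lambda>\<xi>. \<integral>\<eta>. g \<eta> * (h (\<xi> - \<eta>) * of_real (S \<eta>)) \<partial>lborel"
  have eq: "of_real (2 * pi) * dual_fourier v \<xi> = ?P \<xi> + ?R \<xi>" for \<xi>
  proof -
    have r: "rapid (\<lambda>\<eta>. h (\<xi> - \<eta>))" by (rule rapid_reflect[OF h_rapid])
    have rS: "(\<lambda>\<eta>. h (\<xi> - \<eta>) * of_real (S \<eta>)) \<in> schwartz_space" by (rule S_multiplier_schwartz)
    have F: "fourier (\<lambda>\<eta>. h (\<xi> - \<eta>)) = (\<lambda>t. of_real (2 * pi) * (f t * exp (of_real t * (- \<i> * of_real \<xi>))))"
      by (intro ext fourier_fourier_shift[OF f ab])
    have "of_real (2 * pi) * dual_fourier v \<xi> = u (fourier (\<lambda>\<eta>. h (\<xi> - \<eta>)))"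
      unfolding F v_def dual_fourier_def
      by (rule dual01_cmult[OF u smooth01_mult[OF f01 exp_smooth01], symmetric])
    also have "\<dots> = (\<integral>\<eta>. h (\<xi> - \<eta>) * dual_fourier u \<eta> \<partial>lborel)" by (rule dual_fourier_exchange[OF u r])
    also have "\<dots> = (\<integral>\<eta>. h (\<xi> - \<eta>) * of_real (S \<eta>) * dual_fourier q \<eta> + h (\<xi> - \<eta>) * G \<eta> \<partial>lborel)"
      unfolding rel by (simp only: distrib_left mult.assoc)
    also have "\<dots> = (\<integral>\<eta>. h (\<xi> - \<eta>) * of_real (S \<eta>) * dual_fourier q \<eta> \<partial>lborel) + ?R \<xi>"
      by (rule Bochner_Integration.integral_add[OF dual_fourier_exchange(1)[OF q schwartz_rapid[OF rS]]]) (use G in \<open>simp add: negligible_def\<close>)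
    also have "(\<integral>\<eta>. h (\<xi> - \<eta>) * of_real (S \<eta>) * dual_fourier q \<eta> \<partial>lborel) = q (fourier (\<lambda>\<eta>. h (\<xi> - \<eta>) * of_real (S \<eta>)))"
      by (rule dual_fourier_exchange(2)[OF q schwartz_rapid[OF rS], symmetric])
    also have "\<dots> = ?P \<xi>"
      using gq[OF rS] natural_extension_eq[OF q rapid_fourier_smooth[OF schwartz_rapid[OF rS]]] by simp
    finally show ?thesis .
  qed
  let ?T = "\<lambda>\<xi>. \<integral>\<^sup>+\<eta>. ennreal (cmod (g \<eta> * (h (\<xi> - \<eta>) * of_real (S \<eta>)))) \<partial>lborel"
  have PT: "ennreal (cmod (?P \<xi>)) \<le> ?T \<xi>" for \<xi>
    using integral_norm_bound_ennreal[of lborel "\<lambda>\<eta>. g \<eta> * (h (\<xi> - \<eta>) * of_real (S \<eta>))"]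
    by (cases "integrable lborel (\<lambda>\<eta>. g \<eta> * (h (\<xi> - \<eta>) * of_real (S \<eta>)))") (auto simp: not_integrable_integral_eq)
  define M where "M = Suc (nat \<lceil>\<bar>s - 1\<bar>\<rceil>)"
  obtain C where C: "C \<ge> 0" "\<And>\<xi>. (1 + \<bar>\<xi>\<bar>) ^ M * cmod (?R \<xi>) \<le> C" using G unfolding negligible_def by blast
  have Rb: "(1 + \<xi>\<^sup>2) powr (s - 1) * (cmod (?R \<xi>))\<^sup>2 \<le> C\<^sup>2 * (1 / (1 + \<bar>\<xi>\<bar>)\<^sup>2)" for \<xi>
  proof -
    have p: "1 + \<bar>\<xi>\<bar> \<ge> 1" "1 + \<bar>\<xi>\<bar> > 0" by auto
    have "(1 + \<xi>\<^sup>2) powr (s - 1) \<le> (1 + \<xi>\<^sup>2) powr \<bar>s - 1\<bar>" by (intro powr_mono) auto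
    also have "\<dots> \<le> ((1 + \<bar>\<xi>\<bar>)\<^sup>2) powr \<bar>s - 1\<bar>"
      by (intro powr_mono2) (auto simp: power2_eq_square algebra_simps)
    also have "\<dots> \<le> ((1 + \<bar>\<xi>\<bar>)\<^sup>2) powr real (M - 1)"
      unfolding M_def by (intro powr_mono) (auto simp: power2_eq_square algebra_simps)
    also have "\<dots> = ((1 + \<bar>\<xi>\<bar>)\<^sup>2) ^ (M - 1)" using p by (intro powr_realpow) simp
    finally have 1: "(1 + \<xi>\<^sup>2) powr (s - 1) \<le> ((1 + \<bar>\<xi>\<bar>)\<^sup>2) ^ (M - 1)" .
    have "((1 + \<bar>\<xi>\<bar>)\<^sup>2) * ((1 + \<xi>\<^sup>2) powr (s - 1) * (cmod (?R \<xi>))\<^sup>2)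
        \<le> ((1 + \<bar>\<xi>\<bar>)\<^sup>2) * (((1 + \<bar>\<xi>\<bar>)\<^sup>2) ^ (M - 1) * (cmod (?R \<xi>))\<^sup>2)"
      by (intro mult_left_mono mult_right_mono 1) auto
    also have "\<dots> = ((1 + \<bar>\<xi>\<bar>) ^ M * cmod (?R \<xi>))\<^sup>2"
      unfolding M_def by (simp add: power_mult_distrib power_mult[symmetric] mult.commute)
    also have "\<dots> \<le> C\<^sup>2" by (intro power_mono C) auto
    finally show ?thesis using p by (simp add: field_simps)
  qed
  have bound: "ennreal ((1 + \<xi>\<^sup>2) powr (s - 1) * (cmod (dual_fourier v \<xi>))\<^sup>2)
     \<le> 2 * (ennreal ((1 + \<xi>\<^sup>2) powr (s - 1)) * (?T \<xi>)\<^sup>2) + ennreal (2 * C\<^sup>2 * (1 / (1 + \<bar>\<xi>\<bar>)\<^sup>2))" for \<xi>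
  proof -
    let ?W = "(1 + \<xi>\<^sup>2) powr (s - 1)"
    have "cmod (dual_fourier v \<xi>) \<le> 2 * pi * cmod (dual_fourier v \<xi>)"
      using pi_ge_two by (simp add: mult_le_cancel_right1)
    also have "\<dots> = cmod (?P \<xi> + ?R \<xi>)" unfolding eq[symmetric] norm_mult by simp
    also have "\<dots> \<le> cmod (?P \<xi>) + cmod (?R \<xi>)" by (rule norm_triangle_ineq)
    finally have "(cmod (dual_fourier v \<xi>))\<^sup>2 \<le> (cmod (?P \<xi>) + cmod (?R \<xi>))\<^sup>2" by (intro power_mono) auto
    also have "\<dots> \<le> 2 * (cmod (?P \<xi>))\<^sup>2 + 2 * (cmod (?R \<xi>))\<^sup>2"
      using zero_le_power2[of "cmod (?P \<xi>) - cmod (?R \<xi>)"] by (simp add: power2_sum power2_diff)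
    finally have "?W * (cmod (dual_fourier v \<xi>))\<^sup>2 \<le> ?W * (2 * (cmod (?P \<xi>))\<^sup>2 + 2 * (cmod (?R \<xi>))\<^sup>2)"
      by (intro mult_left_mono) auto
    also have "\<dots> = 2 * (?W * (cmod (?P \<xi>))\<^sup>2) + 2 * (?W * (cmod (?R \<xi>))\<^sup>2)" by (simp only: distrib_left mult_ac)
    also have "\<dots> \<le> 2 * (?W * (cmod (?P \<xi>))\<^sup>2) + 2 * C\<^sup>2 * (1 / (1 + \<bar>\<xi>\<bar>)\<^sup>2)" using Rb[of \<xi>] by (simp only: mult.assoc)
    finally have "ennreal (?W * (cmod (dual_fourier v \<xi>))\<^sup>2)
       \<le> ennreal (2 * (?W * (cmod (?P \<xi>))\<^sup>2) + 2 * C\<^sup>2 * (1 / (1 + \<bar>\<xi>\<bar>)\<^sup>2))" by (rule ennreal_leI)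
    also have "\<dots> = ennreal (2 * (?W * (cmod (?P \<xi>))\<^sup>2)) + ennreal (2 * C\<^sup>2 * (1 / (1 + \<bar>\<xi>\<bar>)\<^sup>2))"
      by (intro ennreal_plus) auto
    also have "ennreal (2 * (?W * (cmod (?P \<xi>))\<^sup>2)) = 2 * (ennreal ?W * (ennreal (cmod (?P \<xi>)))\<^sup>2)"
      by (simp add: ennreal_mult ennreal_power)
    also have "\<dots> \<le> 2 * (ennreal ?W * (?T \<xi>)\<^sup>2)"
      by (intro mult_left_mono power_mono PT) auto
    finally show ?thesis by (simp add: add_right_mono)
  qed
  have "integrable lborel (\<lambda>\<xi>. (1 + \<xi>\<^sup>2) powr (s - 1) * (cmod (dual_fourier v \<xi>))\<^sup>2)"
  proof (rule integrableI_bounded)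
    have [measurable]: "dual_fourier v \<in> borel_measurable borel"
      by (rule borel_measurable_continuous_onI[OF dual_fourier_continuous[OF v]])
    show "(\<lambda>\<xi>. (1 + \<xi>\<^sup>2) powr (s - 1) * (cmod (dual_fourier v \<xi>))\<^sup>2) \<in> borel_measurable lborel"
      by measurable
    have "(\<integral>\<^sup>+\<xi>. ennreal (norm ((1 + \<xi>\<^sup>2) powr (s - 1) * (cmod (dual_fourier v \<xi>))\<^sup>2)) \<partial>lborel)
      \<le> (\<integral>\<^sup>+\<xi>. 2 * (ennreal ((1 + \<xi>\<^sup>2) powr (s - 1)) * (?T \<xi>)\<^sup>2) + ennreal (2 * C\<^sup>2 * (1 / (1 + \<bar>\<xi>\<bar>)\<^sup>2)) \<partial>lborel)"
      using bound by (intro nn_integral_mono) simp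
    also have "\<dots> = (\<integral>\<^sup>+\<xi>. 2 * (ennreal ((1 + \<xi>\<^sup>2) powr (s - 1)) * (?T \<xi>)\<^sup>2) \<partial>lborel) + (\<integral>\<^sup>+\<xi>. ennreal (2 * C\<^sup>2 * (1 / (1 + \<bar>\<xi>\<bar>)\<^sup>2)) \<partial>lborel)"
      by (rule nn_integral_add) measurable
    also have "(\<integral>\<^sup>+\<xi>. 2 * (ennreal ((1 + \<xi>\<^sup>2) powr (s - 1)) * (?T \<xi>)\<^sup>2) \<partial>lborel) = 2 * (\<integral>\<^sup>+\<xi>. ennreal ((1 + \<xi>\<^sup>2) powr (s - 1)) * (?T \<xi>)\<^sup>2 \<partial>lborel)"
      by (rule nn_integral_cmult) measurable
    also have "(\<integral>\<^sup>+\<xi>. ennreal (2 * C\<^sup>2 * (1 / (1 + \<bar>\<xi>\<bar>)\<^sup>2)) \<partial>lborel) = ennreal (\<integral>\<xi>. 2 * C\<^sup>2 * (1 / (1 + \<bar>\<xi>\<bar>)\<^sup>2) \<partial>lborel)"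
      by (intro nn_integral_eq_integral integrable_mult_right integrable_inverse_bracket_sq) auto
    also have "2 * (\<integral>\<^sup>+\<xi>. ennreal ((1 + \<xi>\<^sup>2) powr (s - 1)) * (?T \<xi>)\<^sup>2 \<partial>lborel) + \<dots> < \<infinity>"
      using multiplier_convolution[OF gm gi] by (simp add: ennreal_mult_less_top)
    finally show "(\<integral>\<^sup>+\<xi>. ennreal (norm ((1 + \<xi>\<^sup>2) powr (s - 1) * (cmod (dual_fourier v \<xi>))\<^sup>2)) \<partial>lborel) < \<infinity>" .
  qed
  then show ?thesis by (intro sobolev_criterion[where v = v] v w)
qed

end

section \<open>Convex polygons\<close>

text \<open>
  The strict inequality in the interior extends to the hull, since a convex set with nonempty interior
  is contained in the closure of its interior. Here the interior is nonempty because it has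
  a nonempty frontier.
\<close>

lemma convex_polygon_half_plane:
  assumes P: "convex_polygon n z \<Omega>" and i: "i < n" and w: "w \<in> convex hull (z ` {..<n})"
  shows "Im (cnj (z (Suc i mod n) - z i) * (w - z i)) \<ge> 0"
proof -
  let ?H = "convex hull (z ` {..<n})"
  have \<Omega>: "\<Omega> = interior ?H" and fr: "frontier \<Omega> = (\<Union>i<n. closed_segment (z i) (z (Suc i mod n)))"
    and pos: "\<And>w. w \<in> \<Omega> \<Longrightarrow> Im (cnj (z (Suc i mod n) - z i) * (w - z i)) > 0"
    using P i unfolding convex_polygon_def by blast+
  have "frontier \<Omega> \<noteq> {}" unfolding fr using i by fastforce
  then have "\<Omega> \<noteq> {}" by auto
  then have "closure \<Omega> = closure ?H"
    unfolding \<Omega> by (intro convex_closure_interior convex_convex_hull) simp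
  then have w': "w \<in> closure \<Omega>" using w closure_subset by blast
  have "closed {w. Im (cnj (z (Suc i mod n) - z i) * (w - z i)) \<ge> 0}"
    by (intro closed_Collect_le continuous_intros)
  then have "closure \<Omega> \<subseteq> {w. Im (cnj (z (Suc i mod n) - z i) * (w - z i)) \<ge> 0}"
    using pos by (intro closure_minimal) (auto intro: less_imp_le)
  then show ?thesis using w' by blast
qed

text \<open>
  Of three distinct points on a line, one lies between the other two and is not extreme.
\<close>

lemma extreme_point_on_line:
  assumes ext: "p extreme_point_of H" "a extreme_point_of H" "b extreme_point_of H"
    and p: "p = a + of_real r * (b - a)" and ab: "a \<noteq> (b :: complex)"
  shows "p = a \<or> p = b"
proof -
  have H: "p \<in> H" "a \<in> H" "b \<in> H" using ext by (auto simp: extreme_point_of_def)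
  have nos: "x \<notin> open_segment y y'" if "x extreme_point_of H" "y \<in> H" "y' \<in> H" for x y y'
    using that unfolding extreme_point_of_def by blast
  consider "r = 0" | "r = 1" | "0 < r" "r < 1" | "r < 0" | "r > 1" by linarith
  then show ?thesis
  proof cases
    case 3
    have "p \<in> open_segment a b"
      unfolding in_segment using 3 ab by (intro conjI exI[of _ r]) (auto simp: p scaleR_conv_of_real algebra_simps)
    then show ?thesis using nos ext H by blast
  next
    case 4
    have "a \<in> open_segment p b"
      unfolding in_segment
    proof (intro conjI exI)
      have "b - p = of_real (1 - r) * (b - a)" by (simp add: p algebra_simps)
      then show "p \<noteq> b" using 4 ab by auto
      show "0 < - r / (1 - r)" "- r / (1 - r) < 1" using 4 by (auto simp: field_simps)
      define u where "u = - r / (1 - r)"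
      have "(1 - u) * r + u = 0" using 4 by (simp add: u_def field_simps)
      moreover have "(1 - u) *\<^sub>R p + u *\<^sub>R b = a + of_real ((1 - u) * r + u) * (b - a)"
        by (simp add: p scaleR_conv_of_real algebra_simps)
      ultimately show "a = (1 - - r / (1 - r)) *\<^sub>R p + (- r / (1 - r)) *\<^sub>R b"
        unfolding u_def[symmetric] by simp
    qed
    then show ?thesis using nos ext H by blast
  next
    case 5
    have "b \<in> open_segment a p"
      unfolding in_segment
    proof (intro conjI exI)
      show "a \<noteq> p" using 5 ab by (auto simp: p)
      show "0 < 1 / r" "1 / r < 1" using 5 by auto
      show "b = (1 - 1 / r) *\<^sub>R a + (1 / r) *\<^sub>R p"
        using 5 by (simp add: p scaleR_conv_of_real field_simps)
    qed
    then show ?thesis using nos ext H by blast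
  qed (auto simp: p)
qed

lemma convex_polygon_distinct:
  assumes P: "convex_polygon n z \<Omega>" and i: "i < n"
  shows "z i \<noteq> z (Suc i mod n)"
proof -
  have n: "n \<ge> 3" and inj: "inj_on z {..<n}" using P by (auto simp: convex_polygon_def)
  have "Suc i mod n \<noteq> i" "Suc i mod n < n" using n i by (auto simp: mod_Suc)
  then show ?thesis using inj_onD[OF inj, of i "Suc i mod n"] i by auto
qed

text \<open>
  A common point of the two sides is not extreme, hence lies in the interior of side \<open>j\<close> too. Both
  end points of side \<open>j\<close> are in the closed half-plane of side \<open>i\<close>, so they lie on its boundary line;
  being extreme, they are the end points of side \<open>i\<close>. As \<open>n \<ge> 3\<close>, this forces \<open>j = i\<close>.
\<close>

lemma other_side_off_open_side:
  assumes P: "convex_polygon n z \<Omega>" and i: "i < n" and j: "j < n" "j \<noteq> i"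
    and w: "w \<in> closed_segment (z j) (z (Suc j mod n))"
    and wr: "w = z i + of_real r * (z (Suc i mod n) - z i)" and r: "0 < r" "r < 1"
  shows False
proof -
  let ?H = "convex hull (z ` {..<n})"
  define a b c d where "a = z i" and "b = z (Suc i mod n)" and "c = z j" and "d = z (Suc j mod n)"
  have n: "n \<ge> 3" and inj: "inj_on z {..<n}" and ext: "{w. w extreme_point_of ?H} = z ` {..<n}"
    using P by (auto simp: convex_polygon_def)
  have lt: "Suc i mod n < n" "Suc j mod n < n" using n by auto
  have e: "a extreme_point_of ?H" "b extreme_point_of ?H" "c extreme_point_of ?H" "d extreme_point_of ?H"
    unfolding a_def b_def c_def d_def using ext lt i j by blast+
  have H: "a \<in> ?H" "b \<in> ?H" "c \<in> ?H" "d \<in> ?H" using e by (auto simp: extreme_point_of_def)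
  have ab: "a \<noteq> b" using convex_polygon_distinct[OF P i] by (simp add: a_def b_def)
  have wab: "w \<in> open_segment a b"
    unfolding in_segment using r ab wr[folded a_def b_def]
    by (intro conjI exI[of _ r]) (auto simp: scaleR_conv_of_real algebra_simps)
  have "w \<noteq> c" "w \<noteq> d" using wab e H unfolding extreme_point_of_def by blast+
  then have "w \<in> open_segment c d" using w by (simp add: open_segment_def c_def d_def)
  then obtain u where u: "0 < u" "u < 1" "w = (1 - u) *\<^sub>R c + u *\<^sub>R d" unfolding in_segment by blast
  define \<phi> where "\<phi> = (\<lambda>w. Im (cnj (b - a) * (w - a)))"
  have \<phi>0: "\<phi> c \<ge> 0" "\<phi> d \<ge> 0"
    using convex_polygon_half_plane[OF P i] H by (auto simp: \<phi>_def a_def b_def)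
  have "w - a = of_real (1 - u) * (c - a) + of_real u * (d - a)"
    using u(3) by (simp add: scaleR_conv_of_real algebra_simps)
  then have "cnj (b - a) * (w - a) = of_real (1 - u) * (cnj (b - a) * (c - a)) + of_real u * (cnj (b - a) * (d - a))"
    by (simp only: distrib_left mult_ac)
  moreover have "Im (of_real x * p + of_real y * p') = x * Im p + y * Im p'" for x y p p' by simp
  ultimately have "\<phi> w = (1 - u) * \<phi> c + u * \<phi> d" by (simp only: \<phi>_def)
  moreover have "\<phi> w = 0"
  proof -
    have "cnj (b - a) * (w - a) = of_real r * (cnj (b - a) * (b - a))" using wr[folded a_def b_def] by (simp add: mult_ac)
    also have "cnj (b - a) * (b - a) = of_real ((cmod (b - a))\<^sup>2)" unfolding complex_norm_square by (rule mult.commute)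
    finally have "cnj (b - a) * (w - a) = of_real (r * (cmod (b - a))\<^sup>2)" by simp
    then show ?thesis unfolding \<phi>_def by (simp only: Im_complex_of_real)
  qed
  moreover have "(1 - u) * \<phi> c \<ge> 0" "u * \<phi> d \<ge> 0" using u \<phi>0 by auto
  ultimately have "(1 - u) * \<phi> c = 0" "u * \<phi> d = 0" by linarith+
  then have z0: "\<phi> c = 0" "\<phi> d = 0" using u by auto
  have line: "p = a \<or> p = b" if p: "p extreme_point_of ?H" "\<phi> p = 0" for p
  proof (rule extreme_point_on_line[OF p(1) e(1,2) _ ab])
    define q where "q = (p - a) / (b - a)"
    have "cnj (b - a) * (p - a) = of_real ((cmod (b - a))\<^sup>2) * q"
      unfolding complex_norm_square q_def using ab by simp
    then have "(cmod (b - a))\<^sup>2 * Im q = 0" using p(2) unfolding \<phi>_def by simp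
    then have "Im q = 0" using ab by simp
    then have "q = of_real (Re q)" by (simp add: complex_eq_iff)
    moreover have "p = a + q * (b - a)" using ab by (simp add: q_def)
    ultimately show "p = a + of_real (Re q) * (b - a)" by simp
  qed
  have cd: "c = a \<or> c = b" "d = a \<or> d = b" using line e z0 by blast+
  have inj': "z k = z l \<Longrightarrow> k = l" if "k < n" "l < n" for k l using inj_onD[OF inj] that by blast
  have 1: "j = Suc i mod n" using cd(1) inj'[OF j(1) i] inj'[OF j(1) lt(1)] j(2) unfolding a_def b_def c_def by blast
  have 2: "Suc j mod n = i \<or> Suc j mod n = Suc i mod n"
    using cd(2) inj'[OF lt(2) i] inj'[OF lt(2) lt(1)] unfolding a_def b_def d_def by blast
  show False using 1 2 n i j by (auto simp: mod_Suc split: if_splits)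
qed

section \<open>Regularity of the Neumann data\<close>

theorem theorem3:
  fixes \<beta> :: real and n :: nat and z :: "nat \<Rightarrow> complex" and \<Omega> :: "complex set"
    and q dq :: "nat \<Rightarrow> (real \<Rightarrow> complex) \<Rightarrow> complex"
    and i :: nat and s :: real
  assumes "\<beta> > 0"
    and "convex_polygon n z \<Omega>"
    and "\<And>j. j < n \<Longrightarrow> q j \<in> dual01"
    and "\<And>j. j < n \<Longrightarrow> dq j \<in> dual01"
    and "\<And>\<mu>. \<mu> \<noteq> 0 \<Longrightarrow> (\<Sum>j<n. rho \<beta> n z q dq j \<mu>) = 0"
    and "i < n"
    and "natural_extension (q i) \<in> sobolev s"
  shows "dq i \<in> sobolev_loc01 (s - 1)"
  unfolding sobolev_loc01_def mem_Collect_eq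
proof
  fix \<phi> assume \<phi>: "\<phi> \<in> test_functions01"
  then obtain a b where ab: "0 < a" "a < b" "b < 1" and tf: "test_fun a b \<phi>"
    by (rule test_function01_test_fun)
  note P = \<open>convex_polygon n z \<Omega>\<close> and i = \<open>i < n\<close>
  define D where "D j = z (Suc j mod n) - z j" for j
  define l where "l = cmod (D i)"
  have D0: "D j \<noteq> 0" if "j < n" for j using convex_polygon_distinct[OF P that] by (simp add: D_def)
  have l: "l > 0" using D0[OF i] by (simp add: l_def)
  define \<omega> where "\<omega> j = exp (\<i> * of_real (side_angle n z j))" for j
  have \<omega>1: "cmod (\<omega> j) = 1" for j by (simp add: \<omega>_def)
  then have \<omega>0: "\<omega> j \<noteq> 0" for j by (metis norm_zero zero_neq_one)
  have D\<omega>: "D i = of_real l * \<omega> i"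
    unfolding l_def \<omega>_def side_angle_def using Arg_eq[OF D0[OF i]] by (simp add: D_def)
  interpret dispersion_test "1 / l\<^sup>2" "4 * \<beta>\<^sup>2" a b \<phi>
    by unfold_locales (use l \<open>\<beta> > 0\<close> tf ab in auto)

  \<comment> \<open>The real part of \<open>c w\<close> is the coordinate \<open>X\<close> along side \<open>i\<close>, scaled to \<open>(0,1)\<close> on the side
     itself; \<open>l\<close> times the imaginary part is the height \<open>y\<close>.\<close>
  define c where "c w = (w - z i) / D i" for w
  have c_diff: "w - z i = of_real l * \<omega> i * c w" for w
    using D0[OF i] unfolding D\<omega>[symmetric] c_def by simp
  have c_inv: "w = z i + of_real l * \<omega> i * c w" for w
    using D0[OF i] unfolding D\<omega>[symmetric] c_def by simp
  define X0 X1 y0 y1 where "X0 j = Re (c (z j))" and "X1 j = Re (c (z (Suc j mod n)) - c (z j))"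
    and "y0 j = l * Im (c (z j))" and "y1 j = l * Im (c (z (Suc j mod n)) - c (z j))" for j
  define W where "W j \<eta> = (\<lambda>t. wave (X0 j + t * X1 j) (y0 j + t * y1 j) \<eta>)" for j \<eta>
  have c_side: "c (side_param n z j t) = c (z j) + of_real t * (c (z (Suc j mod n)) - c (z j))" for j t
    using D0[OF i] by (simp add: c_def side_param_def field_simps)
  have Rec: "X0 j + t * X1 j = Re (c (side_param n z j t))" and Imc: "y0 j + t * y1 j = l * Im (c (side_param n z j t))" for j t
    unfolding c_side X0_def X1_def y0_def y1_def by (simp_all add: algebra_simps)

  \<comment> \<open>The negative root of \<open>l (k - \<beta>\<^sup>2 / k) = \<eta>\<close>; its sign makes the kernel decrease into the polygon.\<close>
  define k where "k \<eta> = (\<eta> / l - S \<eta>) / 2" for \<eta>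
  have kpm: "k \<eta> \<noteq> 0" "\<beta>\<^sup>2 / k \<eta> = - (\<eta> / l + S \<eta>) / 2" for \<eta>
  proof -
    have "(\<eta> / l - S \<eta>) * (\<eta> / l + S \<eta>) = - 4 * \<beta>\<^sup>2"
      using S_sq[of \<eta>] by (simp add: algebra_simps power2_eq_square)
    moreover have "(x - y) / 2 * (- (x + y) / 2) = - ((x - y) * (x + y)) / 4" for x y :: real by (simp add: field_simps)
    ultimately have *: "k \<eta> * (- (\<eta> / l + S \<eta>) / 2) = \<beta>\<^sup>2" by (simp only: k_def)
    then show "k \<eta> \<noteq> 0" using \<open>\<beta> > 0\<close> by auto
    then show "\<beta>\<^sup>2 / k \<eta> = - (\<eta> / l + S \<eta>) / 2" using * by (simp add: field_simps)
  qed
  define \<mu> where "\<mu> \<eta> = of_real (k \<eta>) / \<omega> i" for \<eta>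
  have \<mu>0: "\<mu> \<eta> \<noteq> 0" for \<eta> using kpm(1) \<omega>0 by (simp add: \<mu>_def)
  define E where "E \<eta> = exp_kernel \<beta> (\<mu> \<eta>) (z i)" for \<eta>
  have E0: "E \<eta> \<noteq> 0" for \<eta> by (simp add: E_def exp_kernel_def)
  have cnj_inv: "cnj (\<omega> j) = inverse (\<omega> j)" for j
    using complex_norm_square[of "\<omega> j"] \<omega>1[of j] inverse_unique[of "\<omega> j" "cnj (\<omega> j)"] by simp
  have kernel: "exp_kernel \<beta> (\<mu> \<eta>) w = E \<eta> * wave (Re (c w)) (l * Im (c w)) \<eta>" for \<eta> w
  proof -
    let ?C = "c w"
    have m: "\<mu> \<eta> * (w - z i) = of_real (k \<eta>) * of_real l * ?C"
      unfolding c_diff \<mu>_def using \<omega>0[of i] by simp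
    have cw: "cnj (w - z i) / \<mu> \<eta> = of_real l * cnj ?C / of_real (k \<eta>)"
    proof -
      have "cnj (w - z i) = of_real l * inverse (\<omega> i) * cnj ?C"
        unfolding c_diff by (simp add: cnj_inv)
      then show ?thesis using \<omega>0[of i] by (simp add: \<mu>_def field_simps)
    qed
    have "- \<i> * \<mu> \<eta> * w + \<i> * of_real (\<beta>\<^sup>2) * cnj w / \<mu> \<eta>
       = (- \<i> * \<mu> \<eta> * z i + \<i> * of_real (\<beta>\<^sup>2) * cnj (z i) / \<mu> \<eta>)
         + (- \<i> * (\<mu> \<eta> * (w - z i)) + \<i> * of_real (\<beta>\<^sup>2) * (cnj (w - z i) / \<mu> \<eta>))"
      by (simp add: algebra_simps diff_divide_distrib)
    also have "- \<i> * (\<mu> \<eta> * (w - z i)) + \<i> * of_real (\<beta>\<^sup>2) * (cnj (w - z i) / \<mu> \<eta>)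
       = of_real l * (- \<i> * of_real (k \<eta>) * ?C + \<i> * of_real (\<beta>\<^sup>2 / k \<eta>) * cnj ?C)"
      unfolding m cw by (simp add: algebra_simps)
    also have "\<dots> = - (\<i> * of_real (Re ?C * \<eta>) + of_real (l * Im ?C * S \<eta>))"
      unfolding kpm(2) unfolding k_def using l by (simp add: complex_eq_iff field_simps)
    finally show ?thesis
      unfolding exp_kernel_def E_def wave_def by (simp only: exp_add)
  qed
  \<comment> \<open>As \<open>\<sigma> j\<close> has modulus \<open>1\<close>, the coefficient of \<open>q j\<close> is \<open>k \<sigma> j + \<beta>\<^sup>2 / k * cnj (\<sigma> j)\<close>, a linear
     combination of \<open>\<eta> = l (k - \<beta>\<^sup>2 / k)\<close> and \<open>- S \<eta> = k + \<beta>\<^sup>2 / k\<close>.\<close>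
  define \<sigma> where "\<sigma> j = \<omega> j / \<omega> i" for j
  define \<kappa> where "\<kappa> j \<eta> = \<i> * of_real (Im (\<sigma> j) / l) * of_real \<eta> + - of_real (Re (\<sigma> j)) * of_real (S \<eta>)" for j \<eta>
  have coeff: "\<mu> \<eta> * \<omega> j + of_real (\<beta>\<^sup>2) / (\<mu> \<eta> * \<omega> j) = \<kappa> j \<eta>" for j \<eta>
  proof -
    have "\<mu> \<eta> * \<omega> j = of_real (k \<eta>) * \<sigma> j" by (simp add: \<mu>_def \<sigma>_def)
    moreover have "cnj (\<sigma> j) = inverse (\<sigma> j)" using cnj_inv by (simp add: \<sigma>_def divide_inverse mult.commute)
    then have "of_real (\<beta>\<^sup>2) / (of_real (k \<eta>) * \<sigma> j) = of_real (\<beta>\<^sup>2 / k \<eta>) * cnj (\<sigma> j)"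
      by (simp add: divide_inverse mult_ac)
    ultimately have "\<mu> \<eta> * \<omega> j + of_real (\<beta>\<^sup>2) / (\<mu> \<eta> * \<omega> j) = of_real (k \<eta>) * \<sigma> j + of_real (\<beta>\<^sup>2 / k \<eta>) * cnj (\<sigma> j)"
      by simp
    also have "\<dots> = \<kappa> j \<eta>"
      unfolding kpm(2) unfolding k_def \<kappa>_def using l by (simp add: complex_eq_iff field_simps)
    finally show ?thesis .
  qed
  define T where "T j \<eta> = dq j (W j \<eta>) + \<kappa> j \<eta> * q j (W j \<eta>)" for j \<eta>
  have rho: "rho \<beta> n z q dq j (\<mu> \<eta>) = E \<eta> * (of_real (side_length n z j) * T j \<eta>)" if j: "j < n" for j \<eta>
  proof -
    have "exp_kernel \<beta> (\<mu> \<eta>) \<circ> side_param n z j = (\<lambda>t. E \<eta> * W j \<eta> t)"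
      by (intro ext) (simp add: kernel W_def Rec Imc)
    moreover have "W j \<eta> \<in> smooth_on {0..1}" unfolding W_def by (rule wave_smooth)
    ultimately have "dq j (exp_kernel \<beta> (\<mu> \<eta>) \<circ> side_param n z j) = E \<eta> * dq j (W j \<eta>)"
      "q j (exp_kernel \<beta> (\<mu> \<eta>) \<circ> side_param n z j) = E \<eta> * q j (W j \<eta>)"
      using dual01_cmult[OF assms(3)[OF j]] dual01_cmult[OF assms(4)[OF j]] by simp_all
    then show ?thesis
      unfolding rho_def T_def coeff[of \<eta> j, unfolded \<omega>_def, symmetric] by (simp add: algebra_simps)
  qed
  have sum0: "(\<Sum>j<n. of_real (side_length n z j) * T j \<eta>) = 0" for \<eta>
  proof -
    have "E \<eta> * (\<Sum>j<n. of_real (side_length n z j) * T j \<eta>) = (\<Sum>j<n. rho \<beta> n z q dq j (\<mu> \<eta>))"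
      unfolding sum_distrib_left by (intro sum.cong) (simp_all add: rho)
    then show ?thesis using assms(5)[OF \<mu>0] E0 by simp
  qed
  have li: "side_length n z i = l" by (simp add: side_length_def l_def D_def dist_norm norm_minus_commute)
  have Ti: "T i \<eta> = dual_fourier (dq i) \<eta> - of_real (S \<eta>) * dual_fourier (q i) \<eta>" for \<eta>
  proof -
    have c0: "c (z i) = 0" "c (z (Suc i mod n)) = 1" using D0[OF i] by (auto simp: c_def D_def)
    then have "X0 i = 0" "X1 i = 1" "y0 i = 0" "y1 i = 0" by (auto simp: X0_def X1_def y0_def y1_def)
    then have "W i \<eta> = (\<lambda>t. exp (of_real t * (- \<i> * of_real \<eta>)))"
      by (intro ext) (simp add: W_def wave_def mult_ac)
    moreover have "\<kappa> i \<eta> = - of_real (S \<eta>)" using \<omega>0[of i] by (simp add: \<kappa>_def \<sigma>_def)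
    ultimately show ?thesis by (simp add: T_def dual_fourier_def)
  qed
  \<comment> \<open>The relation is solved for the term of side \<open>i\<close>, on which waves are the Fourier kernel.\<close>
  define G where "G \<eta> = (\<Sum>j\<in>{..<n} - {i}. - of_real (side_length n z j / l) * T j \<eta>)" for \<eta>
  have rel: "dual_fourier (dq i) \<eta> = of_real (S \<eta>) * dual_fourier (q i) \<eta> + G \<eta>" for \<eta>
  proof -
    have "0 = of_real l * T i \<eta> + (\<Sum>j\<in>{..<n} - {i}. of_real (side_length n z j) * T j \<eta>)"
      using sum0[of \<eta>] sum.remove[of "{..<n}" i "\<lambda>j. of_real (side_length n z j) * T j \<eta>"] i by (simp add: li)
    also have "(\<Sum>j\<in>{..<n} - {i}. of_real (side_length n z j) * T j \<eta>) = - of_real l * G \<eta>"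
      unfolding G_def sum_distrib_left using l by (intro sum.cong) auto
    finally have "of_real l * (T i \<eta> - G \<eta>) = 0" by (simp add: right_diff_distrib)
    then have "T i \<eta> = G \<eta>" using l by simp
    then show ?thesis using Ti[of \<eta>] by (simp add: algebra_simps)
  qed
  have "negligible (T j)" if j: "j < n" "j \<noteq> i" for j
  proof -
    have y: "y0 j + t * y1 j \<ge> 0" if t: "t \<in> {0..1}" for t
    proof -
      let ?w = "side_param n z j t"
      have "?w \<in> closed_segment (z j) (z (Suc j mod n))"
        unfolding in_segment side_param_def using t by (intro exI[of _ t]) (auto simp: scaleR_conv_of_real)
      moreover have "closed_segment (z j) (z (Suc j mod n)) \<subseteq> convex hull (z ` {..<n})"
        using j by (intro closed_segment_subset_convex_hull hull_inc) auto
      ultimately have "Im (cnj (D i) * (?w - z i)) \<ge> 0"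
        using convex_polygon_half_plane[OF P i] unfolding D_def by blast
      also have "cnj (D i) * (?w - z i) = of_real (l\<^sup>2) * c ?w"
        unfolding l_def complex_norm_square c_def using D0[OF i] by simp
      finally have "l\<^sup>2 * Im (c ?w) \<ge> 0" by simp
      then show ?thesis unfolding Imc using l by (simp add: zero_le_mult_iff)
    qed
    have X: "X0 j + t * X1 j \<notin> {a..b}" if t: "t \<in> {0..1}" and "y0 j + t * y1 j = 0" for t
    proof
      let ?w = "side_param n z j t"
      assume "X0 j + t * X1 j \<in> {a..b}"
      then have re: "0 < Re (c ?w)" "Re (c ?w) < 1" unfolding Rec using ab by auto
      have "Im (c ?w) = 0" using that(2) l unfolding Imc by simp
      then have "c ?w = of_real (Re (c ?w))" by (simp add: complex_eq_iff)
      then have "?w = z i + of_real (Re (c ?w)) * D i" using c_inv[of ?w] unfolding D\<omega> by (simp add: mult_ac)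
      moreover have "?w \<in> closed_segment (z j) (z (Suc j mod n))"
        unfolding in_segment side_param_def using t by (intro exI[of _ t]) (auto simp: scaleR_conv_of_real)
      ultimately show False using other_side_off_open_side[OF P i j] re unfolding D_def by blast
    qed
    obtain \<delta> where \<delta>: "\<delta> > 0" "\<And>t. t \<in> {0..1} \<Longrightarrow> away \<delta> (X0 j + t * X1 j) (y0 j + t * y1 j)"
      using away_segment[OF y X] by blast
    have "negligible (\<lambda>\<eta>. 1 * dq j (W j \<eta>))"
      unfolding W_def by (rule segment_negligible[OF assms(4)[OF j(1)] poly_symbol_const \<delta>])
    moreover have "negligible (\<lambda>\<eta>. \<kappa> j \<eta> * q j (W j \<eta>))"
      unfolding W_def \<kappa>_def by (rule segment_negligible[OF assms(3)[OF j(1)] poly_symbol_linear \<delta>])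
    ultimately show ?thesis unfolding T_def[abs_def] using negligible_add by fastforce
  qed
  then have "negligible G"
    unfolding G_def[abs_def] by (intro negligible_sum negligible_cmult) auto
  then show "mult_distribution \<phi> (natural_extension (dq i)) \<in> sobolev (s - 1)"
    using \<phi> by (intro local_regularity[OF assms(4)[OF i] assms(3)[OF i] assms(7) rel]) (auto simp: test_functions01_def)
qed

end
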